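(* Let $c$ be a tensorized circuit over variables $\mathbf{X}$. Assume that each input layer in $c$ encodes a set of orthonormal functions. Then there exists an algorithm returning, in polynomial time, an orthonormal circuit $c'$ such that $c'$ is equivalent to $c$ up to a multiplicative constant, i.e., $$c'(\mathbf{X})=Z^{-\frac12}\,c(\mathbf{X}),\qquad\text{where } Z=\int_{\mathrm{dom}(\mathbf{X})}|c(\mathbf{x})|^2\,\mathrm{d}\mathbf{x}.$$
   Context: Variables: $\mathbf{X}=\{X_i\}_{i=1}^d$ is a finite set of variables, each with a domain $\mathrm{dom}(X_i)$, and $\mathrm{dom}(\mathbf{X})$ is the product of the domains. For discrete variables, integrals over the domain are sums. $[n]=\{1,\dots,n\}$; $(\cdot)^*$ is complex conjugation; $(\cdot)^\dagger$ is the conjugate transpose; $\mathbf{I}_n$ is the $n\times n$ identity matrix; $\delta_{ij}$ is the Kronecker delta. The expression $Z^{-1/2}$ presupposes $Z\neq 0$. Tensorized circuit: a tensorized circuit $c$ over $\mathbf{X}$ is a parameterized computational graph (finite and acyclic) encoding a function $c(\mathbf{X})$ and comprising three kinds of layers: input, product and sum. A layer $\ell$ is a vector-valued function defined over a set of variables $\mathrm{sc}(\ell)\subseteq\mathbf{X}$, called its scope. Every non-input layer receives the outputs of other layers as inputs, and its scope is the union of the scopes of its inputs. - Each input layer has scope a single variable $X\in\mathbf{X}$ and computes a vector of $K$ functions $f_1,\dots,f_K:\mathrm{dom}(X)\to\mathbb{C}$. - Each product layer computes either the element-wise (Hadamard) product $\odot_{i=1}^N\ell_i(\mathrm{sc}(\ell_i))$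 or the Kronecker product $\otimes_{i=1}^N\ell_i(\mathrm{sc}(\ell_i))$ of the output vectors of its $N$ inputs $\ell_1,\dots,\ell_N$. - Each sum layer has exactly one input $\ell_1$, is parameterized by a matrix $\mathbf{W}\in\mathbb{C}^{K_1\times K_2}$, and computes $\mathbf{W}\,\ell_1(\mathrm{sc}(\ell_1))$. The output layer of the circuit outputs a scalar, which is $c(\mathbf{x})\in\mathbb{C}$. Polynomial time: polynomial with respect to the number of layers and the layer size of $c$, where a Hadamard layer with $N$ inputs of width $K$ has size $NK$; a Kronecker layer with $N$ inputs of width $K$ has size $NK^N$; a sum layer with parameter matrix in $\mathbb{C}^{K_1\times K_2}$ has size $K_1K_2$. An input layer computing $K$ functions is taken to have size $K$. Time counts exact arithmetic operations on complex numbers (including square roots of non-negative reals). An input layer over a variable $X$ computing $f_1,\dots,f_K$ encodes a set of orthonormal functions if $\int_{\mathrm{dom}(X)}f_i(x)f_j(x)^*\,\mathrm{d}x=\delta_{ij}$ for all $i,j\in[K]$. Orthonormal circuit: a tensorized circuit is orthonormal if (1) each input layer encodes a set of orthonormal functions, and (2) each sum layer is parameterized by a (semi-)unitary matrix $\mathbf{W}\in\mathbb{C}^{K_1\times K_2}$ with $K_1\le K_2$, i.e., $\mathbf{W}\mathbf{W}^\dagger=\mathbf{I}_{K_1}$ (the rows of $\mathbf{W}$ are orthonormal).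
   Formalization: The circuit c is also assumed decomposable (inputs of each product layer have disjoint scopes); without this Z can be infinite, e.g. c = f·f with f in L² but not in L⁴. The output layer is taken to have scope X, and Z is nonzero. *)

theory Defs
  imports
    "HOL-Analysis.Bochner_Integration"
    "Jordan_Normal_Form.Matrix"
    "Jordan_Normal_Form.Schur_Decomposition"
begin

section \<open>Tensorized circuits\<close>

text \<open>
  A finite acyclic graph of layers is represented by a topologically sorted list: a layer is
  referred to by its position, and the layer at position \<open>i\<close> may only receive the outputs of layers
  at positions below \<open>i\<close> (see \<open>wf_layer\<close>). The last layer is the output layer. Variables are the
  numbers \<open>1, \<dots>, d\<close>, and an assignment to them is a function on \<open>nat\<close> of which only the values on
  \<open>{1..d}\<close> matter.
\<close>

datatype 'a layer =
    Input nat "('a \<Rightarrow> complex) list"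
  | Hadamard "nat list"
  | Kronecker "nat list"
  | Sum "complex mat" nat

type_synonym 'a circuit = "'a layer list"

definition hadamard_vecs :: "complex vec list \<Rightarrow> complex vec" where
  "hadamard_vecs us = vec (dim_vec (hd us)) (\<lambda>i. \<Prod>u\<leftarrow>us. vec_index u i)"

definition kron_vec :: "complex vec \<Rightarrow> complex vec \<Rightarrow> complex vec" where
  "kron_vec u v = vec (dim_vec u * dim_vec v)
     (\<lambda>i. vec_index u (i div dim_vec v) * vec_index v (i mod dim_vec v))"

definition kronecker_vecs :: "complex vec list \<Rightarrow> complex vec" where
  "kronecker_vecs us = foldr kron_vec us (vec 1 (\<lambda>_. 1))"

text \<open>
  \<open>along g c\<close> lists an attribute of every layer of \<open>c\<close>, where \<open>g\<close> computes the attribute of a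
  layer from the attributes of all earlier layers.
\<close>

definition along :: "('b list \<Rightarrow> 'a layer \<Rightarrow> 'b) \<Rightarrow> 'a circuit \<Rightarrow> 'b list" where
  "along g c = foldl (\<lambda>bs l. bs @ [g bs l]) [] c"

fun layer_width :: "nat list \<Rightarrow> 'a layer \<Rightarrow> nat" where
  "layer_width ws (Input X fs) = length fs"
| "layer_width ws (Hadamard js) = ws ! hd js"
| "layer_width ws (Kronecker js) = (\<Prod>j\<leftarrow>js. ws ! j)"
| "layer_width ws (Sum W j) = dim_row W"

fun layer_scope :: "nat set list \<Rightarrow> 'a layer \<Rightarrow> nat set" where
  "layer_scope ss (Input X fs) = {X}"
| "layer_scope ss (Hadamard js) = (\<Union>j\<in>set js. ss ! j)"
| "layer_scope ss (Kronecker js) = (\<Union>j\<in>set js. ss ! j)"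
| "layer_scope ss (Sum W j) = ss ! j"

fun layer_output :: "(nat \<Rightarrow> 'a) \<Rightarrow> complex vec list \<Rightarrow> 'a layer \<Rightarrow> complex vec" where
  "layer_output x vs (Input X fs) = vec_of_list (map (\<lambda>f. f (x X)) fs)"
| "layer_output x vs (Hadamard js) = hadamard_vecs (map (\<lambda>j. vs ! j) js)"
| "layer_output x vs (Kronecker js) = kronecker_vecs (map (\<lambda>j. vs ! j) js)"
| "layer_output x vs (Sum W j) = W *\<^sub>v (vs ! j)"

definition widths :: "'a circuit \<Rightarrow> nat list" where
  "widths = along layer_width"

definition scopes :: "'a circuit \<Rightarrow> nat set list" where
  "scopes = along layer_scope"

definition outputs :: "'a circuit \<Rightarrow> (nat \<Rightarrow> 'a) \<Rightarrow> complex vec list" where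
  "outputs c x = along (layer_output x) c"

definition circuit_fun :: "'a circuit \<Rightarrow> (nat \<Rightarrow> 'a) \<Rightarrow> complex" where
  "circuit_fun c x = vec_index (last (outputs c x)) 0"

fun wf_layer :: "nat \<Rightarrow> nat list \<Rightarrow> nat \<Rightarrow> 'a layer \<Rightarrow> bool" where
  "wf_layer d ws i (Input X fs) \<longleftrightarrow> X \<in> {1..d} \<and> fs \<noteq> []"
| "wf_layer d ws i (Hadamard js) \<longleftrightarrow>
     js \<noteq> [] \<and> (\<forall>j\<in>set js. j < i) \<and> (\<forall>j\<in>set js. ws ! j = ws ! hd js)"
| "wf_layer d ws i (Kronecker js) \<longleftrightarrow> js \<noteq> [] \<and> (\<forall>j\<in>set js. j < i)"
| "wf_layer d ws i (Sum W j) \<longleftrightarrow> j < i \<and> dim_row W \<ge> 1 \<and> dim_col W = ws ! j"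

definition tensorized_circuit :: "nat \<Rightarrow> 'a circuit \<Rightarrow> bool" where
  "tensorized_circuit d c \<longleftrightarrow>
     c \<noteq> [] \<and>
     (\<forall>i<length c. wf_layer d (widths c) i (c ! i)) \<and>
     last (widths c) = 1 \<and>
     last (scopes c) = {1..d}"

text \<open>
  The inputs of a product layer are compared by their position in its input list, so using the
  same layer twice as an input violates decomposability.
\<close>

fun decomposable_layer :: "nat set list \<Rightarrow> 'a layer \<Rightarrow> bool" where
  "decomposable_layer ss (Hadamard js) \<longleftrightarrow>
     (\<forall>q<length js. \<forall>p<q. ss ! (js ! p) \<inter> ss ! (js ! q) = {})"
| "decomposable_layer ss (Kronecker js) \<longleftrightarrow>
     (\<forall>q<length js. \<forall>p<q. ss ! (js ! p) \<inter> ss ! (js ! q) = {})"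
| "decomposable_layer ss (Input X fs) \<longleftrightarrow> True"
| "decomposable_layer ss (Sum W j) \<longleftrightarrow> True"

definition decomposable :: "'a circuit \<Rightarrow> bool" where
  "decomposable c \<longleftrightarrow> (\<forall>l\<in>set c. decomposable_layer (scopes c) l)"

section \<open>Orthonormality\<close>

text \<open>
  The domain of variable \<open>i\<close> is \<open>space (M i)\<close>, and integration over it is with respect to \<open>M i\<close>
  (\<open>count_space\<close> for a discrete variable). All domains are subsets of one type. Measurability is
  required explicitly since \<open>integral\<^sup>L\<close> of a non-measurable function is \<open>0\<close>; a vanishing
  integral would otherwise not mean orthogonality.
\<close>

definition orthonormal_functions :: "'a measure \<Rightarrow> ('a \<Rightarrow> complex) list \<Rightarrow> bool" where
  "orthonormal_functions N fs \<longleftrightarrow>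
     (\<forall>f\<in>set fs. f \<in> borel_measurable N) \<and>
     (\<forall>i<length fs. \<forall>j<length fs.
        (\<integral>x. (fs ! i) x * cnj ((fs ! j) x) \<partial>N) = (if i = j then 1 else 0))"

definition orthonormal_inputs :: "(nat \<Rightarrow> 'a measure) \<Rightarrow> 'a circuit \<Rightarrow> bool" where
  "orthonormal_inputs M c \<longleftrightarrow> (\<forall>X fs. Input X fs \<in> set c \<longrightarrow> orthonormal_functions (M X) fs)"

definition semi_unitary :: "complex mat \<Rightarrow> bool" where
  "semi_unitary W \<longleftrightarrow> dim_row W \<le> dim_col W \<and> W * mat_adjoint W = 1\<^sub>m (dim_row W)"

definition orthonormal_circuit :: "(nat \<Rightarrow> 'a measure) \<Rightarrow> 'a circuit \<Rightarrow> bool" where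
  "orthonormal_circuit M c \<longleftrightarrow>
     orthonormal_inputs M c \<and> (\<forall>W j. Sum W j \<in> set c \<longrightarrow> semi_unitary W)"

definition squared_norm :: "(nat \<Rightarrow> 'a measure) \<Rightarrow> nat \<Rightarrow> 'a circuit \<Rightarrow> real" where
  "squared_norm M d c = (\<integral>x. (cmod (circuit_fun c x))\<^sup>2 \<partial>Pi\<^sub>M {1..d} M)"

section \<open>Size\<close>

fun layer_size :: "nat list \<Rightarrow> 'a layer \<Rightarrow> nat" where
  "layer_size ws (Input X fs) = length fs"
| "layer_size ws (Hadamard js) = length js * ws ! hd js"
| "layer_size ws (Kronecker js) = length js * (\<Prod>j\<leftarrow>js. ws ! j)"
| "layer_size ws (Sum W j) = dim_row W * dim_col W"

definition max_layer_size :: "'a circuit \<Rightarrow> nat" where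
  "max_layer_size c = Max (layer_size (widths c) ` set c)"

section \<open>Algorithms\<close>

text \<open>
  Algorithms are programs in a first-order functional language over binary trees whose leaves are
  exact complex numbers, opaque atoms or \<open>VNil\<close>. A program can copy an opaque atom but neither
  inspect nor create one. Every evaluation step has unit cost, including each exact arithmetic
  operation and each zero test. Variables are de Bruijn indices into the environment, and functions
  are called by their position in the program. Partial operations, such as division by zero or a
  square root of a number that is not a non-negative real, have no result, so that evaluation is
  then stuck.
\<close>

datatype 'f val = VNum complex | VAtom 'f | VNil | VPair "'f val" "'f val"

datatype prim = PLit nat | PAdd | PSub | PMul | PDiv | PCnj | PSqrt | PNil | PPair | PFst | PSnd

datatype expr =
    EVar nat
  | EPrim prim "expr list"
  | ELet expr expr
  | EIfZero expr expr expr
  | EIfNil expr expr expr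
  | ECall nat "expr list"

type_synonym program = "expr list"

fun unary_arith :: "(complex \<Rightarrow> complex option) \<Rightarrow> 'f val list \<Rightarrow> 'f val option" where
  "unary_arith f [VNum a] = map_option VNum (f a)"
| "unary_arith f _ = None"

fun binary_arith ::
  "(complex \<Rightarrow> complex \<Rightarrow> complex option) \<Rightarrow> 'f val list \<Rightarrow> 'f val option" where
  "binary_arith f [VNum a, VNum b] = map_option VNum (f a b)"
| "binary_arith f _ = None"

primrec prim_apply :: "prim \<Rightarrow> 'f val list \<Rightarrow> 'f val option" where
  "prim_apply (PLit n) vs = (if vs = [] then Some (VNum (of_nat n)) else None)"
| "prim_apply PAdd vs = binary_arith (\<lambda>a b. Some (a + b)) vs"
| "prim_apply PSub vs = binary_arith (\<lambda>a b. Some (a - b)) vs"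
| "prim_apply PMul vs = binary_arith (\<lambda>a b. Some (a * b)) vs"
| "prim_apply PDiv vs = binary_arith (\<lambda>a b. if b = 0 then None else Some (a / b)) vs"
| "prim_apply PCnj vs = unary_arith (\<lambda>a. Some (cnj a)) vs"
| "prim_apply PSqrt vs =
     unary_arith (\<lambda>a. if Im a = 0 \<and> Re a \<ge> 0 then Some (complex_of_real (sqrt (Re a))) else None) vs"
| "prim_apply PNil vs = (if vs = [] then Some VNil else None)"
| "prim_apply PPair vs = (case vs of [u, v] \<Rightarrow> Some (VPair u v) | _ \<Rightarrow> None)"
| "prim_apply PFst vs = (case vs of [VPair u v] \<Rightarrow> Some u | _ \<Rightarrow> None)"
| "prim_apply PSnd vs = (case vs of [VPair u v] \<Rightarrow> Some v | _ \<Rightarrow> None)"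

text \<open>
  \<open>eval P \<rho> e v t\<close>: under program \<open>P\<close> and environment \<open>\<rho>\<close>, expression \<open>e\<close> evaluates to \<open>v\<close> in
  exactly \<open>t\<close> steps.
\<close>

inductive eval :: "program \<Rightarrow> 'f val list \<Rightarrow> expr \<Rightarrow> 'f val \<Rightarrow> nat \<Rightarrow> bool"
  and evals :: "program \<Rightarrow> 'f val list \<Rightarrow> expr list \<Rightarrow> 'f val list \<Rightarrow> nat \<Rightarrow> bool"
  for P :: program where
  eval_Var: "i < length \<rho> \<Longrightarrow> eval P \<rho> (EVar i) (\<rho> ! i) 1"
| eval_Prim: "evals P \<rho> es vs t \<Longrightarrow> prim_apply p vs = Some v \<Longrightarrow> eval P \<rho> (EPrim p es) v (t + 1)"
| eval_Let: "eval P \<rho> e u s \<Longrightarrow> eval P (u # \<rho>) e' v t \<Longrightarrow> eval P \<rho> (ELet e e') v (s + t + 1)"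
| eval_IfZero: "eval P \<rho> e (VNum z) s \<Longrightarrow> eval P \<rho> (if z = 0 then e1 else e2) v t \<Longrightarrow>
    eval P \<rho> (EIfZero e e1 e2) v (s + t + 1)"
| eval_IfNil: "eval P \<rho> e u s \<Longrightarrow> eval P \<rho> (if u = VNil then e1 else e2) v t \<Longrightarrow>
    eval P \<rho> (EIfNil e e1 e2) v (s + t + 1)"
| eval_Call: "evals P \<rho> es vs s \<Longrightarrow> f < length P \<Longrightarrow> eval P vs (P ! f) v t \<Longrightarrow>
    eval P \<rho> (ECall f es) v (s + t + 1)"
| evals_Nil: "evals P \<rho> [] [] 0"
| evals_Cons: "eval P \<rho> e v s \<Longrightarrow> evals P \<rho> es vs t \<Longrightarrow> evals P \<rho> (e # es) (v # vs) (s + t)"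

lemma eval_deterministic:
  fixes v :: "'f val" and vs :: "'f val list"
  shows
  "eval P \<rho> e v t \<Longrightarrow> (\<forall>v' t'. eval P \<rho> e v' t' \<longrightarrow> v' = v \<and> t' = t)"
  "evals P \<rho> es vs t \<Longrightarrow> (\<forall>vs' t'. evals P \<rho> es vs' t' \<longrightarrow> vs' = vs \<and> t' = t)"
proof (induction rule: eval_evals.inducts)
  case (eval_Var i \<rho>)
  then show ?case by (auto elim: eval.cases)
next
  case (eval_Prim \<rho> es vs t p v)
  show ?case
  proof (intro allI impI)
    fix v' t' assume "eval P \<rho> (EPrim p es) v' t'"
    then obtain us s where "evals P \<rho> es us s" "prim_apply p us = Some v'" "t' = s + 1"
      by cases auto
    moreover from this eval_Prim.IH have "us = vs" "s = t" by blast+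
    ultimately show "v' = v \<and> t' = t + 1" using eval_Prim.hyps by simp
  qed
next
  case (eval_Let \<rho> e u s e' v t)
  show ?case
  proof (intro allI impI)
    fix v' t' assume "eval P \<rho> (ELet e e') v' t'"
    then obtain u' s' r where *: "eval P \<rho> e u' s'" "eval P (u' # \<rho>) e' v' r" "t' = s' + r + 1"
      by cases auto
    with eval_Let.IH have "u' = u" "s' = s" by blast+
    with * eval_Let.IH show "v' = v \<and> t' = s + t + 1" by blast
  qed
next
  case (eval_IfZero \<rho> e z s e1 e2 v t)
  show ?case
  proof (intro allI impI)
    fix v' t' assume "eval P \<rho> (EIfZero e e1 e2) v' t'"
    then obtain z' s' r where *: "eval P \<rho> e (VNum z') s'"
        "eval P \<rho> (if z' = 0 then e1 else e2) v' r" "t' = s' + r + 1"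
      by cases blast
    with eval_IfZero.IH have "VNum z' = (VNum z :: 'f val)" "s' = s" by blast+
    then have "z' = z" "s' = s" by simp_all
    with * eval_IfZero.IH show "v' = v \<and> t' = s + t + 1" by blast
  qed
next
  case (eval_IfNil \<rho> e u s e1 e2 v t)
  show ?case
  proof (intro allI impI)
    fix v' t' assume "eval P \<rho> (EIfNil e e1 e2) v' t'"
    then obtain u' s' r where *: "eval P \<rho> e u' s'"
        "eval P \<rho> (if u' = VNil then e1 else e2) v' r" "t' = s' + r + 1"
      by cases blast
    with eval_IfNil.IH have "u' = u" "s' = s" by blast+
    with * eval_IfNil.IH show "v' = v \<and> t' = s + t + 1" by blast
  qed
next
  case (eval_Call \<rho> es vs s f v t)
  show ?case
  proof (intro allI impI)
    fix v' t' assume "eval P \<rho> (ECall f es) v' t'"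
    then obtain us s' r where *: "evals P \<rho> es us s'" "eval P us (P ! f) v' r" "t' = s' + r + 1"
      by cases blast
    with eval_Call.IH have "us = vs" "s' = s" by blast+
    with * eval_Call.IH show "v' = v \<and> t' = s + t + 1" by blast
  qed
next
  case (evals_Nil \<rho>)
  then show ?case by (auto elim: evals.cases)
next
  case (evals_Cons \<rho> e v s es vs t)
  show ?case
  proof (intro allI impI)
    fix vs' t' assume "evals P \<rho> (e # es) vs' t'"
    then obtain u us s' r where *: "eval P \<rho> e u s'" "evals P \<rho> es us r"
        "vs' = u # us" "t' = s' + r"
      by cases auto
    with evals_Cons.IH have "u = v" "s' = s" "us = vs" "r = t" by blast+
    with * show "vs' = v # vs \<and> t' = s + t" by simp
  qed
qed

primrec val_size :: "'f val \<Rightarrow> nat" where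
  "val_size (VNum z) = 1"
| "val_size (VAtom a) = 1"
| "val_size VNil = 1"
| "val_size (VPair u v) = val_size u + val_size v + 1"

text \<open>
  The first function of a program is its entry point. The tree size of the result is charged in
  addition to the evaluation steps, because sharing of subtrees would otherwise allow a result
  exponentially larger than the number of steps.
\<close>

definition returns_within :: "program \<Rightarrow> 'f val \<Rightarrow> 'f val \<Rightarrow> nat \<Rightarrow> bool" where
  "returns_within P u v b \<longleftrightarrow> (\<exists>t. eval P [u] (ECall 0 [EVar 0]) v t \<and> t + val_size v \<le> b)"

text \<open>Circuits as inputs and outputs of programs: input functions are opaque atoms.\<close>

definition enc_nat :: "nat \<Rightarrow> 'f val" where
  "enc_nat n = VNum (of_nat n)"

definition enc_list :: "('b \<Rightarrow> 'f val) \<Rightarrow> 'b list \<Rightarrow> 'f val" where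
  "enc_list enc bs = foldr (\<lambda>b. VPair (enc b)) bs VNil"

fun enc_layer :: "'a layer \<Rightarrow> ('a \<Rightarrow> complex) val" where
  "enc_layer (Input X fs) = VPair (enc_nat 0) (VPair (enc_nat X) (enc_list VAtom fs))"
| "enc_layer (Hadamard js) = VPair (enc_nat 1) (enc_list enc_nat js)"
| "enc_layer (Kronecker js) = VPair (enc_nat 2) (enc_list enc_nat js)"
| "enc_layer (Sum W j) =
     VPair (enc_nat 3) (VPair (enc_list (enc_list VNum) (mat_to_list W)) (enc_nat j))"

definition enc_circuit :: "'a circuit \<Rightarrow> ('a \<Rightarrow> complex) val" where
  "enc_circuit c = enc_list enc_layer c"

end

theory Submission
  imports Defs "Jordan_Normal_Form.Determinant"
begin

text \<open>
  Every layer of the given circuit is rewritten as \<open>R u\<close>, where \<open>u\<close> is the output of a layer of the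
  new circuit and \<open>R\<close> is a matrix that is only carried along during the computation. For a product
  layer, the mixed-product property of the Kronecker product moves the matrices \<open>R\<close> of the inputs
  behind a Kronecker layer; a Hadamard product of vectors \<open>R u\<close> and \<open>S v\<close> is the row-wise Kronecker
  product of \<open>R\<close> and \<open>S\<close> applied to the Kronecker product of \<open>u\<close> and \<open>v\<close>. For a sum layer, \<open>R\<close> is
  multiplied by its weight matrix. The resulting matrix \<open>A\<close> is then factored as \<open>A = L Q\<close> by
  Gram-Schmidt on its rows: \<open>Q\<close> has orthonormal rows and becomes a sum layer, and \<open>L = A Q\<^sup>\<dagger>\<close> is the
  new \<open>R\<close>.

  The factorization follows every single binary product, even inside a product layer with many
  inputs. It makes the width of the new layer at most the number of rows of \<open>A\<close>, so that the widths
  stay polynomial; a single Kronecker layer replacing a Hadamard layer of width \<open>K\<close> with \<open>n\<close> inputs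
  would have width up to \<open>K ^ n\<close>.

  At the output layer \<open>R\<close> is a number \<open>\<rho>\<close> and the single output function has norm \<open>1\<close>, since layers
  of a decomposable circuit with orthonormal inputs and semi-unitary sums compute orthonormal
  functions. Hence \<open>Z = \<bar>\<rho>\<bar>\<^sup>2\<close>, and a final sum layer multiplies by \<open>\<rho> / \<bar>\<rho>\<bar>\<close>.
\<close>

section \<open>The algorithm on lists\<close>

text \<open>The obstacle is the Hadamard product: \<open>(R u) \<odot> (S v)\<close> depends on all
  cross products \<open>u_i v_j\<close>, not only on the diagonal ones, so the matrices cannot be
  moved past a Hadamard layer and the full Kronecker product of \<open>u\<close> and
  \<open>v\<close> has to be formed. Widths multiply there, and the factorization pays this back at
  once. Hence a single step multiplies two widths, each at most the largest layer size, and one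
  number \<open>N\<close>, quadratic in the size of the circuit, bounds all matrix dimensions and
  layer counts. The running time has degree \<open>6\<close> in \<open>N\<close>, hence degree
  \<open>12\<close> in the size.

  Input functions are opaque to a program, so it can neither integrate nor test orthogonality. It
  relies on the assumed orthonormality alone: \<open>Z\<close> reaches it only through \<rho>, and
  integrals occur only in the proof of correctness.

  The mathematics is carried by functions on lists; that a program computes them within a certain
  cost is shown separately, with the shapes of the matrices as side conditions.\<close>

text \<open>
  Matrices are lists of rows. \<open>mat_mul\<close> and \<open>row_basis\<close> read the number of columns off the first
  row, so they need a nonempty list.
\<close>

fun ldot :: "complex list \<Rightarrow> complex list \<Rightarrow> complex" where
  "ldot (x # xs) (y # ys) = x * y + ldot xs ys"
| "ldot [] ys = 0"
| "ldot (x # xs) [] = 0"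

fun cdot :: "complex list \<Rightarrow> complex list \<Rightarrow> complex" where
  "cdot (x # xs) (y # ys) = x * cnj y + cdot xs ys"
| "cdot [] ys = 0"
| "cdot (x # xs) [] = 0"

fun axpy :: "complex \<Rightarrow> complex list \<Rightarrow> complex list \<Rightarrow> complex list" where
  "axpy c (x # xs) (y # ys) = (y + c * x) # axpy c xs ys"
| "axpy c [] ys = []"
| "axpy c (x # xs) [] = []"

definition scale :: "complex \<Rightarrow> complex list \<Rightarrow> complex list" where
  "scale c v = map ((*) c) v"

text \<open>Only the length of the argument matters. The element type is arbitrary so that
  \<open>ident\<close>, which builds its rows with \<open>zeros\<close>, can read its dimension off
  a list of opaque input functions.\<close>

definition zeros :: "'b list \<Rightarrow> complex list" where
  "zeros v = map (\<lambda>_. 0) v"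

text \<open>The row vector \<open>cs\<close> times the matrix with rows \<open>qs\<close>,
  accumulated on \<open>z\<close>. The start vector supplies the number of columns.\<close>

fun comb :: "complex list \<Rightarrow> complex list \<Rightarrow> complex list list \<Rightarrow> complex list" where
  "comb z (c # cs) (q # qs) = axpy c q (comb z cs qs)"
| "comb z [] qs = z"
| "comb z (c # cs) [] = z"

text \<open>Modified Gram-Schmidt: each coefficient is taken from the vector already reduced, not
  from the original one. The negation is written \<open>0 - ...\<close> because the language has
  subtraction but only natural literals.\<close>

fun resid :: "complex list list \<Rightarrow> complex list \<Rightarrow> complex list" where
  "resid [] r = r"
| "resid (q # qs) r = resid qs (axpy (0 - cdot r q) q r)"

definition normalize_vec :: "complex list \<Rightarrow> complex list" where
  "normalize_vec r = scale (1 / complex_of_real (sqrt (Re (cdot r r)))) r"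

text \<open>\<open>Q\<close> holds the rows found so far, newest first. Arithmetic is exact, so for
  orthonormal \<open>Q\<close> the zero test decides whether \<open>a\<close> lies in their span;
  such rows are dropped.\<close>

fun gram_schmidt_rows :: "complex list list \<Rightarrow> complex list list \<Rightarrow> complex list list" where
  "gram_schmidt_rows Q [] = Q"
| "gram_schmidt_rows Q (a # A) =
    (let r = resid Q a in
     if cdot r r = 0 then gram_schmidt_rows Q A else gram_schmidt_rows (normalize_vec r # Q) A)"

text \<open>
  A layer must have positive width, so the zero matrix is given the basis vector \<open>(1, 0, \<dots>, 0)\<close>.
\<close>

definition row_basis :: "complex list list \<Rightarrow> complex list list" where
  "row_basis A = (let Q = gram_schmidt_rows [] A in
     if Q = [] then [1 # zeros (tl (hd A))] else Q)"

text \<open>\<open>A\<close> times the conjugate transpose of \<open>Q\<close>, since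
  \<open>cdot\<close> conjugates its second argument: the factor \<open>L\<close> of
  \<open>A = L Q\<close>.\<close>

definition dot_mat :: "complex list list \<Rightarrow> complex list list \<Rightarrow> complex list list" where
  "dot_mat A Q = map (\<lambda>a. map (cdot a) Q) A"

fun lkron :: "complex list \<Rightarrow> complex list \<Rightarrow> complex list" where
  "lkron [] b = []"
| "lkron (x # a) b = scale x b @ lkron a b"

text \<open>The face-splitting or transposed Khatri-Rao product. Unlike \<open>kron_rows\<close> it
  pairs only rows of equal index, so the columns multiply but the rows do not.\<close>

fun face_split :: "complex list list \<Rightarrow> complex list list \<Rightarrow> complex list list" where
  "face_split (r # R) (s # S) = lkron r s # face_split R S"
| "face_split [] S = []"
| "face_split (r # R) [] = []"

fun kron_rows :: "complex list list \<Rightarrow> complex list list \<Rightarrow> complex list list" where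
  "kron_rows [] S = []"
| "kron_rows (r # R) S = map (lkron r) S @ kron_rows R S"

definition mat_mul :: "complex list list \<Rightarrow> complex list list \<Rightarrow> complex list list" where
  "mat_mul W R = map (\<lambda>w. comb (zeros (hd R)) w R) W"

fun ident :: "'b list \<Rightarrow> complex list list" where
  "ident [] = []"
| "ident (x # xs) = (1 # zeros xs) # map ((#) 0) (ident xs)"

type_synonym entry = "nat \<times> complex list list"

definition sum_layer :: "complex list list \<Rightarrow> nat \<Rightarrow> 'a layer" where
  "sum_layer Q p = Sum (mat_of_rows_list (length (hd Q)) Q) p"

definition reduce :: "nat \<Rightarrow> complex list list \<Rightarrow> 'a circuit \<Rightarrow> entry \<times> 'a circuit" where
  "reduce p A c = ((length c, dot_mat A (row_basis A)), c @ [sum_layer (row_basis A) p])"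

definition combine :: "bool \<Rightarrow> entry \<Rightarrow> entry \<Rightarrow> 'a circuit \<Rightarrow> entry \<times> 'a circuit" where
  "combine had e1 e2 c = reduce (length c)
     ((if had then face_split else kron_rows) (snd e1) (snd e2)) (c @ [Kronecker [fst e1, fst e2]])"

text \<open>A right fold, matching \<open>foldr\<close> in \<open>kronecker_vecs\<close>. The last
  input contributes its entry unchanged, so \<open>n\<close> inputs take \<open>n - 1\<close> binary
  products and a single input takes no new layer. Well-formedness excludes the empty list.\<close>

fun combine_all :: "bool \<Rightarrow> nat list \<Rightarrow> entry list \<Rightarrow> 'a circuit \<Rightarrow> entry \<times> 'a circuit" where
  "combine_all had [] es c = undefined"
| "combine_all had [j] es c = (es ! j, c)"
| "combine_all had (j # js) es c =
     (let r = combine_all had js es c in combine had (es ! j) (fst r) (snd r))"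

fun add_layer :: "'a layer \<Rightarrow> entry list \<Rightarrow> 'a circuit \<Rightarrow> entry \<times> 'a circuit" where
  "add_layer (Input X fs) es c = ((length c, ident fs), c @ [Input X fs])"
| "add_layer (Hadamard js) es c = combine_all True js es c"
| "add_layer (Kronecker js) es c = combine_all False js es c"
| "add_layer (Sum W j) es c = reduce (fst (es ! j)) (mat_mul (mat_to_list W) (snd (es ! j))) c"

fun add_layers :: "'a layer list \<Rightarrow> entry list \<Rightarrow> 'a circuit \<Rightarrow> entry list \<times> 'a circuit" where
  "add_layers [] es c = (es, c)"
| "add_layers (l # ls) es c =
     (let r = add_layer l es c in add_layers ls (es @ [fst r]) (snd r))"

text \<open>The modulus is written as the root of \<open>z * cnj z\<close>, the form in which the
  primitive operations can compute it.\<close>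

definition phase :: "complex \<Rightarrow> complex" where
  "phase z = z / complex_of_real (sqrt (Re (z * cnj z)))"

definition orthonormalize :: "'a circuit \<Rightarrow> 'a circuit" where
  "orthonormalize c = (let r = add_layers c [] []; e = fst r ! (length (fst r) - 1) in
     snd r @ [sum_layer [[phase (hd (hd (snd e)))]] (fst e)])"

section \<open>The program\<close>

abbreviation (input) "ELit n \<equiv> EPrim (PLit n) []"
abbreviation (input) "EAdd a b \<equiv> EPrim PAdd [a, b]"
abbreviation (input) "ESub a b \<equiv> EPrim PSub [a, b]"
abbreviation (input) "EMul a b \<equiv> EPrim PMul [a, b]"
abbreviation (input) "EDiv a b \<equiv> EPrim PDiv [a, b]"
abbreviation (input) "ECnj a \<equiv> EPrim PCnj [a]"
abbreviation (input) "ESqrt a \<equiv> EPrim PSqrt [a]"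
abbreviation (input) "ENil \<equiv> EPrim PNil []"
abbreviation (input) "EPair a b \<equiv> EPrim PPair [a, b]"
abbreviation (input) "EFst a \<equiv> EPrim PFst [a]"
abbreviation (input) "ESnd a \<equiv> EPrim PSnd [a]"
abbreviation (input) "ESingle a \<equiv> EPair a ENil"

text \<open>
  The names of the functions are their positions in the program. On entry, \<open>EVar i\<close> is argument
  \<open>i\<close> of the function being called. A boolean argument is encoded as \<open>0\<close> for a Hadamard and \<open>1\<close> for
  a Kronecker product.
\<close>

abbreviation (input) "fAxpy \<equiv> 1 :: nat"
abbreviation (input) "fDot \<equiv> 2 :: nat"
abbreviation (input) "fScale \<equiv> 3 :: nat"
abbreviation (input) "fZeros \<equiv> 4 :: nat"
abbreviation (input) "fComb \<equiv> 5 :: nat"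
abbreviation (input) "fResid \<equiv> 6 :: nat"
abbreviation (input) "fGs \<equiv> 7 :: nat"
abbreviation (input) "fBasis \<equiv> 8 :: nat"
abbreviation (input) "fDots \<equiv> 9 :: nat"
abbreviation (input) "fDotMat \<equiv> 10 :: nat"
abbreviation (input) "fApp \<equiv> 11 :: nat"
abbreviation (input) "fKron \<equiv> 12 :: nat"
abbreviation (input) "fFace \<equiv> 13 :: nat"
abbreviation (input) "fMapKron \<equiv> 14 :: nat"
abbreviation (input) "fKronRows \<equiv> 15 :: nat"
abbreviation (input) "fMatMul \<equiv> 16 :: nat"
abbreviation (input) "fCons0 \<equiv> 17 :: nat"
abbreviation (input) "fIdent \<equiv> 18 :: nat"
abbreviation (input) "fNth \<equiv> 19 :: nat"
abbreviation (input) "fLen \<equiv> 20 :: nat"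
abbreviation (input) "fReduce \<equiv> 21 :: nat"
abbreviation (input) "fCombine \<equiv> 22 :: nat"
abbreviation (input) "fCombineAll \<equiv> 23 :: nat"
abbreviation (input) "fLayer \<equiv> 24 :: nat"
abbreviation (input) "fLayers \<equiv> 25 :: nat"

text \<open>The three bindings are the result of the main loop, the entry of the output layer and
  the number \<rho>. Under all of them \<open>EVar 0\<close> is \<rho>, \<open>EVar 1\<close> the
  entry and \<open>EVar 2\<close> the loop result; the literal \<open>3\<close> is the tag of a sum
  layer.\<close>

definition "main_body =
  ELet (ECall fLayers [EVar 0, ENil, ENil])
   (ELet (ECall fNth [EFst (EVar 0), ESub (ECall fLen [EFst (EVar 0)]) (ELit 1)])
    (ELet (EFst (EFst (ESnd (EVar 0))))
      (ECall fApp [ESnd (EVar 2), ESingle (EPair (ELit 3) (EPair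
         (ESingle (ESingle (EDiv (EVar 0) (ESqrt (EMul (EVar 0) (ECnj (EVar 0)))))))
         (EFst (EVar 1))))])))"

definition "axpy_body =
  EIfNil (EVar 1) ENil
    (EPair (EAdd (EFst (EVar 2)) (EMul (EVar 0) (EFst (EVar 1))))
      (ECall fAxpy [EVar 0, ESnd (EVar 1), ESnd (EVar 2)]))"

definition "dot_body =
  EIfNil (EVar 0) (ELit 0)
    (EAdd (EMul (EFst (EVar 0)) (ECnj (EFst (EVar 1)))) (ECall fDot [ESnd (EVar 0), ESnd (EVar
      1)]))"

definition "scale_body =
  EIfNil (EVar 1) ENil
    (EPair (EMul (EVar 0) (EFst (EVar 1))) (ECall fScale [EVar 0, ESnd (EVar 1)]))"

definition "zeros_body =
  EIfNil (EVar 0) ENil (EPair (ELit 0) (ECall fZeros [ESnd (EVar 0)]))"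

definition "comb_body =
  EIfNil (EVar 1) (EVar 0)
    (ECall fAxpy [EFst (EVar 1), EFst (EVar 2), ECall fComb [EVar 0, ESnd (EVar 1), ESnd (EVar
      2)]])"

definition "resid_body =
  EIfNil (EVar 0) (EVar 1)
    (ECall fResid [ESnd (EVar 0),
      ECall fAxpy [ESub (ELit 0) (ECall fDot [EVar 1, EFst (EVar 0)]), EFst (EVar 0), EVar 1]])"

definition "gs_body =
  EIfNil (EVar 1) (EVar 0)
    (ELet (ECall fResid [EVar 0, EFst (EVar 1)])
     (ELet (ECall fDot [EVar 0, EVar 0])
      (EIfZero (EVar 0) (ECall fGs [EVar 2, ESnd (EVar 3)])
        (ECall fGs [EPair (ECall fScale [EDiv (ELit 1) (ESqrt (EVar 0)), EVar 1]) (EVar 2),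
           ESnd (EVar 3)]))))"

definition "basis_body =
  ELet (ECall fGs [ENil, EVar 0])
    (EIfNil (EVar 0) (ESingle (EPair (ELit 1) (ECall fZeros [ESnd (EFst (EVar 1))]))) (EVar 0))"

definition "dots_body =
  EIfNil (EVar 1) ENil
    (EPair (ECall fDot [EVar 0, EFst (EVar 1)]) (ECall fDots [EVar 0, ESnd (EVar 1)]))"

definition "dotMat_body =
  EIfNil (EVar 0) ENil
    (EPair (ECall fDots [EFst (EVar 0), EVar 1]) (ECall fDotMat [ESnd (EVar 0), EVar 1]))"

definition "app_body =
  EIfNil (EVar 0) (EVar 1) (EPair (EFst (EVar 0)) (ECall fApp [ESnd (EVar 0), EVar 1]))"

definition "kron_body =
  EIfNil (EVar 0) ENil
    (ECall fApp [ECall fScale [EFst (EVar 0), EVar 1], ECall fKron [ESnd (EVar 0), EVar 1]])"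

definition "face_body =
  EIfNil (EVar 0) ENil
    (EPair (ECall fKron [EFst (EVar 0), EFst (EVar 1)]) (ECall fFace [ESnd (EVar 0), ESnd (EVar
      1)]))"

definition "mapKron_body =
  EIfNil (EVar 1) ENil
    (EPair (ECall fKron [EVar 0, EFst (EVar 1)]) (ECall fMapKron [EVar 0, ESnd (EVar 1)]))"

definition "kronRows_body =
  EIfNil (EVar 0) ENil
    (ECall fApp [ECall fMapKron [EFst (EVar 0), EVar 1], ECall fKronRows [ESnd (EVar 0), EVar 1]])"

definition "matMul_body =
  EIfNil (EVar 0) ENil
    (EPair (ECall fComb [ECall fZeros [EFst (EVar 1)], EFst (EVar 0), EVar 1])
      (ECall fMatMul [ESnd (EVar 0), EVar 1]))"

definition "cons0_body =
  EIfNil (EVar 0) ENil (EPair (EPair (ELit 0) (EFst (EVar 0))) (ECall fCons0 [ESnd (EVar 0)]))"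

definition "ident_body =
  EIfNil (EVar 0) ENil
    (EPair (EPair (ELit 1) (ECall fZeros [ESnd (EVar 0)]))
      (ECall fCons0 [ECall fIdent [ESnd (EVar 0)]]))"

definition "nth_body =
  EIfZero (EVar 1) (EFst (EVar 0)) (ECall fNth [ESnd (EVar 0), ESub (EVar 1) (ELit 1)])"

definition "len_body =
  EIfNil (EVar 0) (ELit 0) (EAdd (ECall fLen [ESnd (EVar 0)]) (ELit 1))"

definition "reduce_body =
  ELet (ECall fBasis [EVar 1])
    (EPair (EPair (ECall fLen [EVar 3]) (ECall fDotMat [EVar 2, EVar 0]))
      (ECall fApp [EVar 3, ESingle (EPair (ELit 3) (EPair (EVar 0) (EVar 1)))]))"

definition "combine_body =
  ECall fReduce [ECall fLen [EVar 3],
    EIfZero (EVar 0) (ECall fFace [ESnd (EVar 1), ESnd (EVar 2)])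
      (ECall fKronRows [ESnd (EVar 1), ESnd (EVar 2)]),
    ECall fApp [EVar 3,
      ESingle (EPair (ELit 2) (EPair (EFst (EVar 1)) (ESingle (EFst (EVar 2)))))]]"

definition "combineAll_body =
  EIfNil (ESnd (EVar 1)) (EPair (ECall fNth [EVar 2, EFst (EVar 1)]) (EVar 3))
    (ELet (ECall fCombineAll [EVar 0, ESnd (EVar 1), EVar 2, EVar 3])
      (ECall fCombine [EVar 1, ECall fNth [EVar 3, EFst (EVar 2)], EFst (EVar 0), ESnd (EVar 0)]))"

text \<open>Numbers can only be tested for zero, so the tag is told apart by subtracting and
  testing; the innermost branch is the sum layer.\<close>

definition "layer_body =
  EIfZero (EFst (EVar 0))
    (EPair (EPair (ECall fLen [EVar 2]) (ECall fIdent [ESnd (ESnd (EVar 0))]))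
      (ECall fApp [EVar 2, ESingle (EVar 0)]))
    (EIfZero (ESub (EFst (EVar 0)) (ELit 1))
      (ECall fCombineAll [ELit 0, ESnd (EVar 0), EVar 1, EVar 2])
    (EIfZero (ESub (EFst (EVar 0)) (ELit 2))
      (ECall fCombineAll [ELit 1, ESnd (EVar 0), EVar 1, EVar 2])
      (ELet (ECall fNth [EVar 1, ESnd (ESnd (EVar 0))])
        (ECall fReduce [EFst (EVar 0), ECall fMatMul [EFst (ESnd (EVar 1)), ESnd (EVar 0)],
           EVar 3]))))"

definition "layers_body =
  EIfNil (EVar 0) (EPair (EVar 1) (EVar 2))
    (ELet (ECall fLayer [EFst (EVar 0), EVar 1, EVar 2])
      (ECall fLayers [ESnd (EVar 1), ECall fApp [EVar 2, ESingle (EFst (EVar 0))], ESnd (EVar 0)]))"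

definition prog :: program where
  "prog = [main_body, axpy_body, dot_body, scale_body, zeros_body, comb_body,
    resid_body, gs_body, basis_body, dots_body, dotMat_body, app_body,
    kron_body, face_body, mapKron_body, kronRows_body, matMul_body, cons0_body,
    ident_body, nth_body, len_body, reduce_body, combine_body, combineAll_body,
    layer_body, layers_body]"

section \<open>Evaluation with bounded cost\<close>

text \<open>An upper bound replaces the exact step count of \<open>eval\<close>, so that costs can
  be rounded to closed forms inside an induction.\<close>

definition ev :: "'f val list \<Rightarrow> expr \<Rightarrow> 'f val \<Rightarrow> nat \<Rightarrow> bool" where
  "ev \<rho> e v b \<longleftrightarrow> (\<exists>t\<le>b. eval prog \<rho> e v t)"

definition evs :: "'f val list \<Rightarrow> expr list \<Rightarrow> 'f val list \<Rightarrow> nat \<Rightarrow> bool" where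
  "evs \<rho> es vs b \<longleftrightarrow> (\<exists>t\<le>b. evals prog \<rho> es vs t)"

definition computes :: "nat \<Rightarrow> 'f val list \<Rightarrow> 'f val \<Rightarrow> nat \<Rightarrow> bool" where
  "computes f vs v b \<longleftrightarrow> f < length prog \<and> ev vs (prog ! f) v b"

lemma ev_nth: "i < length \<rho> \<Longrightarrow> ev \<rho> (EVar i) (\<rho> ! i) 1"
  unfolding ev_def using eval_Var by blast

lemma ev_Var:
  "ev (v0 # \<rho>) (EVar 0) v0 1"
  "ev (v0 # v1 # \<rho>) (EVar 1) v1 1"
  "ev (v0 # v1 # v2 # \<rho>) (EVar 2) v2 1"
  "ev (v0 # v1 # v2 # v3 # \<rho>) (EVar 3) v3 1"
  using ev_nth[of 0 "v0 # \<rho>"] ev_nth[of 1 "v0 # v1 # \<rho>"] ev_nth[of 2 "v0 # v1 # v2 # \<rho>"]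
    ev_nth[of 3 "v0 # v1 # v2 # v3 # \<rho>"] by simp_all

lemma evs_Nil: "evs \<rho> [] [] 0"
  unfolding evs_def using evals_Nil by blast

lemma evs_Cons: "ev \<rho> e v s \<Longrightarrow> evs \<rho> es vs t \<Longrightarrow> evs \<rho> (e # es) (v # vs) (s + t)"
  unfolding ev_def evs_def by (meson add_mono evals_Cons)

lemma ev_Prim: "evs \<rho> es vs t \<Longrightarrow> prim_apply p vs = Some v \<Longrightarrow> ev \<rho> (EPrim p es) v (t + 1)"
  unfolding ev_def evs_def by (meson add_mono eval_Prim order_refl)

lemma ev_Prim1: "ev \<rho> e u s \<Longrightarrow> prim_apply p [u] = Some v \<Longrightarrow> ev \<rho> (EPrim p [e]) v (s + 1)"
  using ev_Prim[OF evs_Cons[OF _ evs_Nil]] by simp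

lemma ev_Prim2: "ev \<rho> e1 u1 s \<Longrightarrow> ev \<rho> e2 u2 t \<Longrightarrow> prim_apply p [u1, u2] = Some v \<Longrightarrow>
    ev \<rho> (EPrim p [e1, e2]) v (s + t + 1)"
  using ev_Prim[OF evs_Cons[OF _ evs_Cons[OF _ evs_Nil]]] by (simp add: add.assoc)

lemma ev_Lit: "ev \<rho> (ELit n) (VNum (of_nat n)) 1"
  using ev_Prim[OF evs_Nil, of "PLit n" "VNum (of_nat n)" \<rho>] by simp

lemma ev_Nil: "ev \<rho> ENil VNil 1"
  using ev_Prim[OF evs_Nil, of PNil VNil \<rho>] by simp

lemma ev_Add: "ev \<rho> e1 (VNum a) s \<Longrightarrow> ev \<rho> e2 (VNum b) t \<Longrightarrow>
  ev \<rho> (EAdd e1 e2) (VNum (a + b)) (s + t + 1)"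
  by (rule ev_Prim2, assumption+) simp_all

lemma ev_Sub: "ev \<rho> e1 (VNum a) s \<Longrightarrow> ev \<rho> e2 (VNum b) t \<Longrightarrow>
  ev \<rho> (ESub e1 e2) (VNum (a - b)) (s + t + 1)"
  by (rule ev_Prim2, assumption+) simp_all

lemma ev_Mul: "ev \<rho> e1 (VNum a) s \<Longrightarrow> ev \<rho> e2 (VNum b) t \<Longrightarrow>
  ev \<rho> (EMul e1 e2) (VNum (a * b)) (s + t + 1)"
  by (rule ev_Prim2, assumption+) simp_all

lemma ev_Div: "ev \<rho> e1 (VNum a) s \<Longrightarrow> ev \<rho> e2 (VNum b) t \<Longrightarrow> b \<noteq> 0 \<Longrightarrow>
    ev \<rho> (EDiv e1 e2) (VNum (a / b)) (s + t + 1)"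
  by (rule ev_Prim2, assumption+) simp_all

lemma ev_Cnj: "ev \<rho> e (VNum a) s \<Longrightarrow> ev \<rho> (ECnj e) (VNum (cnj a)) (s + 1)"
  by (rule ev_Prim1, assumption) simp_all

lemma ev_Sqrt: "ev \<rho> e (VNum a) s \<Longrightarrow> Im a = 0 \<Longrightarrow> Re a \<ge> 0 \<Longrightarrow>
    ev \<rho> (ESqrt e) (VNum (complex_of_real (sqrt (Re a)))) (s + 1)"
  by (rule ev_Prim1, assumption) simp_all

lemma ev_Pair: "ev \<rho> e1 u s \<Longrightarrow> ev \<rho> e2 v t \<Longrightarrow> ev \<rho> (EPair e1 e2) (VPair u v) (s + t + 1)"
  by (rule ev_Prim2, assumption+) simp_all

lemma ev_Fst: "ev \<rho> e (VPair u v) s \<Longrightarrow> ev \<rho> (EFst e) u (s + 1)"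
  by (rule ev_Prim1, assumption) simp_all

lemma ev_Snd: "ev \<rho> e (VPair u v) s \<Longrightarrow> ev \<rho> (ESnd e) v (s + 1)"
  by (rule ev_Prim1, assumption) simp_all

lemma ev_Let: "ev \<rho> e u s \<Longrightarrow> ev (u # \<rho>) e' v t \<Longrightarrow> ev \<rho> (ELet e e') v (s + t + 1)"
  unfolding ev_def by (meson add_mono eval_Let order_refl)

lemma ev_IfNil:
  assumes "ev \<rho> e u s" "ev \<rho> (if u = VNil then e1 else e2) v t"
  shows "ev \<rho> (EIfNil e e1 e2) v (s + t + 1)"
proof -
  obtain s' t' where "eval prog \<rho> e u s'" "eval prog \<rho> (if u = VNil then e1 else e2) v t'" "s' \<le>
    s" "t' \<le> t"
    using assms unfolding ev_def by blast
  then show ?thesis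
    unfolding ev_def by (intro exI[of _ "s' + t' + 1"] conjI eval_IfNil) auto
qed

lemma ev_IfNil1: "ev \<rho> e VNil s \<Longrightarrow> ev \<rho> e1 v t \<Longrightarrow> ev \<rho> (EIfNil e e1 e2) v (s + t + 1)"
  by (rule ev_IfNil, assumption) simp

lemma ev_IfNil2: "ev \<rho> e (VPair a b) s \<Longrightarrow> ev \<rho> e2 v t \<Longrightarrow> ev \<rho> (EIfNil e e1 e2) v (s + t + 1)"
  by (rule ev_IfNil, assumption) simp

lemma ev_IfZero:
  assumes "ev \<rho> e (VNum z) s" "ev \<rho> (if z = 0 then e1 else e2) v t"
  shows "ev \<rho> (EIfZero e e1 e2) v (s + t + 1)"
proof -
  obtain s' t' where "eval prog \<rho> e (VNum z) s'" "eval prog \<rho> (if z = 0 then e1 else e2) v t'" "s'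
    \<le> s" "t' \<le> t"
    using assms unfolding ev_def by blast
  then show ?thesis
    unfolding ev_def by (intro exI[of _ "s' + t' + 1"] conjI eval_IfZero) auto
qed

lemma ev_IfZero1: "ev \<rho> e (VNum z) s \<Longrightarrow> z = 0 \<Longrightarrow> ev \<rho> e1 v t \<Longrightarrow> ev \<rho> (EIfZero e e1 e2) v (s + t + 1)"
  by (rule ev_IfZero, assumption) simp

lemma ev_IfZero2: "ev \<rho> e (VNum z) s \<Longrightarrow> z \<noteq> 0 \<Longrightarrow> ev \<rho> e2 v t \<Longrightarrow> ev \<rho> (EIfZero e e1 e2) v (s + t + 1)"
  by (rule ev_IfZero, assumption) simp

lemma ev_Call:
  assumes "evs \<rho> es vs s" "computes f vs v t"
  shows "ev \<rho> (ECall f es) v (s + t + 1)"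
proof -
  obtain s' t' where "evals prog \<rho> es vs s'" "f < length prog" "eval prog vs (prog ! f) v t'" "s'
    \<le> s" "t' \<le> t"
    using assms unfolding ev_def evs_def computes_def by blast
  then show ?thesis
    unfolding ev_def by (intro exI[of _ "s' + t' + 1"] conjI eval_Call) auto
qed

lemmas ev_rules = ev_Var evs_Nil evs_Cons ev_Lit ev_Nil ev_Add ev_Sub ev_Mul ev_Div ev_Cnj
  ev_Sqrt ev_Pair ev_Fst ev_Snd ev_Let ev_IfNil1 ev_IfNil2 ev_IfZero1 ev_IfZero2 ev_Call

text \<open>The pattern of the cost proofs: \<open>ev_rules\<close> run the body symbolically and
  synthesise a value and a bound, and this rule leaves the comparison with the claimed value and
  bound as the remaining goals.\<close>

lemma computes_weaken:
  "computes f vs v' b' \<Longrightarrow> v' = v \<Longrightarrow> b' \<le> b \<Longrightarrow> computes f vs v b"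
  unfolding computes_def ev_def by (meson order_trans)

lemma enc_list_simps [simp]:
  "enc_list enc [] = VNil"
  "enc_list enc (x # xs) = VPair (enc x) (enc_list enc xs)"
  by (simp_all add: enc_list_def)

abbreviation (input) "enc_vec \<equiv> enc_list VNum"
abbreviation (input) "enc_rows \<equiv> enc_list enc_vec"

declare One_nat_def [simp del]

lemma computes_intros_aux:
  "ev vs main_body v b \<Longrightarrow> computes 0 vs v b"
  "ev vs axpy_body v b \<Longrightarrow> computes fAxpy vs v b"
  "ev vs dot_body v b \<Longrightarrow> computes fDot vs v b"
  "ev vs scale_body v b \<Longrightarrow> computes fScale vs v b"
  "ev vs zeros_body v b \<Longrightarrow> computes fZeros vs v b"
  "ev vs comb_body v b \<Longrightarrow> computes fComb vs v b"
  "ev vs resid_body v b \<Longrightarrow> computes fResid vs v b"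
  "ev vs gs_body v b \<Longrightarrow> computes fGs vs v b"
  "ev vs basis_body v b \<Longrightarrow> computes fBasis vs v b"
  "ev vs dots_body v b \<Longrightarrow> computes fDots vs v b"
  "ev vs dotMat_body v b \<Longrightarrow> computes fDotMat vs v b"
  "ev vs app_body v b \<Longrightarrow> computes fApp vs v b"
  "ev vs kron_body v b \<Longrightarrow> computes fKron vs v b"
  "ev vs face_body v b \<Longrightarrow> computes fFace vs v b"
  "ev vs mapKron_body v b \<Longrightarrow> computes fMapKron vs v b"
  "ev vs kronRows_body v b \<Longrightarrow> computes fKronRows vs v b"
  "ev vs matMul_body v b \<Longrightarrow> computes fMatMul vs v b"
  "ev vs cons0_body v b \<Longrightarrow> computes fCons0 vs v b"
  "ev vs ident_body v b \<Longrightarrow> computes fIdent vs v b"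
  "ev vs nth_body v b \<Longrightarrow> computes fNth vs v b"
  "ev vs len_body v b \<Longrightarrow> computes fLen vs v b"
  "ev vs reduce_body v b \<Longrightarrow> computes fReduce vs v b"
  "ev vs combine_body v b \<Longrightarrow> computes fCombine vs v b"
  "ev vs combineAll_body v b \<Longrightarrow> computes fCombineAll vs v b"
  "ev vs layer_body v b \<Longrightarrow> computes fLayer vs v b"
  "ev vs layers_body v b \<Longrightarrow> computes fLayers vs v b"
  by (simp_all add: computes_def prog_def)

lemmas computes_intros = computes_intros_aux[unfolded
  main_body_def axpy_body_def dot_body_def scale_body_def zeros_body_def
  comb_body_def resid_body_def gs_body_def basis_body_def dots_body_def
  dotMat_body_def app_body_def kron_body_def face_body_def mapKron_body_def
  kronRows_body_def matMul_body_def cons0_body_def ident_body_def nth_body_def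
  len_body_def reduce_body_def combine_body_def combineAll_body_def layer_body_def
  layers_body_def]

section \<open>Lengths and costs of the list routines\<close>

lemma length_axpy [simp]: "length (axpy c u v) = min (length u) (length v)"
  by (induction c u v rule: axpy.induct) simp_all

lemma length_scale [simp]: "length (scale c v) = length v"
  by (simp add: scale_def)

lemma length_zeros [simp]: "length (zeros v) = length v"
  by (simp add: zeros_def)

lemma length_lkron [simp]: "length (lkron a b) = length a * length b"
  by (induction a) simp_all

lemma length_ident [simp]: "length (ident xs) = length xs"
  by (induction xs) simp_all

lemma length_comb: "\<forall>q\<in>set qs. length q = length z \<Longrightarrow> length (comb z cs qs) = length z"
  by (induction z cs qs rule: comb.induct) simp_all

lemma length_resid: "\<forall>q\<in>set Q. length q = length r \<Longrightarrow> length (resid Q r) = length r"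
  by (induction Q r rule: resid.induct) simp_all

lemma cdot_self: "Im (cdot r r) = 0" "0 \<le> Re (cdot r r)"
  by (induction r) (simp_all add: complex_mult_cnj)

text \<open>One pass through the body takes fewer than \<open>30\<close> steps besides the
  recursion; later costs are rounded just as generously. The length condition keeps the program from
  getting stuck: it looks for the end of \<open>u\<close> only, and \<open>EFst\<close> has no
  result on \<open>VNil\<close>, whereas \<open>axpy\<close> is total.\<close>

lemma computes_axpy: "length u \<le> length v \<Longrightarrow>
  computes fAxpy [VNum c :: 'f val, enc_vec u, enc_vec v]
    (enc_vec (axpy c u v)) (30 * length u + 30)"
proof (induction c u v rule: axpy.induct)
  case (1 c x xs y ys)
  then have IH: "computes fAxpy [VNum c :: 'f val, enc_vec xs, enc_vec ys]
    (enc_vec (axpy c xs ys)) (30 * length xs + 30)"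
    by simp
  show ?case unfolding axpy.simps enc_list_simps
    by (rule computes_weaken, rule computes_intros, (rule ev_rules IH)+, simp_all)
next
  case (2 c ys)
  show ?case unfolding axpy.simps enc_list_simps
    by (rule computes_weaken, rule computes_intros, (rule ev_rules)+, simp_all)
qed simp

lemma computes_dot: "length u \<le> length v \<Longrightarrow>
  computes fDot [enc_vec u :: 'f val, enc_vec v] (VNum (cdot u v)) (30 * length u + 30)"
proof (induction u v rule: cdot.induct)
  case (1 x xs y ys)
  then have IH: "computes fDot [enc_vec xs :: 'f val, enc_vec ys] (VNum
    (cdot xs ys)) (30 * length xs + 30)"
    by simp
  show ?case unfolding cdot.simps enc_list_simps
    by (rule computes_weaken, rule computes_intros, (rule ev_rules IH)+, simp_all)
next
  case (2 ys)
  show ?case unfolding cdot.simps enc_list_simps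
    by (rule computes_weaken, rule computes_intros, (rule ev_rules)+, simp_all)
qed simp

lemma computes_scale:
  "computes fScale [VNum c :: 'f val, enc_vec u] (enc_vec (scale c u)) (30 * length u + 30)"
proof (induction u)
  case Nil
  show ?case unfolding scale_def enc_list_simps list.map
    by (rule computes_weaken, rule computes_intros, (rule ev_rules)+, simp_all)
next
  case (Cons x u)
  note IH = Cons.IH[unfolded scale_def]
  show ?case unfolding scale_def enc_list_simps list.map
    by (rule computes_weaken, rule computes_intros, (rule ev_rules IH)+, simp_all)
qed

lemma computes_zeros:
  "computes fZeros [enc_list enc xs :: 'f val] (enc_vec (zeros xs)) (30 * length xs + 30)"
proof (induction xs)
  case Nil
  show ?case unfolding zeros_def enc_list_simps list.map
    by (rule computes_weaken, rule computes_intros, (rule ev_rules)+, simp_all)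
next
  case (Cons x xs)
  note IH = Cons.IH[unfolded zeros_def]
  show ?case unfolding zeros_def enc_list_simps list.map
    by (rule computes_weaken, rule computes_intros, (rule ev_rules IH)+, simp_all)
qed

lemma computes_comb: "length cs \<le> length qs \<Longrightarrow> \<forall>q\<in>set qs. length q = length z \<Longrightarrow>
  computes fComb [enc_vec z :: 'f val, enc_vec cs, enc_rows qs] (enc_vec (comb z cs qs))
    (length cs * (30 * length z + 90) + 30)"
proof (induction z cs qs rule: comb.induct)
  case (1 z c cs q qs)
  then have IH: "computes fComb [enc_vec z :: 'f val, enc_vec cs, enc_rows qs] (enc_vec
    (comb z cs qs))
    (length cs * (30 * length z + 90) + 30)" by simp
  have *: "length q \<le> length (comb z cs qs)" using 1 by (simp add: length_comb)
  show ?case unfolding comb.simps enc_list_simps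
    by (rule computes_weaken, rule computes_intros, (rule ev_rules IH computes_axpy[OF *])+)
      (use 1 in simp_all)
next
  case (2 z qs)
  show ?case unfolding comb.simps enc_list_simps
    by (rule computes_weaken, rule computes_intros, (rule ev_rules)+, simp_all)
qed simp

lemma computes_resid: "\<forall>q\<in>set Q. length q = length r \<Longrightarrow>
  computes fResid [enc_rows Q :: 'f val, enc_vec r] (enc_vec (resid Q r))
    (length Q * (60 * length r + 120) + 30)"
proof (induction Q r rule: resid.induct)
  case (1 r)
  show ?case unfolding resid.simps enc_list_simps
    by (rule computes_weaken, rule computes_intros, (rule ev_rules)+, simp_all)
next
  case (2 q qs r)
  then have IH: "computes fResid [enc_rows qs :: 'f val, enc_vec (axpy (0 - cdot r q) q r)]
    (enc_vec (resid qs (axpy (0 - cdot r q) q r))) (length qs * (60 * length r + 120) + 30)" by simp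
  have *: "length q \<le> length r" "length r \<le> length q" using 2 by auto
  \<comment> \<open>The literal \<open>0\<close> evaluates to \<open>VNum (of_nat 0)\<close>, and
    rules are matched syntactically, so the induction hypothesis is restated in that form.\<close>
  have IH': "computes fResid [enc_rows qs :: 'f val, enc_vec (axpy (of_nat 0 - cdot r q) q r)]
    (enc_vec (resid qs (axpy (0 - cdot r q) q r))) (length qs * (60 * length r + 120) + 30)"
    using IH by simp
  show ?case unfolding resid.simps enc_list_simps
    by (rule computes_weaken, rule computes_intros,
        (rule ev_rules IH' computes_axpy[OF *(1)] computes_dot[OF *(2)])+) (use * in simp_all)
qed

text \<open>The number \<open>m\<close> makes the cost of a step uniform: each step takes one row
  from \<open>A\<close> and adds at most one to \<open>Q\<close>, so
  \<open>length Q + length A\<close> never grows.\<close>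

lemma computes_gs: "\<forall>q\<in>set Q. length q = k \<Longrightarrow> \<forall>a\<in>set A. length a = k \<Longrightarrow>
  length Q + length A \<le> m \<Longrightarrow>
  computes fGs [enc_rows Q :: 'f val, enc_rows A] (enc_rows (gram_schmidt_rows Q A))
    (length A * (m * (60 * k + 120) + 60 * k + 200) + 30)"
proof (induction Q A rule: gram_schmidt_rows.induct)
  case (1 Q)
  show ?case unfolding gram_schmidt_rows.simps enc_list_simps
    by (rule computes_weaken, rule computes_intros, (rule ev_rules)+, simp_all)
next
  case (2 Q a A)
  let ?r = "resid Q a"
  have len: "length ?r = k" using 2 by (simp add: length_resid)
  have Q: "\<forall>q\<in>set Q. length q = length a" using 2 by simp
  have Qm: "length Q * (60 * length a + 120) \<le> m * (60 * k + 120)"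
    using 2 by (intro mult_le_mono) auto
  note R = computes_resid[OF Q] computes_dot[of ?r ?r, OF order_refl]
  show ?case
  proof (cases "cdot ?r ?r = 0")
    case True
    then have IH: "computes fGs [enc_rows Q :: 'f val, enc_rows A]
      (enc_rows (gram_schmidt_rows Q A))
      (length A * (m * (60 * k + 120) + 60 * k + 200) + 30)" using 2 by simp
    have eq: "gram_schmidt_rows Q (a # A) = gram_schmidt_rows Q A" using True by simp
    show ?thesis unfolding eq enc_list_simps
      by (rule computes_weaken, rule computes_intros, (rule ev_rules R IH True)+)
        (use Qm len in \<open>simp_all add: algebra_simps\<close>)
  next
    case False
    then have IH: "computes fGs [enc_rows (normalize_vec ?r # Q) :: 'f val, enc_rows A]
      (enc_rows (gram_schmidt_rows (normalize_vec ?r # Q) A))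
      (length A * (m * (60 * k + 120) + 60 * k + 200) + 30)" using 2 len
      by (simp add: normalize_vec_def)
    have eq: "gram_schmidt_rows Q (a # A) = gram_schmidt_rows (normalize_vec ?r # Q) A"
      using False by (simp add: Let_def)
    \<comment> \<open>Without this the division in the normalization would have no result.\<close>
    have nz: "complex_of_real (sqrt (Re (cdot ?r ?r))) \<noteq> 0"
      using False cdot_self[of ?r] by (simp add: complex_eq_iff)
    have IH: "computes fGs [VPair (enc_vec (scale (of_nat 1 / complex_of_real (sqrt (Re
      (cdot ?r ?r)))) ?r)) (enc_rows Q) :: 'f val, enc_rows A]
      (enc_rows (gram_schmidt_rows (normalize_vec ?r # Q) A))
      (length A * (m * (60 * k + 120) + 60 * k + 200) + 30)"
      using IH by (simp add: normalize_vec_def)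
    show ?thesis unfolding eq enc_list_simps
      by (rule computes_weaken, rule computes_intros,
          (rule ev_rules R IH computes_scale nz False cdot_self)+)
        (use Qm len in \<open>simp_all add: algebra_simps\<close>)
  qed
qed

lemma gram_schmidt_rows_induct [case_names Nil dependent independent]:
  assumes "\<And>Q. P Q []"
    and "\<And>Q a A. cdot (resid Q a) (resid Q a) = 0 \<Longrightarrow> P Q A \<Longrightarrow> P Q (a # A)"
    and "\<And>Q a A. cdot (resid Q a) (resid Q a) \<noteq> 0 \<Longrightarrow> P (normalize_vec (resid Q a) # Q) A \<Longrightarrow>
      P Q (a # A)"
  shows "P Q A"
  by (induction A arbitrary: Q) (metis assms)+

lemma gram_schmidt_rows_Cons:
  "cdot (resid Q a) (resid Q a) = 0 \<Longrightarrow> gram_schmidt_rows Q (a # A) = gram_schmidt_rows Q A"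
  "cdot (resid Q a) (resid Q a) \<noteq> 0 \<Longrightarrow>
    gram_schmidt_rows Q (a # A) = gram_schmidt_rows (normalize_vec (resid Q a) # Q) A"
  by (simp_all add: Let_def)

lemma gram_schmidt_rows_length: "length (gram_schmidt_rows Q A) \<le> length Q + length A"
  by (induction Q A rule: gram_schmidt_rows_induct)
    (simp_all add: gram_schmidt_rows_Cons del: gram_schmidt_rows.simps(2))

lemma gram_schmidt_rows_row_length:
  "\<forall>q\<in>set Q. length q = k \<Longrightarrow> \<forall>a\<in>set A. length a = k \<Longrightarrow>
    \<forall>q\<in>set (gram_schmidt_rows Q A). length q = k"
  by (induction Q A rule: gram_schmidt_rows_induct)
    (simp_all add: gram_schmidt_rows_Cons normalize_vec_def length_resid del:
      gram_schmidt_rows.simps(2))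

text \<open>\<open>A \<noteq> []\<close> makes room for the fallback row, which is the whole basis
  when \<open>A\<close> is zero.\<close>

lemma row_basis_length: "A \<noteq> [] \<Longrightarrow> length (row_basis A) \<le> length A"
  using gram_schmidt_rows_length[of "[]" A] by (cases A) (auto simp: row_basis_def Let_def)

lemma row_basis_nonempty: "row_basis A \<noteq> []"
  by (simp add: row_basis_def Let_def)

lemma row_basis_row_length:
  assumes "A \<noteq> []" "\<forall>a\<in>set A. length a = k" "k \<ge> 1"
  shows "\<forall>q\<in>set (row_basis A). length q = k"
proof -
  have "hd A \<in> set A" using assms(1) by simp
  then have "length (hd A) = k" using assms(2) by blast
  then have "length (1 # zeros (tl (hd A))) = k" using assms(3) by simp
  moreover have "\<forall>q\<in>set (gram_schmidt_rows [] A). length q = k"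
    by (rule gram_schmidt_rows_row_length) (use assms(2) in simp_all)
  ultimately show ?thesis
    by (auto simp: row_basis_def Let_def simp del: length_Cons)
qed

lemma computes_basis:
  assumes "A \<noteq> []" "\<forall>a\<in>set A. length a = k" "k \<ge> 1"
  shows "computes fBasis [enc_rows A :: 'f val] (enc_rows (row_basis A))
    (length A * (length A * (60 * k + 120) + 60 * k + 200) + 30 * k + 100)"
proof -
  obtain a A' where A: "A = a # A'" using assms by (cases A) auto
  then obtain x a' where a: "a = x # a'" using assms by (cases a) auto
  have k: "k = Suc (length a')" using A a assms by simp
  let ?v = "VPair (VPair (VNum x) (enc_vec a')) (enc_rows A') :: 'f val"
  define b where "b = length A * (length A * (60 * k + 120) + 60 * k + 200) + 30"
  have gs: "computes fGs [VNil, ?v] (enc_rows (gram_schmidt_rows [] A)) b"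
    using computes_gs[of "[]" k A "length A", where ?'f = 'f] assms(2) by (simp add: b_def A a)
  have b: "length A * (length A * (60 * k + 120) + 60 * k + 200) + 30 * k + 100 = b + 30 * k + 70"
    by (simp add: b_def)
  have "computes fBasis [?v] (enc_rows (row_basis A)) (b + 30 * k + 70)"
  proof (cases "gram_schmidt_rows [] A")
    case Nil
    have eq: "row_basis A = [1 # zeros a']" using Nil by (simp add: row_basis_def A a)
    note gs = gs[unfolded Nil enc_list_simps(1)]
    show ?thesis unfolding eq
      by (rule computes_weaken, rule computes_intros, (rule ev_rules computes_zeros gs)+)
        (simp_all add: k)
  next
    case (Cons q Q)
    have eq: "row_basis A = q # Q" using Cons by (simp add: row_basis_def)
    note gs = gs[unfolded Cons enc_list_simps(2)]
    show ?thesis unfolding eq enc_list_simps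
      by (rule computes_weaken, rule computes_intros, (rule ev_rules gs)+) simp_all
  qed
  then show ?thesis unfolding b by (simp add: A a)
qed

lemma computes_dots: "\<forall>q\<in>set Q. length a \<le> length q \<Longrightarrow>
  computes fDots [enc_vec a :: 'f val, enc_rows Q] (enc_vec (map (cdot a) Q))
    (length Q * (30 * length a + 80) + 30)"
proof (induction Q)
  case Nil
  show ?case unfolding enc_list_simps list.map
    by (rule computes_weaken, rule computes_intros, (rule ev_rules)+, simp_all)
next
  case (Cons q Q)
  then have IH: "computes fDots [enc_vec a :: 'f val, enc_rows Q] (enc_vec (map (cdot a) Q))
    (length Q * (30 * length a + 80) + 30)" and q: "length a \<le> length q" by simp_all
  show ?case unfolding enc_list_simps list.map
    by (rule computes_weaken, rule computes_intros, (rule ev_rules IH computes_dot[OF q])+,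
      simp_all)
qed

lemma computes_dotMat: "\<forall>q\<in>set Q. length q = k \<Longrightarrow> \<forall>a\<in>set A. length a = k \<Longrightarrow>
  computes fDotMat [enc_rows A :: 'f val, enc_rows Q] (enc_rows (dot_mat A Q))
    (length A * (length Q * (30 * k + 80) + 80) + 30)"
proof (induction A)
  case Nil
  show ?case unfolding enc_list_simps list.map dot_mat_def
    by (rule computes_weaken, rule computes_intros, (rule ev_rules)+, simp_all)
next
  case (Cons a A)
  then have IH: "computes fDotMat [enc_rows A :: 'f val, enc_rows Q] (enc_rows (map (\<lambda>a. map
    (cdot a) Q) A))
    (length A * (length Q * (30 * k + 80) + 80) + 30)" by (simp add: dot_mat_def)
  have *: "\<forall>q\<in>set Q. length a \<le> length q" using Cons by simp
  show ?case unfolding enc_list_simps list.map dot_mat_def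
    by (rule computes_weaken, rule computes_intros, (rule ev_rules IH computes_dots[OF *])+)
      (use Cons in simp_all)
qed

lemma computes_app:
  "computes fApp [enc_list enc xs :: 'f val, enc_list enc ys] (enc_list enc (xs @ ys))
    (30 * length xs + 30)"
proof (induction xs)
  case Nil
  show ?case unfolding enc_list_simps append.simps
    by (rule computes_weaken, rule computes_intros, (rule ev_rules)+, simp_all)
next
  case (Cons x xs)
  show ?case unfolding enc_list_simps append.simps
    by (rule computes_weaken, rule computes_intros, (rule ev_rules Cons.IH)+, simp_all)
qed

lemma computes_snoc:
  "computes fApp [enc_list enc xs :: 'f val, VPair (enc y) VNil] (enc_list enc (xs @ [y]))
    (30 * length xs + 30)"
  using computes_app[of enc xs "[y]"] by simp

lemma computes_kron:
  "computes fKron [enc_vec a :: 'f val, enc_vec b] (enc_vec (lkron a b))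
    (length a * (60 * length b + 120) + 30)"
proof (induction a)
  case Nil
  show ?case unfolding enc_list_simps lkron.simps
    by (rule computes_weaken, rule computes_intros, (rule ev_rules)+, simp_all)
next
  case (Cons x a)
  show ?case unfolding enc_list_simps lkron.simps
    by (rule computes_weaken, rule computes_intros,
        (rule ev_rules computes_app computes_scale Cons.IH)+, simp_all)
qed

lemma computes_face: "length R \<le> length S \<Longrightarrow> \<forall>r\<in>set R. length r = k \<Longrightarrow> \<forall>s\<in>set S. length s = l \<Longrightarrow>
  computes fFace [enc_rows R :: 'f val, enc_rows S] (enc_rows (face_split R S))
    (length R * (k * (60 * l + 120) + 100) + 30)"
proof (induction R S rule: face_split.induct)
  case (1 r R s S)
  then have IH: "computes fFace [enc_rows R :: 'f val, enc_rows S] (enc_rows (face_split R S))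
    (length R * (k * (60 * l + 120) + 100) + 30)" by simp
  show ?case unfolding enc_list_simps face_split.simps
    by (rule computes_weaken, rule computes_intros, (rule ev_rules computes_kron IH)+)
      (use 1 in simp_all)
next
  case (2 S)
  show ?case unfolding enc_list_simps face_split.simps
    by (rule computes_weaken, rule computes_intros, (rule ev_rules)+, simp_all)
qed simp

lemma computes_mapKron: "\<forall>s\<in>set S. length s = l \<Longrightarrow>
  computes fMapKron [enc_vec a :: 'f val, enc_rows S] (enc_rows (map (lkron a) S))
    (length S * (length a * (60 * l + 120) + 100) + 30)"
proof (induction S)
  case Nil
  show ?case unfolding enc_list_simps list.map
    by (rule computes_weaken, rule computes_intros, (rule ev_rules)+, simp_all)
next
  case (Cons s S)
  then have IH: "computes fMapKron [enc_vec a :: 'f val, enc_rows S] (enc_rows (map (lkron a) S))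
    (length S * (length a * (60 * l + 120) + 100) + 30)" by simp
  show ?case unfolding enc_list_simps list.map
    by (rule computes_weaken, rule computes_intros, (rule ev_rules computes_kron IH)+)
      (use Cons in simp_all)
qed

lemma computes_kronRows: "\<forall>r\<in>set R. length r = k \<Longrightarrow> \<forall>s\<in>set S. length s = l \<Longrightarrow>
  computes fKronRows [enc_rows R :: 'f val, enc_rows S] (enc_rows (kron_rows R S))
    (length R * (length S * (k * (60 * l + 120) + 130) + 120) + 30)"
proof (induction R)
  case Nil
  show ?case unfolding enc_list_simps kron_rows.simps
    by (rule computes_weaken, rule computes_intros, (rule ev_rules)+, simp_all)
next
  case (Cons r R)
  then have IH: "computes fKronRows [enc_rows R :: 'f val, enc_rows S] (enc_rows (kron_rows R S))
    (length R * (length S * (k * (60 * l + 120) + 130) + 120) + 30)" by simp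
  show ?case unfolding enc_list_simps kron_rows.simps
    by (rule computes_weaken, rule computes_intros,
        (rule ev_rules computes_app computes_mapKron[OF Cons.prems(2)] IH)+)
      (use Cons in \<open>simp_all add: algebra_simps\<close>)
qed

lemma computes_matMul:
  assumes R: "R \<noteq> []" "\<forall>r\<in>set R. length r = k"
  shows "\<forall>w\<in>set W. length w = length R \<Longrightarrow>
  computes fMatMul [enc_rows W :: 'f val, enc_rows R] (enc_rows (mat_mul W R))
    (length W * (length R * (30 * k + 90) + 30 * k + 150) + 30)"
proof (induction W)
  case Nil
  show ?case unfolding enc_list_simps mat_mul_def list.map
    by (rule computes_weaken, rule computes_intros, (rule ev_rules)+, simp_all)
next
  case (Cons w W)
  obtain r R' where R': "R = r # R'" using R by (cases R) auto
  have IH: "computes fMatMul [enc_rows W :: 'f val, enc_rows (r # R')]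
    (enc_rows (map (\<lambda>w. comb (zeros (hd (r # R'))) w (r # R')) W))
    (length W * (length R * (30 * k + 90) + 30 * k + 150) + 30)"
    using Cons unfolding R' mat_mul_def by simp
  have *: "length w \<le> length R" "\<forall>r'\<in>set R. length r' = length (zeros r)"
    using Cons R R' by auto
  have k: "length r = k" using R R' by simp
  show ?case unfolding enc_list_simps mat_mul_def list.map R'
    by (rule computes_weaken, rule computes_intros,
        (rule ev_rules computes_comb[OF *, unfolded R' enc_list_simps] computes_zeros
          IH[unfolded enc_list_simps])+)
      (use Cons k R' in simp_all)
qed

lemma computes_cons0:
  "computes fCons0 [enc_rows A :: 'f val] (enc_rows (map ((#) 0) A)) (30 * length A + 30)"
proof (induction A)
  case Nil
  show ?case unfolding enc_list_simps list.map
    by (rule computes_weaken, rule computes_intros, (rule ev_rules)+, simp_all)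
next
  case (Cons a A)
  show ?case unfolding enc_list_simps list.map
    by (rule computes_weaken, rule computes_intros, (rule ev_rules Cons.IH)+, simp_all)
qed

lemma computes_ident: "length xs \<le> n \<Longrightarrow>
  computes fIdent [enc_list enc xs :: 'f val] (enc_rows (ident xs))
    (length xs * (60 * n + 120) + 30)"
proof (induction xs)
  case Nil
  show ?case unfolding enc_list_simps ident.simps
    by (rule computes_weaken, rule computes_intros, (rule ev_rules)+, simp_all)
next
  case (Cons x xs)
  then have IH: "computes fIdent [enc_list enc xs :: 'f val] (enc_rows (ident xs))
    (length xs * (60 * n + 120) + 30)"
    by simp
  show ?case unfolding enc_list_simps ident.simps
    by (rule computes_weaken, rule computes_intros,
        (rule ev_rules IH computes_zeros computes_cons0)+) (use Cons in simp_all)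
qed

lemma computes_nth: "i < length xs \<Longrightarrow>
  computes fNth [enc_list enc xs :: 'f val, enc_nat i] (enc (xs ! i)) (30 * i + 30)"
proof (induction i arbitrary: xs)
  case 0
  then obtain x xs' where xs: "xs = x # xs'" by (cases xs) auto
  show ?case unfolding enc_list_simps xs enc_nat_def nth_Cons_0
    by (rule computes_weaken, rule computes_intros, rule ev_IfZero1, (rule ev_rules of_nat_0)+,
      simp_all)
next
  case (Suc i)
  then obtain x xs' where xs: "xs = x # xs'" by (cases xs) auto
  have IH: "computes fNth [enc_list enc xs' :: 'f val, VNum (of_nat (Suc i) - of_nat 1)] (enc (xs'
    ! i)) (30 * i + 30)"
    using Suc.IH[of xs'] Suc.prems by (simp add: xs enc_nat_def)
  show ?case unfolding enc_list_simps xs enc_nat_def nth_Cons_Suc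
    by (rule computes_weaken, rule computes_intros, rule ev_IfZero2, (rule ev_rules IH
      of_nat_neq_0)+, simp_all)
qed

lemma computes_len: "computes fLen [enc_list enc xs :: 'f val] (enc_nat
  (length xs)) (30 * length xs + 30)"
proof (induction xs)
  case Nil
  show ?case unfolding enc_list_simps enc_nat_def list.size(3)
    by (rule computes_weaken, rule computes_intros, (rule ev_rules)+, simp_all)
next
  case (Cons x xs)
  note IH = Cons.IH[unfolded enc_nat_def]
  show ?case unfolding enc_list_simps enc_nat_def
    by (rule computes_weaken, rule computes_intros, (rule ev_rules IH)+, simp_all)
qed

section \<open>Linear algebra on lists\<close>

definition mat_app :: "complex list list \<Rightarrow> complex list \<Rightarrow> complex list" where
  "mat_app R u = map (\<lambda>r. ldot r u) R"

lemma ldot_Nil2 [simp]: "ldot u [] = 0"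
  by (cases u) simp_all

lemma cdot_Nil2 [simp]: "cdot u [] = 0"
  by (cases u) simp_all

text \<open>Turns the sesquilinear product into the bilinear one, so that an identity
  \<open>ldot a u = ...\<close> holding for all test vectors \<open>u\<close> specialises to inner
  products.\<close>

lemma cdot_conv_ldot: "cdot u v = ldot u (map cnj v)"
  by (induction u v rule: cdot.induct) simp_all

lemma cdot_cnj: "cnj (cdot u v) = cdot v u"
  by (induction u v rule: cdot.induct) simp_all

lemma ldot_axpy: "length u = length v \<Longrightarrow> ldot (axpy c u v) w = c * ldot u w + ldot v w"
proof (induction c u v arbitrary: w rule: axpy.induct)
  case (1 c x xs y ys)
  then show ?case by (cases w) (simp_all add: algebra_simps)
qed simp_all

lemma cdot_axpy: "length u = length v \<Longrightarrow> cdot (axpy c u v) w = c * cdot u w + cdot v w"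
  by (simp add: cdot_conv_ldot ldot_axpy)

lemma ldot_scale: "ldot (scale c u) w = c * ldot u w"
proof (induction u arbitrary: w)
  case (Cons x u)
  then show ?case by (cases w) (simp_all add: scale_def algebra_simps)
qed (simp add: scale_def)

lemma ldot_scale2: "ldot w (scale c u) = c * ldot w u"
proof (induction w u rule: ldot.induct)
  case (1 x xs y ys)
  then show ?case by (simp add: scale_def algebra_simps)
qed (simp_all add: scale_def)

lemma cdot_scale: "cdot (scale c u) w = c * cdot u w"
  by (simp add: cdot_conv_ldot ldot_scale)

lemma cdot_scale2: "cdot w (scale c u) = cnj c * cdot w u"
  by (metis cdot_cnj cdot_scale complex_cnj_mult)

lemma ldot_zeros [simp]: "ldot (zeros xs) w = 0"
proof (induction xs arbitrary: w)
  case (Cons x xs)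
  then show ?case by (cases w) (simp_all add: zeros_def)
qed (simp add: zeros_def)

lemma ldot_append: "length a = length u \<Longrightarrow> ldot (a @ b) (u @ v) = ldot a u + ldot b v"
proof (induction a u rule: ldot.induct)
qed simp_all

lemma ldot_comb: "length cs = length qs \<Longrightarrow> \<forall>q\<in>set qs. length q = length z \<Longrightarrow>
    ldot (comb z cs qs) u = ldot z u + ldot cs (mat_app qs u)"
  by (induction z cs qs rule: comb.induct) (simp_all add: mat_app_def ldot_axpy length_comb)

lemma mat_app_mat_mul:
  assumes "R \<noteq> []" "\<forall>r\<in>set R. length r = k" "\<forall>w\<in>set W. length w = length R"
  shows "mat_app (mat_mul W R) u = mat_app W (mat_app R u)"
proof -
  have hd: "length (hd R) = k" using assms(1,2) by auto
  have "ldot (comb (zeros (hd R)) w R) u = ldot w (mat_app R u)" if "w \<in> set W" for w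
    using assms that hd by (subst ldot_comb) auto
  then show ?thesis by (auto simp: mat_app_def mat_mul_def)
qed

text \<open>The mixed-product property for a single row; the two matrix versions below apply it row
  by row.\<close>

lemma ldot_lkron: "length a = length u \<Longrightarrow> length b = length v \<Longrightarrow>
    ldot (lkron a b) (lkron u v) = ldot a u * ldot b v"
  by (induction a u rule: ldot.induct)
    (simp_all add: ldot_append ldot_scale ldot_scale2 algebra_simps)

lemma mat_app_face_split: "\<forall>r\<in>set R. length r = length u \<Longrightarrow> \<forall>s\<in>set S. length s = length v \<Longrightarrow>
    mat_app (face_split R S) (lkron u v) = map2 (*) (mat_app R u) (mat_app S v)"
  by (induction R S rule: face_split.induct) (simp_all add: mat_app_def ldot_lkron)

lemma mat_app_kron_rows: "\<forall>r\<in>set R. length r = length u \<Longrightarrow> \<forall>s\<in>set S. length s = length v \<Longrightarrow>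
    mat_app (kron_rows R S) (lkron u v) = lkron (mat_app R u) (mat_app S v)"
proof (induction R)
  case (Cons r R)
  then show ?case by (auto simp: mat_app_def ldot_lkron scale_def)
qed (simp_all add: mat_app_def)

lemma mat_app_ident: "length xs = length u \<Longrightarrow> mat_app (ident xs) u = u"
proof (induction xs u rule: list_induct2)
  case (Cons x xs y ys)
  then show ?case by (simp add: mat_app_def comp_def)
qed (simp add: mat_app_def)

lemma lkron_one [simp]: "lkron u [1] = u"
  by (induction u) (simp_all add: scale_def)

section \<open>Gram-Schmidt on rows\<close>

fun orthonormal_rows :: "complex list list \<Rightarrow> bool" where
  "orthonormal_rows [] \<longleftrightarrow> True"
| "orthonormal_rows (q # Q) \<longleftrightarrow>
    cdot q q = 1 \<and> (\<forall>p\<in>set Q. cdot q p = 0 \<and> cdot p q = 0) \<and> orthonormal_rows Q"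

lemma orthonormal_rows_nth: "orthonormal_rows Q \<Longrightarrow> i < length Q \<Longrightarrow> j < length Q \<Longrightarrow>
    cdot (Q ! i) (Q ! j) = (if i = j then 1 else 0)"
proof (induction Q arbitrary: i j)
  case (Cons q Q)
  then show ?case by (cases i; cases j) auto
qed simp

text \<open>The projection of \<open>a\<close> onto the span of orthonormal rows \<open>Q\<close>,
  paired with a test vector \<open>u\<close>. Vectors are compared through all their pairings
  \<open>ldot a u\<close>, because the matrices are only ever applied to vectors.\<close>

definition expansion :: "complex list list \<Rightarrow> complex list \<Rightarrow> complex list \<Rightarrow> complex" where
  "expansion Q a u = (\<Sum>q\<leftarrow>Q. cdot a q * ldot q u)"

lemma expansion_conv: "expansion Q a u = ldot (map (cdot a) Q) (mat_app Q u)"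
  by (induction Q) (simp_all add: expansion_def mat_app_def)

lemma expansion_cong: "(\<And>q. q \<in> set Q \<Longrightarrow> cdot a q = cdot b q) \<Longrightarrow> expansion Q a u = expansion Q b u"
  unfolding expansion_def by (intro arg_cong[of _ _ sum_list] map_cong) auto

lemma expansion_orthogonal:
  "\<forall>q\<in>set Q. cdot q r = 0 \<Longrightarrow> expansion Q a (map cnj r) = 0"
  unfolding expansion_def by (induction Q) (simp_all flip: cdot_conv_ldot)

lemma expansion_orthonormal:
  "orthonormal_rows Q \<Longrightarrow> p \<in> set Q \<Longrightarrow> expansion Q a (map cnj p) = cdot a p"
proof (induction Q)
  case (Cons q Q)
  have 0: "expansion Q a (map cnj q) = 0"
    by (rule expansion_orthogonal) (use Cons.prems(1) in simp)
  show ?case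
  proof (cases "p = q")
    case True
    then show ?thesis using Cons.prems 0 by (simp add: expansion_def cdot_conv_ldot)
  next
    case False
    then show ?thesis using Cons by (simp add: expansion_def cdot_conv_ldot)
  qed
qed simp

text \<open>Subtracting a multiple of \<open>q\<close> does not change the coefficients at the other
  rows, which are orthogonal to \<open>q\<close>. Hence the modified scheme removes the same
  projection as the classical one.\<close>

lemma ldot_resid: "orthonormal_rows Q \<Longrightarrow> \<forall>q\<in>set Q. length q = length r \<Longrightarrow>
    ldot (resid Q r) u = ldot r u - expansion Q r u"
proof (induction Q r rule: resid.induct)
  case (2 q Q r)
  let ?r = "axpy (0 - cdot r q) q r"
  have "ldot (resid Q ?r) u = ldot ?r u - expansion Q ?r u"
    using 2 by simp
  also have "expansion Q ?r u = expansion Q r u"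
    using 2 by (intro expansion_cong) (simp add: cdot_axpy)
  finally show ?case using 2 by (simp add: ldot_axpy expansion_def)
qed (simp add: expansion_def)

text \<open>Test \<open>ldot_resid\<close> with the conjugate of \<open>p\<close>: the expansion
  then equals \<open>cdot r p\<close> and cancels.\<close>

lemma cdot_resid: "orthonormal_rows Q \<Longrightarrow> \<forall>q\<in>set Q. length q = length r \<Longrightarrow> p \<in> set Q \<Longrightarrow>
    cdot (resid Q r) p = 0"
  by (simp add: cdot_conv_ldot[of "resid Q r"] ldot_resid expansion_orthonormal)
    (simp add: cdot_conv_ldot)

text \<open>A sum of squared moduli vanishes only if every entry does. The conclusion is put in
  terms of \<open>ldot\<close> to fit \<open>in_row_span\<close>.\<close>

lemma cdot_self_eq_0: "cdot r r = 0 \<Longrightarrow> ldot r u = 0"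
proof (induction r arbitrary: u)
  case (Cons x r)
  have "Re (x * cnj x) \<ge> 0" "Re (cdot r r) \<ge> 0"
    using cdot_self by (simp_all add: complex_mult_cnj)
  moreover have "Re (x * cnj x) + Re (cdot r r) = 0"
    using Cons.prems by (metis cdot.simps(1) plus_complex.sel(1) zero_complex.sel(1))
  ultimately have "Re (x * cnj x) = 0" "Re (cdot r r) = 0" by linarith+
  then have "x = 0" "cdot r r = 0"
    using cdot_self[of r] by (simp_all add: complex_mult_cnj complex_eq_iff sum_power2_eq_zero_iff)
  then show ?case using Cons.IH by (cases u) simp_all
qed simp

lemma normalize_vec_props:
  assumes "cdot r r \<noteq> 0"
  defines "s \<equiv> complex_of_real (sqrt (Re (cdot r r)))"
  shows "s \<noteq> 0" "s * s = cdot r r" "normalize_vec r = scale (1 / s) r" "cnj s = s"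
proof -
  have "complex_of_real (Re (cdot r r)) = cdot r r"
    using cdot_self[of r] by (simp add: complex_eq_iff)
  moreover have "s * s = complex_of_real (sqrt (Re (cdot r r)) * sqrt (Re (cdot r r)))"
    unfolding s_def by (rule of_real_mult[symmetric])
  ultimately show "s * s = cdot r r"
    using cdot_self(2)[of r] by simp
  then show "s \<noteq> 0" using assms by auto
qed (simp_all add: s_def normalize_vec_def)

text \<open>For orthonormal \<open>Q\<close>, lying in the span means being equal to one's own
  projection; this form directly yields the coefficients collected in
  \<open>dot_mat\<close>.\<close>

definition in_row_span :: "complex list list \<Rightarrow> complex list \<Rightarrow> bool" where
  "in_row_span Q a \<longleftrightarrow> (\<forall>u. ldot a u = expansion Q a u)"

text \<open>The middle conjunct carries the induction: a row already expressed by \<open>Q\<close>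
  must stay expressed after later rows have been added.\<close>

lemma gram_schmidt_rows_correct:
  "orthonormal_rows Q \<Longrightarrow> \<forall>q\<in>set Q. length q = k \<Longrightarrow> \<forall>a\<in>set A. length a = k \<Longrightarrow>
   orthonormal_rows (gram_schmidt_rows Q A) \<and>
   (\<forall>b. in_row_span Q b \<longrightarrow> in_row_span (gram_schmidt_rows Q A) b) \<and>
   (\<forall>a\<in>set A. in_row_span (gram_schmidt_rows Q A) a)"
proof (induction Q A rule: gram_schmidt_rows_induct)
  case (Nil Q)
  then show ?case by simp
next
  case (dependent Q a A)
  have "in_row_span Q a"
    unfolding in_row_span_def
    using ldot_resid[of Q a] cdot_self_eq_0[OF dependent.hyps] dependent.prems by simp
  then show ?case using dependent by (simp add: gram_schmidt_rows_Cons del: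
    gram_schmidt_rows.simps(2))
next
  case (independent Q a A)
  let ?r = "resid Q a"
  define s where "s = complex_of_real (sqrt (Re (cdot ?r ?r)))"
  note s = normalize_vec_props[OF independent.hyps, folded s_def]
  let ?q = "normalize_vec ?r"
  have len: "\<forall>q\<in>set Q. length q = length a" using independent.prems by simp
  have perp: "cdot ?r p = 0" "cdot p ?r = 0" if "p \<in> set Q" for p
    using cdot_resid[OF independent.prems(1) len that] cdot_cnj[of ?r p] by simp_all
  have on: "orthonormal_rows (?q # Q)"
  proof -
    have "cdot ?q ?q = (s * s) / (s * s)"
      unfolding s(3) s(2) by (simp add: cdot_scale cdot_scale2 s(4) flip: s(2))
    moreover have "cdot ?q p = 0" "cdot p ?q = 0" if "p \<in> set Q" for p
      using perp[OF that] by (simp_all add: s(3) cdot_scale cdot_scale2)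
    ultimately show ?thesis using independent.prems(1) s(1) by simp
  qed
  have len': "\<forall>q\<in>set (?q # Q). length q = k"
    using independent.prems(2,3) length_resid[OF len] by (simp add: normalize_vec_def)
  have old: "in_row_span (?q # Q) b" if b: "in_row_span Q b" for b
  proof -
    \<comment> \<open>A vector in the span of \<open>Q\<close> is orthogonal to the residual, so the
      new row adds a zero term to its expansion.\<close>
    have "expansion Q b (map cnj ?r) = 0"
      by (rule expansion_orthogonal) (use perp in blast)
    then have "cdot b ?r = 0" using b by (simp add: cdot_conv_ldot in_row_span_def)
    then have "cdot b ?q = 0" by (simp add: s(3) cdot_scale2)
    then show ?thesis using b by (simp add: in_row_span_def expansion_def)
  qed
  have ra: "ldot a u = ldot ?r u + expansion Q a u" for u
    using ldot_resid[OF independent.prems(1) len] by simp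
  have "expansion Q a (map cnj ?r) = 0"
    by (rule expansion_orthogonal) (use perp in blast)
  \<comment> \<open>The part of \<open>a\<close> inside the span of \<open>Q\<close> is orthogonal
    to \<open>?r\<close>, so \<open>a\<close> and \<open>?r\<close> have the same inner product with
    \<open>?r\<close>. With \<open>?q = ?r / s\<close>, the new term of the expansion is
    \<open>(s * s / s) * (?r / s)\<close>, exactly the residual.\<close>
  then have "cdot a ?r = s * s" using ra[of "map cnj ?r"] s by (simp flip: cdot_conv_ldot)
  then have "cdot a ?q * ldot ?q u = ldot ?r u" for u
    using s(1) by (simp add: s(3,4) cdot_scale2 ldot_scale)
  then have new: "in_row_span (?q # Q) a"
    unfolding in_row_span_def using ra by (simp add: expansion_def)
  note IH = independent.IH[OF on len']
  show ?case
    unfolding gram_schmidt_rows_Cons(2)[OF independent.hyps]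
  proof (intro conjI allI impI ballI)
    show "orthonormal_rows (gram_schmidt_rows (?q # Q) A)"
      using IH independent.prems(3) by simp
    show "in_row_span (gram_schmidt_rows (?q # Q) A) b" if "in_row_span Q b" for b
      using IH independent.prems(3) old[OF that] by simp
    show "in_row_span (gram_schmidt_rows (?q # Q) A) b" if "b \<in> set (a # A)" for b
      using IH independent.prems(3) new that by (cases "b = a") simp_all
  qed
qed

lemma row_basis_orthonormal:
  assumes "\<forall>a\<in>set A. length a = k"
  shows "orthonormal_rows (row_basis A)"
proof -
  have 1: "orthonormal_rows [1 # zeros xs]" for xs :: "complex list"
    by (simp add: cdot_conv_ldot)
  show ?thesis
    using gram_schmidt_rows_correct[of "[]" k A] assms 1
    by (auto simp: row_basis_def Let_def simp del: orthonormal_rows.simps(2))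
qed

text \<open>The factorization \<open>A = L Q\<close>, applied to a vector: every row of
  \<open>A\<close> equals its expansion in the basis.\<close>

lemma mat_app_row_basis:
  assumes "\<forall>a\<in>set A. length a = k"
  shows "mat_app (dot_mat A (row_basis A)) (mat_app (row_basis A) u) = mat_app A u"
proof -
  have *: "ldot a v = expansion (gram_schmidt_rows [] A) a v" if "a \<in> set A" for a v
    using gram_schmidt_rows_correct[of "[]" k A] assms that by (simp add: in_row_span_def)
  have "ldot a u = ldot (map (cdot a) (row_basis A)) (mat_app (row_basis A) u)" if "a \<in> set A" for a
  proof (cases "gram_schmidt_rows [] A = []")
    \<comment> \<open>An empty Gram-Schmidt result means that all rows of \<open>A\<close> act as
      zero, so their coefficients at the fallback row are zero as well.\<close>
    case True
    then have "ldot a v = 0" for v using *[OF that] by (simp add: expansion_def)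
    then show ?thesis by (simp add: cdot_conv_ldot flip: expansion_conv) (simp add: expansion_def
      cdot_conv_ldot)
  next
    case False
    then show ?thesis using *[OF that] by (simp add: row_basis_def Let_def expansion_conv)
  qed
  then show ?thesis by (simp add: mat_app_def dot_mat_def comp_def)
qed

declare One_nat_def [simp]

text \<open>
  If \<open>n < r\<close>, padding with zeros makes \<open>A\<close> and \<open>B\<close> square, so that \<open>B A\<close> is the identity as well;
  but the padded \<open>B\<close> has a zero row.
\<close>

lemma right_inverse_dims:
  fixes A :: "'a :: field mat"
  assumes A: "A \<in> carrier_mat r n" and B: "B \<in> carrier_mat n r" and AB: "A * B = 1\<^sub>m r"
  shows "r \<le> n"
proof (rule ccontr)
  assume "\<not> r \<le> n"
  then have n: "n < r" by simp
  define A' where "A' = mat r r (\<lambda>(i, j). if j < n then A $$ (i, j) else 0)"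
  define B' where "B' = mat r r (\<lambda>(i, j). if i < n then B $$ (i, j) else 0)"
  have AB': "A' * B' = 1\<^sub>m r"
  proof (rule eq_matI)
    fix i j assume ij: "i < dim_row (1\<^sub>m r :: 'a mat)" "j < dim_col (1\<^sub>m r :: 'a mat)"
    then have "(A' * B') $$ (i, j) = (\<Sum>k\<in>{0..<r}. if k < n then A $$ (i, k) * B $$ (k, j) else 0)"
      by (auto simp: A'_def B'_def scalar_prod_def intro!: sum.cong)
    also have "\<dots> = (\<Sum>k\<in>{0..<n}. A $$ (i, k) * B $$ (k, j))"
      using n by (intro sum.mono_neutral_cong_right) auto
    also have "\<dots> = (A * B) $$ (i, j)"
      using A B ij by (auto simp: scalar_prod_def intro!: sum.cong)
    finally show "(A' * B') $$ (i, j) = 1\<^sub>m r $$ (i, j)" using AB by simp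
  qed (simp_all add: A'_def B'_def)
  then have "B' * A' = 1\<^sub>m r"
    by (rule mat_mult_left_right_inverse[rotated 2]) (simp_all add: A'_def B'_def)
  moreover have "(B' * A') $$ (r - 1, r - 1) = 0"
  proof -
    have dims: "dim_row B' = r" "dim_col B' = r" "dim_row A' = r" "dim_col A' = r"
      by (simp_all add: A'_def B'_def)
    have "B' $$ (r - 1, k) = 0" if "k < r" for k
      using n that by (simp add: B'_def)
    moreover have "(B' * A') $$ (r - 1, r - 1) = (\<Sum>k\<in>{0..<r}. B' $$ (r - 1, k) * A' $$ (k, r - 1))"
      using n dims by (simp add: scalar_prod_def)
    ultimately show ?thesis by simp
  qed
  ultimately show False using n by simp
qed

section \<open>Lists of rows as matrices\<close>

lemma mat_adjoint_index:
  "i < dim_col A \<Longrightarrow> j < dim_row A \<Longrightarrow> mat_adjoint A $$ (i, j) = conjugate (A $$ (j, i))"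
  by (simp add: mat_adjoint_def mat_of_rows_def)

lemma mat_adjoint_carrier: "mat_adjoint A \<in> carrier_mat (dim_col A) (dim_row A)"
  by (intro carrier_matI) (simp_all add: mat_adjoint_def)

lemma ldot_conv_sum: "length u = length v \<Longrightarrow> ldot u v = (\<Sum>i<length u. u ! i * v ! i)"
  by (induction u v rule: list_induct2) (simp_all add: sum.lessThan_Suc_shift del: sum.lessThan_Suc)

lemma mat_to_list_mat_of_rows_list:
  "\<forall>q\<in>set Q. length q = k \<Longrightarrow> mat_to_list (mat_of_rows_list k Q) = Q"
  by (auto simp: mat_to_list_def mat_of_rows_list_def intro!: nth_equalityI)

text \<open>The entries of \<open>W * mat_adjoint W\<close> are the inner products of the rows. The
  inequality of dimensions is not tracked by the algorithm; it follows from the existence of a right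
  inverse.\<close>

lemma semi_unitary_mat_of_rows_list:
  assumes Q: "orthonormal_rows Q" "\<forall>q\<in>set Q. length q = k"
  shows "semi_unitary (mat_of_rows_list k Q)"
proof -
  let ?W = "mat_of_rows_list k Q"
  have dims: "dim_row ?W = length Q" "dim_col ?W = k" by (simp_all add: mat_of_rows_list_def)
  have 1: "?W * mat_adjoint ?W = 1\<^sub>m (length Q)"
  proof (rule eq_matI)
    fix i j assume ij: "i < dim_row (1\<^sub>m (length Q) :: complex mat)" "j < dim_col (1\<^sub>m
      (length Q) :: complex mat)"
    then have len: "length (Q ! i) = k" "length (Q ! j) = k" using Q(2) by simp_all
    have "(?W * mat_adjoint ?W) $$ (i, j) = (\<Sum>l\<in>{0..<k}. Q ! i ! l * cnj (Q ! j ! l))"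
      using ij mat_adjoint_carrier[of ?W] dims
      by (auto simp: scalar_prod_def mat_adjoint_index mat_of_rows_list_def intro!: sum.cong)
    also have "\<dots> = cdot (Q ! i) (Q ! j)"
      using len by (simp add: cdot_conv_ldot ldot_conv_sum atLeast0LessThan)
    finally show "(?W * mat_adjoint ?W) $$ (i, j) = 1\<^sub>m (length Q) $$ (i, j)"
      using ij orthonormal_rows_nth[OF Q(1)] by simp
  qed (use mat_adjoint_carrier[of ?W] dims in auto)
  moreover have "length Q \<le> k"
    by (rule right_inverse_dims[OF _ _ 1]) (use mat_adjoint_carrier[of ?W] dims in auto)
  ultimately show ?thesis by (simp add: semi_unitary_def dims)
qed

section \<open>Attributes of the layers of a circuit\<close>

lemma along_Nil [simp]: "along g [] = []"
  by (simp add: along_def)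

lemma along_snoc [simp]: "along g (c @ [l]) = along g c @ [g (along g c) l]"
  by (simp add: along_def)

lemma length_along [simp]: "length (along g c) = length c"
  by (induction c rule: rev_induct) simp_all

lemma along_nth_append: "i < length c \<Longrightarrow> along g (c @ c') ! i = along g c ! i"
proof (induction c' rule: rev_induct)
  case (snoc l c')
  then have "along g (c @ c' @ [l]) ! i = along g (c @ c') ! i"
    unfolding append_assoc[symmetric] along_snoc by (simp add: nth_append)
  then show ?case using snoc by simp
qed simp

definition lout :: "'a circuit \<Rightarrow> (nat \<Rightarrow> 'a) \<Rightarrow> nat \<Rightarrow> complex list" where
  "lout c x i = list_of_vec (outputs c x ! i)"

lemma length_attr [simp]:
  "length (widths c) = length c" "length (scopes c) = length c" "length (outputs c x) = length c"
  by (simp_all add: widths_def scopes_def outputs_def)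

lemma attr_append:
  assumes "i < length c"
  shows "widths (c @ c') ! i = widths c ! i" "scopes (c @ c') ! i = scopes c ! i"
    "outputs (c @ c') x ! i = outputs c x ! i" "lout (c @ c') x i = lout c x i"
  using assms by (simp_all add: widths_def scopes_def outputs_def lout_def along_nth_append)

lemma attr_snoc:
  "widths (c @ [l]) = widths c @ [layer_width (widths c) l]"
  "scopes (c @ [l]) = scopes c @ [layer_scope (scopes c) l]"
  "outputs (c @ [l]) x = outputs c x @ [layer_output x (outputs c x) l]"
  "lout (c @ [l]) x (length c) = list_of_vec (layer_output x (outputs c x) l)"
  by (simp_all add: widths_def scopes_def outputs_def lout_def nth_append)

lemma wf_layer_append:
  "i \<le> length ws \<Longrightarrow> wf_layer d (ws @ ws') i l \<longleftrightarrow> wf_layer d ws i l"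
proof (cases l)
  case (Hadamard js)
  assume i: "i \<le> length ws"
  have "(ws @ ws') ! j = ws ! j" if "j < i" for j using i that by (simp add: nth_append)
  then show ?thesis using Hadamard by (cases js) auto
qed (auto simp: nth_append)

lemma decomposable_layer_append:
  assumes "wf_layer d ws (length ss) l"
  shows "decomposable_layer (ss @ ss') l \<longleftrightarrow> decomposable_layer ss l"
proof -
  have *: "(ss @ ss') ! (js ! p) = ss ! (js ! p)"
    if "\<forall>j\<in>set js. j < length ss" "p < length js" for js p
    using that by (simp add: nth_append)
  show ?thesis using assms by (cases l) (auto simp: *)
qed

text \<open>The part of \<open>tensorized_circuit\<close>, joined with decomposability, that passes
  to prefixes: the conditions on the output layer are left out, which permits induction over the
  list of layers.\<close>

definition valid :: "nat \<Rightarrow> 'a circuit \<Rightarrow> bool" where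
  "valid d c \<longleftrightarrow> (\<forall>i<length c. wf_layer d (widths c) i (c ! i)) \<and> decomposable c"

lemma valid_Nil [simp]: "valid d []"
  by (simp add: valid_def decomposable_def)

lemma wf_layers_snoc:
  "(\<forall>i<length (c @ [l]). wf_layer d (widths (c @ [l])) i ((c @ [l]) ! i)) \<longleftrightarrow>
   (\<forall>i<length c. wf_layer d (widths c) i (c ! i)) \<and> wf_layer d (widths c) (length c) l"
  by (auto simp: attr_snoc(1) nth_append less_Suc_eq wf_layer_append)

lemma wf_layer_mono: "wf_layer d ws i l \<Longrightarrow> i \<le> k \<Longrightarrow> wf_layer d ws k l"
  by (cases l; simp only: wf_layer.simps; meson less_le_trans)

lemma valid_snoc:
  "valid d (c @ [l]) \<longleftrightarrow> valid d c \<and> wf_layer d (widths c) (length c) l \<and>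
     decomposable_layer (scopes c) l"
proof -
  have "decomposable (c @ [l]) \<longleftrightarrow> decomposable c \<and> decomposable_layer (scopes c) l"
    if wf: "\<forall>i<length c. wf_layer d (widths c) i (c ! i)" "wf_layer d (widths c) (length c) l"
  proof -
    have "wf_layer d (widths c) (length (scopes c)) l'" if "l' \<in> set (c @ [l])" for l'
      using wf that by (auto simp: in_set_conv_nth intro: wf_layer_mono)
    note decomposable_layer_append[OF this]
    then show ?thesis
      unfolding decomposable_def attr_snoc(2) by auto
  qed
  then show ?thesis unfolding valid_def wf_layers_snoc by auto
qed

lemma valid_induct [consumes 1, case_names Nil snoc]:
  assumes "valid d c" "P []"
    and "\<And>c l. valid d c \<Longrightarrow> wf_layer d (widths c) (length c) l \<Longrightarrow> decomposable_layer (scopes c) l \<Longrightarrow>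
      P c \<Longrightarrow> P (c @ [l])"
  shows "P c"
  using assms(1)
proof (induction c rule: rev_induct)
  case (snoc l c)
  then show ?case using assms(3) by (simp add: valid_snoc)
qed (rule assms(2))

text \<open>Positive widths let the number of inputs and each partial product be bounded by the size
  of a product layer, and keep all matrices nonempty.\<close>

lemma widths_pos: "valid d c \<Longrightarrow> i < length c \<Longrightarrow> 1 \<le> widths c ! i"
proof (induction arbitrary: i rule: valid_induct)
  case (snoc c l)
  have "1 \<le> layer_width (widths c) l"
  proof (cases l)
    case (Kronecker js)
    have "1 \<le> (\<Prod>j\<leftarrow>js. widths c ! j)" if "\<forall>j\<in>set js. j < length c" for js
      using that
    proof (induction js)
      case (Cons j js)
      then show ?case using snoc.IH[of j] by (simp add: Suc_le_eq)
    qed simp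
    then show ?thesis using Kronecker snoc.hyps by simp
  next
    case (Input X fs)
    then show ?thesis using snoc.hyps(2) by (cases fs) simp_all
  next
    case (Hadamard js)
    then show ?thesis using snoc.hyps(2) snoc.IH by (cases js) simp_all
  next
    case (Sum W j)
    then show ?thesis using snoc.hyps(2) by simp
  qed
  then show ?case
    using snoc.IH snoc.prems by (cases "i = length c") (simp_all add: attr_snoc nth_append)
qed simp

text \<open>Supplies the finiteness of scopes that the factoring of integrals over product measures
  requires.\<close>

lemma scopes_subset: "valid d c \<Longrightarrow> i < length c \<Longrightarrow> scopes c ! i \<subseteq> {1..d}"
proof (induction arbitrary: i rule: valid_induct)
  case (snoc c l)
  have "layer_scope (scopes c) l \<subseteq> {1..d}"
    using snoc.hyps snoc.IH by (cases l) fastforce+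
  then show ?case
    using snoc.IH snoc.prems by (cases "i = length c") (simp_all add: attr_snoc nth_append)
qed simp

section \<open>Layer outputs as lists\<close>

lemma lkron_nth:
  "i < length a * length b \<Longrightarrow> lkron a b ! i = a ! (i div length b) * b ! (i mod length b)"
proof (induction a arbitrary: i)
  case (Cons x a)
  let ?n = "length b"
  have n: "0 < ?n" using Cons.prems by (cases b) simp_all
  show ?case
  proof (cases "i < ?n")
    case True
    then show ?thesis by (simp add: nth_append scale_def)
  next
    case False
    then obtain k where k: "i = k + ?n" by (metis add.commute le_Suc_ex not_less)
    then have "lkron a b ! k = a ! (k div ?n) * b ! (k mod ?n)"
      using Cons.IH[of k] Cons.prems by simp
    then show ?thesis using k n by (simp add: nth_append)
  qed
qed simp

lemma list_of_vec_kron_vec: "list_of_vec (kron_vec u v) = lkron (list_of_vec u) (list_of_vec v)"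
  by (rule nth_equalityI) (simp_all add: kron_vec_def lkron_nth list_of_vec_index)

lemma kronecker_vecs_Cons: "kronecker_vecs (u # us) = kron_vec u (kronecker_vecs us)"
  by (simp add: kronecker_vecs_def)

lemma list_of_vec_kronecker_vecs:
  "list_of_vec (kronecker_vecs []) = [1]"
  "list_of_vec (kronecker_vecs (u # us)) = lkron (list_of_vec u) (list_of_vec (kronecker_vecs us))"
  by (simp_all add: kronecker_vecs_Cons list_of_vec_kron_vec)
    (simp add: kronecker_vecs_def)

lemma list_of_vec_hadamard_vecs:
  "list_of_vec (hadamard_vecs [u]) = list_of_vec u"
  "us \<noteq> [] \<Longrightarrow> dim_vec (hd us) = dim_vec u \<Longrightarrow>
    list_of_vec (hadamard_vecs (u # us)) = map2 (*) (list_of_vec u) (list_of_vec (hadamard_vecs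
      us))"
  by (auto simp: hadamard_vecs_def list_of_vec_index intro!: nth_equalityI)

lemma list_of_vec_mult_mat_vec:
  assumes "dim_vec v = dim_col W"
  shows "list_of_vec (W *\<^sub>v v) = mat_app (mat_to_list W) (list_of_vec v)"
proof (rule nth_equalityI)
  fix i assume "i < length (list_of_vec (W *\<^sub>v v))"
  then have i: "i < dim_row W" by simp
  have "list_of_vec (W *\<^sub>v v) ! i = (\<Sum>j<dim_col W. W $$ (i, j) * v $ j)"
    using i assms by (auto simp: list_of_vec_index scalar_prod_def atLeast0LessThan intro!:
      sum.cong)
  also have "\<dots> = ldot (map (\<lambda>j. W $$ (i, j)) [0..<dim_col W]) (list_of_vec v)"
    using assms by (subst ldot_conv_sum) (auto simp: list_of_vec_index intro!: sum.cong)
  finally show "list_of_vec (W *\<^sub>v v) ! i = mat_app (mat_to_list W) (list_of_vec v) ! i"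
    using i by (simp add: mat_app_def mat_to_list_def)
qed (simp add: mat_app_def mat_to_list_def)

lemma dim_outputs: "valid d c \<Longrightarrow> i < length c \<Longrightarrow> dim_vec (outputs c x ! i) = widths c ! i"
proof (induction arbitrary: i rule: valid_induct)
  case (snoc c l)
  have "dim_vec (layer_output x (outputs c x) l) = layer_width (widths c) l"
  proof (cases l)
    case (Hadamard js)
    then show ?thesis using snoc.hyps(2) snoc.IH by (cases js) (simp_all add: hadamard_vecs_def)
  next
    case (Kronecker js)
    have "dim_vec (kronecker_vecs (map ((!) (outputs c x)) js)) = (\<Prod>j\<leftarrow>js. widths c ! j)"
      if "\<forall>j\<in>set js. j < length c" for js
      using that
    proof (induction js)
      case Nil
      then show ?case by (simp add: kronecker_vecs_def One_nat_def)
    next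
      case (Cons j js)
      then show ?case using snoc.IH[of j] by (simp add: kronecker_vecs_Cons kron_vec_def)
    qed
    then show ?thesis using Kronecker snoc.hyps(2) by simp
  qed simp_all
  then show ?case
    using snoc.IH snoc.prems by (cases "i = length c") (simp_all add: attr_snoc nth_append)
qed simp

lemma length_lout: "valid d c \<Longrightarrow> i < length c \<Longrightarrow> length (lout c x i) = widths c ! i"
  by (simp add: lout_def dim_outputs)

section \<open>Correctness of the rewriting\<close>

text \<open>The shapes that the rewriting emits. Restricting the new circuit to them leaves only
  binary products in the proof of orthonormality.\<close>

fun simple_layer :: "'a layer \<Rightarrow> bool" where
  "simple_layer (Input X fs) \<longleftrightarrow> True"
| "simple_layer (Hadamard js) \<longleftrightarrow> False"
| "simple_layer (Kronecker js) \<longleftrightarrow> length js = 2"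
| "simple_layer (Sum W j) \<longleftrightarrow> True"

fun orthonormal_layer :: "(nat \<Rightarrow> 'a measure) \<Rightarrow> 'a layer \<Rightarrow> bool" where
  "orthonormal_layer M (Input X fs) \<longleftrightarrow> orthonormal_functions (M X) fs"
| "orthonormal_layer M (Sum W j) \<longleftrightarrow> semi_unitary W"
| "orthonormal_layer M _ \<longleftrightarrow> True"

lemma orthonormal_circuit_iff:
  "orthonormal_circuit M c \<longleftrightarrow> (\<forall>l\<in>set c. orthonormal_layer M l)"
proof
  assume *: "orthonormal_circuit M c"
  show "\<forall>l\<in>set c. orthonormal_layer M l"
  proof
    fix l assume l: "l \<in> set c"
    show "orthonormal_layer M l"
      by (cases l) (use * l in \<open>auto simp: orthonormal_circuit_def orthonormal_inputs_def\<close>)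
  qed
qed (fastforce simp: orthonormal_circuit_def orthonormal_inputs_def)

definition built :: "(nat \<Rightarrow> 'a measure) \<Rightarrow> nat \<Rightarrow> 'a circuit \<Rightarrow> bool" where
  "built M d c \<longleftrightarrow> valid d c \<and> (\<forall>l\<in>set c. orthonormal_layer M l \<and> simple_layer l)"

lemma built_Nil [simp]: "built M d []"
  by (simp add: built_def)

lemma built_snoc:
  "built M d (c @ [l]) \<longleftrightarrow> built M d c \<and> wf_layer d (widths c) (length c) l \<and>
     decomposable_layer (scopes c) l \<and> orthonormal_layer M l \<and> simple_layer l"
  by (auto simp: built_def valid_snoc)

lemma built_valid: "built M d c \<Longrightarrow> valid d c"
  by (simp add: built_def)

text \<open>
  The invariant of the rewriting: entry \<open>(p, R)\<close> represents a layer of width \<open>K\<close>, scope \<open>S\<close>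
    and output
  \<open>F\<close> by layer \<open>p\<close> of the new circuit.
\<close>

definition entry_ok ::
  "'a circuit \<Rightarrow> entry \<Rightarrow> nat \<Rightarrow> nat set \<Rightarrow> ((nat \<Rightarrow> 'a) \<Rightarrow> complex list) \<Rightarrow> bool" where
  "entry_ok c e K S F \<longleftrightarrow> fst e < length c \<and> length (snd e) = K \<and>
     (\<forall>r\<in>set (snd e). length r = widths c ! fst e) \<and> widths c ! fst e \<le> K \<and>
     scopes c ! fst e = S \<and> (\<forall>x. F x = mat_app (snd e) (lout c x (fst e)))"

lemma entry_ok_append: "entry_ok c e K S F \<Longrightarrow> entry_ok (c @ c') e K S F"
  by (auto simp: entry_ok_def attr_append)

lemma length_mat_app [simp]: "length (mat_app R u) = length R"
  by (simp add: mat_app_def)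

lemma reduce_correct:
  assumes c: "built M d c" and p: "p < length c" and A: "A \<noteq> []" "\<forall>a\<in>set A. length a = widths c ! p"
  shows "built M d (snd (reduce p A c))"
    "entry_ok (snd (reduce p A c)) (fst (reduce p A c))
      (length A) (scopes c ! p) (\<lambda>x. mat_app A (lout c x p))"
proof -
  define k where "k = widths c ! p"
  have k: "1 \<le> k" using widths_pos[OF built_valid[OF c] p] by (simp add: k_def)
  define Q where "Q = row_basis A"
  define W where "W = mat_of_rows_list k Q"
  have Q: "Q \<noteq> []" "\<forall>q\<in>set Q. length q = k" "length Q \<le> length A" "orthonormal_rows Q"
    using row_basis_nonempty row_basis_row_length[of A k] row_basis_length[of A]
      row_basis_orthonormal[of A k] A k by (simp_all add: Q_def k_def)
  have "length (hd Q) = k" using Q(1,2) by auto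
  then have red: "reduce p A c = ((length c, dot_mat A Q), c @ [Sum W p])"
    by (simp add: reduce_def sum_layer_def Q_def W_def)
  have W: "dim_row W = length Q" "dim_col W = k" "mat_to_list W = Q" "semi_unitary W"
    using semi_unitary_mat_of_rows_list[OF Q(4,2)] mat_to_list_mat_of_rows_list[OF Q(2)]
    by (simp_all add: W_def mat_of_rows_list_def)
  have lout: "lout (c @ [Sum W p]) x (length c) = mat_app Q (lout c x p)" for x
    unfolding attr_snoc(4) using dim_outputs[OF built_valid[OF c] p] W
    by (simp add: list_of_vec_mult_mat_vec k_def lout_def)
  show "built M d (snd (reduce p A c))"
    using c p W Q(1) by (simp add: red built_snoc k_def Suc_le_eq)
  show "entry_ok (snd (reduce p A c)) (fst (reduce p A c))
    (length A) (scopes c ! p) (\<lambda>x. mat_app A (lout c x p))"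
    unfolding entry_ok_def red using Q W mat_app_row_basis[OF A(2)]
    by (auto simp: lout attr_snoc(1,2) nth_append dot_mat_def Q_def)
qed

lemma face_split_dims:
  assumes "\<forall>r\<in>set R. length r = k" "\<forall>s\<in>set S. length s = l"
  shows "length (face_split R S) = min (length R) (length S)"
    "\<forall>t\<in>set (face_split R S). length t = k * l"
proof -
  show "length (face_split R S) = min (length R) (length S)"
    by (induction R S rule: face_split.induct) simp_all
  have "\<exists>r\<in>set R. \<exists>s\<in>set S. t = lkron r s" if "t \<in> set (face_split R S)" for t
    using that by (induction R S rule: face_split.induct) auto
  then show "\<forall>t\<in>set (face_split R S). length t = k * l"
    using assms by (metis length_lkron)
qed

lemma kron_rows_dims:
  assumes "\<forall>r\<in>set R. length r = k" "\<forall>s\<in>set S. length s = l"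
  shows "length (kron_rows R S) = length R * length S"
    "\<forall>t\<in>set (kron_rows R S). length t = k * l"
proof -
  show "length (kron_rows R S) = length R * length S"
    by (induction R) simp_all
  have "\<exists>r\<in>set R. \<exists>s\<in>set S. t = lkron r s" if "t \<in> set (kron_rows R S)" for t
    using that by (induction R) auto
  then show "\<forall>t\<in>set (kron_rows R S). length t = k * l"
    using assms by (metis length_lkron)
qed

lemma lout_kronecker2:
  "lout (c @ [Kronecker [p, q]]) x (length c) = lkron (lout c x p) (lout c x q)"
  unfolding attr_snoc(4) by (simp add: list_of_vec_kronecker_vecs lout_def)

lemma combine_correct:
  assumes c: "built M d c" and e1: "entry_ok c e1 K1 S1 F1" and e2: "entry_ok c e2 K2 S2 F2"
    and S: "S1 \<inter> S2 = {}" and K: "had \<longrightarrow> K1 = K2"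
  shows "built M d (snd (combine had e1 e2 c))"
    "\<exists>l l'. snd (combine had e1 e2 c) = c @ [l, l']"
    "entry_ok (snd (combine had e1 e2 c)) (fst (combine had e1 e2 c))
       (if had then K1 else K1 * K2) (S1 \<union> S2)
       (\<lambda>x. if had then map2 (*) (F1 x) (F2 x) else lkron (F1 x) (F2 x))"
proof -
  obtain p R where pR: "e1 = (p, R)" by (cases e1)
  obtain q T where qT: "e2 = (q, T)" by (cases e2)
  note e1 = e1[unfolded entry_ok_def pR fst_conv snd_conv]
  note e2 = e2[unfolded entry_ok_def qT fst_conv snd_conv]
  define c1 where "c1 = c @ [Kronecker [p, q]]"
  define A where "A = (if had then face_split else kron_rows) R T"
  have comb: "combine had e1 e2 c = reduce (length c) A c1"
    by (simp add: combine_def pR qT A_def c1_def)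
  have pos: "1 \<le> widths c ! p" "1 \<le> widths c ! q"
    using widths_pos[OF built_valid[OF c]] e1 e2 by simp_all
  have K0: "1 \<le> K1" "1 \<le> K2" using pos e1 e2 by auto
  have dis: "decomposable_layer (scopes c) (Kronecker [p, q])"
    using e1 e2 S by (auto simp: less_Suc_eq)
  have c1: "built M d c1" "length c < length c1"
    using c e1 e2 dis by (simp_all add: c1_def built_snoc del: decomposable_layer.simps)
  have w: "widths c1 ! length c = widths c ! p * widths c ! q" "scopes c1 ! length c = S1 \<union> S2"
    using e1 e2 by (auto simp: c1_def attr_snoc nth_append)
  have A: "length A = (if had then K1 else K1 * K2)" "\<forall>a\<in>set A. length a = widths c1 ! length c"
  proof -
    have R: "\<forall>r\<in>set R. length r = widths c ! p" "length R = K1"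
      and T: "\<forall>r\<in>set T. length r = widths c ! q" "length T = K2" using e1 e2 by simp_all
    note dims = face_split_dims[OF R(1) T(1)] kron_rows_dims[OF R(1) T(1)]
    show "length A = (if had then K1 else K1 * K2)"
      unfolding A_def using dims(1,3) R(2) T(2) K by simp
    show "\<forall>a\<in>set A. length a = widths c1 ! length c"
      unfolding A_def w by (cases had) (use dims(2,4) in \<open>simp_all only: if_True if_False\<close>)
  qed
  then have A0: "A \<noteq> []" using K0 by (auto split: if_splits)
  have len: "length (lout c x p) = widths c ! p" "length (lout c x q) = widths c ! q" for x
    using length_lout[OF built_valid[OF c]] e1 e2 by simp_all
  have F: "mat_app A (lout c1 x (length c)) =
    (if had then map2 (*) (F1 x) (F2 x) else lkron (F1 x) (F2 x))" for x
    using e1 e2 len by (simp add: A_def c1_def lout_kronecker2 mat_app_face_split mat_app_kron_rows)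
  show "built M d (snd (combine had e1 e2 c))"
    unfolding comb by (rule reduce_correct(1)[OF c1 A0 A(2)])
  show "\<exists>l l'. snd (combine had e1 e2 c) = c @ [l, l']"
    unfolding comb by (simp add: reduce_def c1_def)
  show "entry_ok (snd (combine had e1 e2 c)) (fst (combine had e1 e2 c))
       (if had then K1 else K1 * K2) (S1 \<union> S2)
       (\<lambda>x. if had then map2 (*) (F1 x) (F2 x) else lkron (F1 x) (F2 x))"
    unfolding comb using reduce_correct(2)[OF c1 A0 A(2)] by (simp add: F w A(1))
qed

definition product_layer :: "bool \<Rightarrow> nat list \<Rightarrow> 'a layer" where
  "product_layer had js = (if had then Hadamard js else Kronecker js)"

text \<open>One entry for each original layer processed so far, so a layer feeding several others is
  transformed only once. Its entry stays valid because the new circuit only grows at its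
  end.\<close>

definition entries_ok :: "'a circuit \<Rightarrow> entry list \<Rightarrow> 'a circuit \<Rightarrow> bool" where
  "entries_ok c es c' \<longleftrightarrow> length es = length c \<and>
    (\<forall>j<length c. entry_ok c' (es ! j) (widths c ! j) (scopes c ! j) (\<lambda>x. lout c x j))"

lemma combine_all_Cons: "js \<noteq> [] \<Longrightarrow> combine_all had (j # js) es c =
    combine had (es ! j) (fst (combine_all had js es c)) (snd (combine_all had js es c))"
  by (cases js) (simp_all add: Let_def)

lemma decomposable_product_layer_Cons:
  "decomposable_layer ss (product_layer had (j # js) :: 'a layer) \<longleftrightarrow>
   ss ! j \<inter> (\<Union>j\<in>set js. ss ! j) = {} \<and> decomposable_layer ss (product_layer had js :: 'a layer)"
proof -
  have "(\<forall>q<length (j # js). \<forall>p<q. ss ! ((j # js) ! p) \<inter> ss ! ((j # js) ! q) = {}) \<longleftrightarrow>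
    (\<forall>q<length js. ss ! j \<inter> ss ! (js ! q) = {}) \<and>
    (\<forall>q<length js. \<forall>p<q. ss ! (js ! p) \<inter> ss ! (js ! q) = {})"
    by (simp add: All_less_Suc2) blast
  also have "(\<forall>q<length js. ss ! j \<inter> ss ! (js ! q) = {}) \<longleftrightarrow> ss ! j \<inter> (\<Union>j\<in>set js. ss ! j) = {}"
    unfolding set_conv_nth by blast
  finally show ?thesis by (simp add: product_layer_def)
qed

text \<open>The induction speaks of the product layer over each suffix of the inputs. Such a layer
  need not occur in \<open>c\<close>, but its width, scope and output are determined by the
  attributes of \<open>c\<close>. The factor \<open>2\<close> counts one Kronecker and one sum layer
  for each binary product.\<close>

lemma combine_all_correct:
  fixes c :: "'a circuit"
  assumes c': "built M d c'" and es: "entries_ok c es c'" and c: "valid d c"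
  shows "js \<noteq> [] \<Longrightarrow> wf_layer d (widths c) (length c) (product_layer had js :: 'a layer) \<Longrightarrow>
    decomposable_layer (scopes c) (product_layer had js :: 'a layer) \<Longrightarrow>
    built M d (snd (combine_all had js es c')) \<and>
    (\<exists>ls. snd (combine_all had js es c') = c' @ ls \<and> length ls \<le> 2 * length js) \<and>
    entry_ok (snd (combine_all had js es c')) (fst (combine_all had js es c'))
      (layer_width (widths c) (product_layer had js :: 'a layer)) (layer_scope (scopes c)
        (product_layer had js :: 'a layer))
      (\<lambda>x. list_of_vec (layer_output x (outputs c x) (product_layer had js :: 'a layer)))"
proof (induction js)
  case (Cons j js)
  have j: "j < length c" using Cons.prems(2) by (auto simp: product_layer_def split: if_splits)
  then have ej: "entry_ok c' (es ! j) (widths c ! j) (scopes c ! j) (\<lambda>x. lout c x j)"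
    using es by (simp add: entries_ok_def)
  show ?case
  proof (cases "js = []")
    case True
    then show ?thesis using ej c'
      by (auto simp: product_layer_def lout_def list_of_vec_hadamard_vecs
        list_of_vec_kronecker_vecs)
  next
    case False
    have w: "had \<Longrightarrow> widths c ! hd js = widths c ! j" "\<And>j'. had \<Longrightarrow> j' \<in> set js \<Longrightarrow>
      widths c ! j' = widths c ! j"
      using Cons.prems(2) False by (auto simp: product_layer_def)
    have wf: "wf_layer d (widths c) (length c) (product_layer had js :: 'a layer)"
    proof (cases had)
      case True
      then show ?thesis using Cons.prems(2) False w unfolding product_layer_def by simp
    next
      case False
      then show ?thesis using Cons.prems(2) \<open>js \<noteq> []\<close> unfolding product_layer_def by simp
    qed
    have dec: "scopes c ! j \<inter> layer_scope (scopes c) (product_layer had js :: 'a layer) = {}"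
        "decomposable_layer (scopes c) (product_layer had js :: 'a layer)"
    proof -
      have "layer_scope (scopes c) (product_layer had js :: 'a layer) = (\<Union>j\<in>set js. scopes c ! j)"
        by (simp add: product_layer_def)
      then show "scopes c ! j \<inter> layer_scope (scopes c) (product_layer had js :: 'a layer) = {}"
        using Cons.prems(3)[unfolded decomposable_product_layer_Cons] by (simp only: simp_thms)
      show "decomposable_layer (scopes c) (product_layer had js :: 'a layer)"
        using Cons.prems(3)[unfolded decomposable_product_layer_Cons] by (rule conjunct2)
    qed
    let ?r = "combine_all had js es c'"
    obtain ls where IH: "built M d (snd ?r)" "snd ?r = c' @ ls" "length ls \<le> 2 * length js"
      "entry_ok (snd ?r) (fst ?r)
      (layer_width (widths c) (product_layer had js :: 'a layer)) (layer_scope (scopes c)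
        (product_layer had js :: 'a layer))
      (\<lambda>x. list_of_vec (layer_output x (outputs c x) (product_layer had js :: 'a layer)))"
      using Cons.IH[OF False wf dec(2)] by blast
    have ej': "entry_ok (snd ?r) (es ! j) (widths c ! j) (scopes c ! j) (\<lambda>x. lout c x j)"
      using entry_ok_append[OF ej] IH(2) by simp
    have K: "had \<longrightarrow> widths c ! j = layer_width (widths c) (product_layer had js :: 'a layer)"
      using w by (simp add: product_layer_def)
    note comb = combine_correct[OF IH(1) ej' IH(4) dec(1) K]
    have hd: "hd js < length c" "\<forall>j\<in>set js. j < length c"
      using wf False by (cases js; auto simp: product_layer_def split: if_splits)+
    have out: "(if had then map2 (*) (lout c x j) (list_of_vec (layer_output x (outputs c x)
      (product_layer had js :: 'a layer)))
       else lkron (lout c x j) (list_of_vec (layer_output x (outputs c x) (product_layer had js ::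
         'a layer)))) =
       list_of_vec (layer_output x (outputs c x) (product_layer had (j # js) :: 'a layer))" for x
      using w(1) False dim_outputs[OF c, of _ x] hd(1) j
      by (simp add: product_layer_def lout_def list_of_vec_hadamard_vecs hd_map
        list_of_vec_kronecker_vecs)
    show ?thesis
      unfolding combine_all_Cons[OF False]
    proof (intro conjI)
      show "\<exists>ls. snd (combine had (es ! j) (fst ?r) (snd ?r)) = c' @ ls \<and>
        length ls \<le> 2 * length (j # js)"
        using comb(2) IH(2,3) by fastforce
      show "entry_ok (snd (combine had (es ! j) (fst ?r) (snd ?r)))
        (fst (combine had (es ! j) (fst ?r) (snd ?r)))
        (layer_width (widths c) (product_layer had (j # js) :: 'a layer))
        (layer_scope (scopes c) (product_layer had (j # js) :: 'a layer))
        (\<lambda>x. list_of_vec (layer_output x (outputs c x) (product_layer had (j # js) :: 'a layer)))"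
        using comb(3) unfolding out by (simp add: product_layer_def split: if_splits)
    qed (rule comb(1))
  qed
qed simp

text \<open>Positive widths make the size of a product layer at least its number of inputs, which
  converts the count of new layers into a multiple of \<open>layer_size\<close>.\<close>

lemma add_layer_correct:
  assumes c': "built M d c'" and es: "entries_ok c es c'" and c: "valid d c"
    and l: "wf_layer d (widths c) (length c) l" "decomposable_layer (scopes c) l"
    and inp: "\<And>X fs. l = Input X fs \<Longrightarrow> orthonormal_functions (M X) fs"
  shows "built M d (snd (add_layer l es c'))"
    "\<exists>ls. snd (add_layer l es c') = c' @ ls \<and> length ls \<le> 2 * layer_size (widths c) l"
    "entries_ok (c @ [l]) (es @ [fst (add_layer l es c')]) (snd (add_layer l es c'))"
proof -
  let ?r = "add_layer l es c'"
  have pos: "1 \<le> widths c ! j" if "j < length c" for j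
    using widths_pos[OF c that] .
  have "built M d (snd ?r) \<and> (\<exists>ls. snd ?r = c' @ ls \<and> length ls \<le> 2 * layer_size (widths c) l) \<and>
    entry_ok (snd ?r) (fst ?r) (layer_width (widths c) l) (layer_scope (scopes c) l)
      (\<lambda>x. list_of_vec (layer_output x (outputs c x) l))"
  proof (cases l)
    case (Input X fs)
    have r: "?r = ((length c', ident fs), c' @ [Input X fs])" by (simp add: Input)
    have "length fs \<ge> 1" using l Input by (cases fs) simp_all
    moreover have "\<forall>r\<in>set (ident fs). length r = length fs"
      by (induction fs) auto
    ultimately show ?thesis
      using c' l inp[OF Input] unfolding r entry_ok_def
      by (auto simp: Input built_snoc attr_snoc nth_append list_vec mat_app_ident lout_def)
  next
    case (Hadamard js)
    have js: "js \<noteq> []" "hd js < length c" using l Hadamard by (cases js; simp)+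
    have ge: "length js \<le> length js * widths c ! hd js" using pos[OF js(2)] by simp
    have le: "n \<le> 2 * layer_size (widths c) l" if "n \<le> 2 * length js" for n
      using that ge unfolding Hadamard layer_size.simps by linarith
    have eq: "product_layer True js = l" by (simp add: product_layer_def Hadamard)
    have r: "?r = combine_all True js es c'" by (simp add: Hadamard)
    show ?thesis
      unfolding r using combine_all_correct[OF c' es c js(1), of True, unfolded eq, OF l] le
        by blast
  next
    case (Kronecker js)
    have js: "js \<noteq> []" "\<forall>j\<in>set js. j < length c" using l Kronecker by simp_all
    have "1 \<le> (\<Prod>j\<leftarrow>js. widths c ! j)"
      using widths_pos[of d "c @ [l]" "length c"] c l
      by (simp add: valid_snoc attr_snoc nth_append Kronecker)
    then have ge: "length js \<le> length js * (\<Prod>j\<leftarrow>js. widths c ! j)" by simp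
    have le: "n \<le> 2 * layer_size (widths c) l" if "n \<le> 2 * length js" for n
      using that ge unfolding Kronecker layer_size.simps by linarith
    have eq: "product_layer False js = l" by (simp add: product_layer_def Kronecker)
    have r: "?r = combine_all False js es c'" by (simp add: Kronecker)
    show ?thesis
      unfolding r using combine_all_correct[OF c' es c js(1), of False, unfolded eq, OF l] le
        by blast
  next
    case (Sum W j)
    have j: "j < length c" "1 \<le> dim_row W" "dim_col W = widths c ! j" using l Sum by simp_all
    then have ej: "entry_ok c' (es ! j) (widths c ! j) (scopes c ! j) (\<lambda>x. lout c x j)"
      using es by (simp add: entries_ok_def)
    obtain p R where pR: "es ! j = (p, R)" by (cases "es ! j")
    note ej = ej[unfolded entry_ok_def pR fst_conv snd_conv]
    have R: "R \<noteq> []" "\<forall>r\<in>set R. length r = widths c' ! p" "p < length c'"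
      "\<forall>w\<in>set (mat_to_list W). length w = length R"
      using ej pos[OF j(1)] j by (auto simp: mat_to_list_def)
    let ?A = "mat_mul (mat_to_list W) R"
    have zlen: "length (zeros (hd R)) = widths c' ! p"
      using R(1,2) by simp
    have A: "?A \<noteq> []" "\<forall>a\<in>set ?A. length a = widths c' ! p" "length ?A = dim_row W"
      using j R zlen by (auto simp: mat_mul_def mat_to_list_def length_comb)
    have out: "mat_app ?A (lout c' x p) = list_of_vec (layer_output x (outputs c x) l)" for x
    proof -
      have "mat_app ?A (lout c' x p) = mat_app (mat_to_list W) (lout c x j)"
        using mat_app_mat_mul[OF R(1,2,4)] ej by simp
      also have "\<dots> = list_of_vec (W *\<^sub>v (outputs c x ! j))"
        using dim_outputs[OF c j(1)] j(3) by (simp add: list_of_vec_mult_mat_vec lout_def)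
      finally show ?thesis by (simp add: Sum)
    qed
    have r: "?r = reduce p ?A c'" by (simp add: Sum pR)
    have "1 \<le> dim_row W * dim_col W" using j pos[OF j(1)] by simp
    moreover have "snd ?r = c' @ [sum_layer (row_basis ?A) p]" by (simp add: r reduce_def)
    ultimately show ?thesis
      using reduce_correct[OF c' R(3) A(1,2)] ej unfolding r
        by (simp add: Sum A(3) out[unfolded Sum])
  qed
  then obtain ls where r: "built M d (snd ?r)" "snd ?r = c' @ ls" "length ls \<le> 2 * layer_size
    (widths c) l"
    "entry_ok (snd ?r) (fst ?r) (layer_width (widths c) l) (layer_scope (scopes c) l)
      (\<lambda>x. list_of_vec (layer_output x (outputs c x) l))" by blast
  show "built M d (snd ?r)" "\<exists>ls. snd ?r = c' @ ls \<and> length ls \<le> 2 * layer_size (widths c) l"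
    using r by blast+
  have "entry_ok (snd ?r) (es ! j) (widths c ! j) (scopes c ! j) (\<lambda>x. lout c x j)"
    if "j < length c" for j
    unfolding r(2) by (rule entry_ok_append) (use es that in \<open>simp add: entries_ok_def\<close>)
  then show "entries_ok (c @ [l]) (es @ [fst ?r]) (snd ?r)"
    using es r(4) by (auto simp: entries_ok_def attr_append less_Suc_eq nth_append attr_snoc)
qed

section \<open>Orthonormal families of functions\<close>

lemma borel_measurable_cnj [measurable]: "cnj \<in> borel_measurable borel"
  by (intro borel_measurable_continuous_onI continuous_intros)

text \<open>A non-integrable function has integral \<open>0\<close>, so the value \<open>1\<close>
  already makes both squared moduli integrable. Their sum dominates the modulus of the
  product.\<close>

lemma integrable_mult_cnj:
  fixes f g :: "'b \<Rightarrow> complex"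
  assumes [measurable]: "f \<in> borel_measurable N" "g \<in> borel_measurable N"
    and "(\<integral>x. f x * cnj (f x) \<partial>N) = 1" "(\<integral>x. g x * cnj (g x) \<partial>N) = 1"
  shows "integrable N (\<lambda>x. f x * cnj (g x))"
proof (rule Bochner_Integration.integrable_bound)
  show "integrable N (\<lambda>x. norm (f x * cnj (f x)) + norm (g x * cnj (g x)))"
    using assms(3,4) not_integrable_integral_eq
      by (intro Bochner_Integration.integrable_add integrable_norm) force+
  have "cmod (f x) * cmod (g x) \<le> cmod (f x) * cmod (f x) + cmod (g x) * cmod (g x)" for x
  proof -
    have "2 * (cmod (f x) * cmod (g x)) \<le> (cmod (f x))\<^sup>2 + (cmod (g x))\<^sup>2"
      using sum_squares_bound[of "cmod (f x)" "cmod (g x)"] by simp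
    moreover have "0 \<le> cmod (f x) * cmod (g x)" by simp
    ultimately show ?thesis unfolding power2_eq_square by linarith
  qed
  then show "AE x in N. norm (f x * cnj (g x)) \<le> norm (norm (f x * cnj (f x)) + norm (g x * cnj (g
    x)))"
    by (simp add: norm_mult)
qed measurable

text \<open>The condition on \<open>x\<close> and \<open>y\<close> says that \<open>F i\<close>
  depends only on the variables in \<open>S\<close>. It lets \<open>F i\<close>, defined on
  arbitrary assignments, be moved to a product over more variables.\<close>

definition orthonormal_family ::
  "(nat \<Rightarrow> 'a measure) \<Rightarrow> nat set \<Rightarrow> (nat \<Rightarrow> (nat \<Rightarrow> 'a) \<Rightarrow> complex) \<Rightarrow> nat \<Rightarrow> bool" where
  "orthonormal_family M S F n \<longleftrightarrow>
     (\<forall>i<n. F i \<in> borel_measurable (Pi\<^sub>M S M) \<and> (\<forall>x y. (\<forall>k\<in>S. x k = y k) \<longrightarrow> F i x = F i y)) \<and>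
     (\<forall>i<n. \<forall>j<n. (\<integral>x. F i x * cnj (F j x) \<partial>Pi\<^sub>M S M) = (if i = j then 1 else 0))"

lemma orthonormal_family_integrable:
  "orthonormal_family M S F n \<Longrightarrow> i < n \<Longrightarrow> j < n \<Longrightarrow>
    integrable (Pi\<^sub>M S M) (\<lambda>x. F i x * cnj (F j x))"
  by (rule integrable_mult_cnj) (simp_all add: orthonormal_family_def)

lemma orthonormal_family_cong:
  assumes "\<And>i x. i < n \<Longrightarrow> F i x = G i x"
  shows "orthonormal_family M S F n \<longleftrightarrow> orthonormal_family M S G n"
proof -
  have "F i = G i" if "i < n" for i using assms that by auto
  then show ?thesis by (simp add: orthonormal_family_def)
qed

context product_sigma_finite
begin

text \<open>Fubini, after splitting an assignment on \<open>I \<union> J\<close> by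
  \<open>merge\<close>. Dependence on \<open>I\<close> or \<open>J\<close> alone allows restricting
  before applying \<open>f\<close> or \<open>g\<close>, which gives measurability on the joint
  product.\<close>

lemma product_integral_mult:
  fixes f g :: "('i \<Rightarrow> 'a) \<Rightarrow> complex"
  assumes IJ: "I \<inter> J = {}" "finite I" "finite J"
    and f: "integrable (Pi\<^sub>M I M) f" "\<And>x y. (\<forall>k\<in>I. x k = y k) \<Longrightarrow> f x = f y"
    and g: "integrable (Pi\<^sub>M J M) g" "\<And>x y. (\<forall>k\<in>J. x k = y k) \<Longrightarrow> g x = g y"
  shows "(\<integral>x. f x * g x \<partial>Pi\<^sub>M (I \<union> J) M) = (\<integral>x. f x \<partial>Pi\<^sub>M I M) * (\<integral>x. g x \<partial>Pi\<^sub>M J M)"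
proof -
  interpret I: finite_product_sigma_finite M I by standard fact
  interpret J: finite_product_sigma_finite M J by standard fact
  interpret P: pair_sigma_finite "Pi\<^sub>M I M" "Pi\<^sub>M J M" ..
  have [measurable]: "f \<in> borel_measurable (Pi\<^sub>M I M)" "g \<in> borel_measurable (Pi\<^sub>M J M)"
    using f g by auto
  have fg: "f x = f (restrict x I)" "g x = g (restrict x J)" for x
    by (auto intro: f(2) g(2))
  have meas: "(\<lambda>x. f x * g x) \<in> borel_measurable (Pi\<^sub>M (I \<union> J) M)"
  proof -
    have "(\<lambda>x. f (restrict x I) * g (restrict x J)) \<in> borel_measurable (Pi\<^sub>M (I \<union> J) M)"
      by measurable
    moreover have "(\<lambda>x. f x * g x) = (\<lambda>x. f (restrict x I) * g (restrict x J))"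
      by (rule ext, subst fg(1), subst fg(2), rule refl)
    ultimately show ?thesis by simp
  qed
  have merge: "f (merge I J (x, y)) = f x" "g (merge I J (x, y)) = g y" for x y
    using IJ by (auto intro!: f(2) g(2))
  \<comment> \<open>The inner integral of the norms is \<open>norm (f x)\<close> times a constant,
    so integrability of the two factors suffices.\<close>
  have int: "integrable (Pi\<^sub>M I M \<Otimes>\<^sub>M Pi\<^sub>M J M) (\<lambda>p. f (fst p) * g (snd p))"
  proof (rule P.Fubini_integrable)
    show "integrable (Pi\<^sub>M I M) (\<lambda>x. \<integral>y. norm (f (fst (x, y)) * g (snd (x, y))) \<partial>Pi\<^sub>M J M)"
      using f(1) by (simp add: norm_mult)
  qed (use g(1) in auto)
  have "(\<integral>x. f x * g x \<partial>Pi\<^sub>M (I \<union> J) M) =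
    (\<integral>p. f (merge I J p) * g (merge I J p) \<partial>(Pi\<^sub>M I M \<Otimes>\<^sub>M Pi\<^sub>M J M))"
    by (subst distr_merge[symmetric, OF IJ]) (rule integral_distr[OF measurable_merge meas])
  also have "\<dots> = (\<integral>p. f (fst p) * g (snd p) \<partial>(Pi\<^sub>M I M \<Otimes>\<^sub>M Pi\<^sub>M J M))"
    by (intro Bochner_Integration.integral_cong) (auto simp: merge split_beta)
  also have "\<dots> = (\<integral>x. (\<integral>y. f x * g y \<partial>Pi\<^sub>M J M) \<partial>Pi\<^sub>M I M)"
    using P.integral_fst'[OF int] by simp
  finally show ?thesis by simp
qed

end

lemma orthonormal_family_input:
  assumes "product_sigma_finite M" "orthonormal_functions (M X) fs"
  shows "orthonormal_family M {X} (\<lambda>i x. (fs ! i) (x X)) (length fs)"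
proof -
  interpret product_sigma_finite M by fact
  have meas: "fs ! i \<in> borel_measurable (M X)" if "i < length fs" for i
    using assms(2) that by (simp add: orthonormal_functions_def)
  have "(\<integral>x. (fs ! i) (x X) * cnj ((fs ! j) (x X)) \<partial>Pi\<^sub>M {X} M) = (if i = j then 1 else 0)"
    if ij: "i < length fs" "j < length fs" for i j
  proof -
    have [measurable]: "fs ! i \<in> borel_measurable (M X)" "fs ! j \<in> borel_measurable (M X)"
      using meas ij by simp_all
    have "(\<lambda>y. (fs ! i) y * cnj ((fs ! j) y)) \<in> borel_measurable (M X)"
      by measurable
    from product_integral_singleton[OF this] show ?thesis
      using assms(2) ij by (simp add: orthonormal_functions_def)
  qed
  moreover have "(\<lambda>x. (fs ! i) (x X)) \<in> borel_measurable (Pi\<^sub>M {X} M)" if "i < length fs" for i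
    using measurable_compose[OF measurable_component_singleton[of X "{X}" M] meas[OF that]] by simp
  ultimately show ?thesis by (simp add: orthonormal_family_def)
qed

text \<open>Each inner product factors into two over disjoint variables, hence into two Kronecker
  deltas, and indices agree exactly when their quotients and remainders by \<open>n\<close>
  do.\<close>

lemma orthonormal_family_product:
  assumes M: "product_sigma_finite M" and ST: "S \<inter> T = {}" "finite S" "finite T"
    and F: "orthonormal_family M S F m" and G: "orthonormal_family M T G n"
  shows "orthonormal_family M (S \<union> T) (\<lambda>i x. F (i div n) x * G (i mod n) x) (m * n)"
proof -
  interpret product_sigma_finite M by fact
  have dm: "i div n < m" "i mod n < n" if "i < m * n" for i
    using that by (auto simp: less_mult_imp_div_less) (metis mod_less_divisor mult_0_right
      not_gr_zero not_less_zero)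
  have local: "F i x = F i y" if "i < m" "\<forall>k\<in>S. x k = y k" for i x y
    using F that unfolding orthonormal_family_def by blast
  have local': "G i x = G i y" if "i < n" "\<forall>k\<in>T. x k = y k" for i x y
    using G that unfolding orthonormal_family_def by blast
  have meas: "(\<lambda>x. F (i div n) x * G (i mod n) x) \<in> borel_measurable (Pi\<^sub>M (S \<union> T) M)"
    if "i < m * n" for i
  proof -
    have [measurable]: "F (i div n) \<in> borel_measurable (Pi\<^sub>M S M)" "G (i mod n) \<in> borel_measurable
      (Pi\<^sub>M T M)"
      using F G dm[OF that] by (simp_all add: orthonormal_family_def)
    have "(\<lambda>x. F (i div n) (restrict x S) * G (i mod n) (restrict x T)) \<in> borel_measurable (Pi\<^sub>M
      (S \<union> T) M)"
      by measurable
    moreover have "(\<lambda>x. F (i div n) x * G (i mod n) x) =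
        (\<lambda>x. F (i div n) (restrict x S) * G (i mod n) (restrict x T))"
      by (intro ext arg_cong2[of _ _ _ _ "(*)"] local[OF dm(1)[OF that]] local'[OF dm(2)[OF
        that]]) simp_all
    ultimately show ?thesis by simp
  qed
  have int: "(\<integral>x. (F (i div n) x * G (i mod n) x) * cnj (F (j div n) x * G (j mod n) x) \<partial>Pi\<^sub>M (S \<union>
    T) M) =
      (if i = j then 1 else 0)" if ij: "i < m * n" "j < m * n" for i j
  proof -
    note d = dm[OF ij(1)] dm[OF ij(2)]
    have "(\<integral>x. (F (i div n) x * G (i mod n) x) * cnj (F (j div n) x * G (j mod n) x) \<partial>Pi\<^sub>M (S \<union> T)
      M) =
      (\<integral>x. (F (i div n) x * cnj (F (j div n) x)) * (G (i mod n) x * cnj (G (j mod n) x)) \<partial>Pi\<^sub>M (S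
        \<union> T) M)"
      by (intro Bochner_Integration.integral_cong) (auto simp: algebra_simps)
    also have "\<dots> = (\<integral>x. F (i div n) x * cnj (F (j div n) x) \<partial>Pi\<^sub>M S M) *
        (\<integral>x. G (i mod n) x * cnj (G (j mod n) x) \<partial>Pi\<^sub>M T M)"
    proof (rule product_integral_mult[OF ST])
      show "integrable (Pi\<^sub>M S M) (\<lambda>x. F (i div n) x * cnj (F (j div n) x))"
        by (rule orthonormal_family_integrable[OF F d(1,3)])
      show "integrable (Pi\<^sub>M T M) (\<lambda>x. G (i mod n) x * cnj (G (j mod n) x))"
        by (rule orthonormal_family_integrable[OF G d(2,4)])
      show "F (i div n) x * cnj (F (j div n) x) = F (i div n) y * cnj (F (j div n) y)"
        if "\<forall>k\<in>S. x k = y k" for x y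
        using local[OF d(1) that] local[OF d(3) that] by simp
      show "G (i mod n) x * cnj (G (j mod n) x) = G (i mod n) y * cnj (G (j mod n) y)"
        if "\<forall>k\<in>T. x k = y k" for x y
        using local'[OF d(2) that] local'[OF d(4) that] by simp
    qed
    also have "\<dots> = (if i div n = j div n then 1 else 0) * (if i mod n = j mod n then 1 else 0)"
      using F G d by (simp add: orthonormal_family_def)
    also have "\<dots> = (if i = j then 1 else 0)"
      by (auto) (metis div_mult_mod_eq)
    finally show ?thesis .
  qed
  have loc: "F (i div n) x * G (i mod n) x = F (i div n) y * G (i mod n) y"
    if "i < m * n" "\<forall>k\<in>S \<union> T. x k = y k" for i x y
    using local[OF dm(1)[OF that(1)], of x y] local'[OF dm(2)[OF that(1)], of x y] that(2) by simp
  show ?thesis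
    unfolding orthonormal_family_def using meas int loc by blast
qed

text \<open>Expanding both sums and integrating term by term, the orthonormality of \<open>F\<close>
  leaves the entry \<open>(i, j)\<close> of \<open>W * mat_adjoint W\<close>.\<close>

lemma orthonormal_family_sum:
  assumes F: "orthonormal_family M S F n" and W: "semi_unitary W" "dim_col W = n"
  shows "orthonormal_family M S (\<lambda>i x. \<Sum>k<n. W $$ (i, k) * F k x) (dim_row W)"
proof -
  have meas: "(\<lambda>x. \<Sum>k<n. W $$ (i, k) * F k x) \<in> borel_measurable (Pi\<^sub>M S M)" for i
  proof (intro borel_measurable_sum borel_measurable_times)
    show "F k \<in> borel_measurable (Pi\<^sub>M S M)" if "k \<in> {..<n}" for k
      using F that by (simp add: orthonormal_family_def)
  qed simp
  have loc: "(\<Sum>k<n. W $$ (i, k) * F k x) = (\<Sum>k<n. W $$ (i, k) * F k y)"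
    if "\<forall>k\<in>S. x k = y k" for i x y
    using F that unfolding orthonormal_family_def by (intro sum.cong) auto
  have int: "(\<integral>x. (\<Sum>k<n. W $$ (i, k) * F k x) * cnj (\<Sum>k<n. W $$ (j, k) * F k x) \<partial>Pi\<^sub>M S M) =
      (if i = j then 1 else 0)" if ij: "i < dim_row W" "j < dim_row W" for i j
  proof -
    have "(\<integral>x. (\<Sum>k<n. W $$ (i, k) * F k x) * cnj (\<Sum>k<n. W $$ (j, k) * F k x) \<partial>Pi\<^sub>M S M) =
      (\<integral>x. (\<Sum>k<n. \<Sum>l<n. (W $$ (i, k) * cnj (W $$ (j, l))) * (F k x * cnj (F l x))) \<partial>Pi\<^sub>M S M)"
      by (intro Bochner_Integration.integral_cong) (simp_all add: sum_product algebra_simps)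
    also have "\<dots> = (\<Sum>k<n. \<Sum>l<n. (W $$ (i, k) * cnj (W $$ (j, l))) * (\<integral>x. F k x * cnj (F l x) \<partial>Pi\<^sub>M
      S M))"
    proof -
      have I: "integrable (Pi\<^sub>M S M) (\<lambda>x. (W $$ (i, k) * cnj (W $$ (j, l))) * (F k x * cnj (F l
        x)))"
        if "k < n" "l < n" for k l
        by (rule integrable_mult_right) (rule orthonormal_family_integrable[OF F that])
      have "(\<integral>x. (\<Sum>k<n. \<Sum>l<n. (W $$ (i, k) * cnj (W $$ (j, l))) * (F k x * cnj (F l x))) \<partial>Pi\<^sub>M S
        M) =
        (\<Sum>k<n. (\<integral>x. (\<Sum>l<n. (W $$ (i, k) * cnj (W $$ (j, l))) * (F k x * cnj (F l x))) \<partial>Pi\<^sub>M S M))"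
        by (rule Bochner_Integration.integral_sum) (rule Bochner_Integration.integrable_sum, simp
          add: I)
      also have "\<dots> = (\<Sum>k<n. \<Sum>l<n. (\<integral>x. (W $$ (i, k) * cnj (W $$ (j, l))) * (F k x * cnj (F l x))
        \<partial>Pi\<^sub>M S M))"
        by (intro sum.cong refl Bochner_Integration.integral_sum) (simp add: I)
      finally show ?thesis by (simp only: integral_mult_right_zero)
    qed
    also have "\<dots> = (\<Sum>k<n. \<Sum>l<n. (W $$ (i, k) * cnj (W $$ (j, l))) * (if k = l then 1 else 0))"
      using F by (intro sum.cong) (auto simp: orthonormal_family_def)
    also have "\<dots> = (\<Sum>k<n. W $$ (i, k) * cnj (W $$ (j, k)))"
      by (simp add: if_distrib[of "(*) _"] cong: if_cong)
    also have "\<dots> = (W * mat_adjoint W) $$ (i, j)"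
      using ij W(2) mat_adjoint_carrier[of W]
      by (auto simp: scalar_prod_def mat_adjoint_index atLeast0LessThan intro!: sum.cong)
    also have "\<dots> = (if i = j then 1 else 0)"
      using W(1) ij by (simp add: semi_unitary_def)
    finally show ?thesis .
  qed
  show ?thesis
    unfolding orthonormal_family_def using meas int loc by blast
qed

section \<open>Running time\<close>

abbreviation "enc_entry e \<equiv> VPair (enc_nat (fst e)) (enc_rows (snd e))"
abbreviation "enc_layers \<equiv> enc_list enc_layer"
abbreviation "enc_result r \<equiv> VPair (enc_entry (fst r)) (enc_layers (snd r))"

text \<open>Needed because the tree size of the result is charged. The largest layers are sum layers
  with at most \<open>N\<close> rows of \<open>N\<close> entries; the factor \<open>20\<close>
  absorbs the lower-order terms.\<close>

definition layers_bounded :: "nat \<Rightarrow> 'a circuit \<Rightarrow> bool" where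
  "layers_bounded N c \<longleftrightarrow> (\<forall>l\<in>set c. val_size (enc_layer l) \<le> 20 * (N * N))"

lemma val_size_enc_list:
  "\<forall>x\<in>set xs. val_size (enc x) \<le> b \<Longrightarrow> val_size (enc_list enc xs) \<le> length xs * (b + 1) + 1"
  by (induction xs) auto

lemma val_size_enc_vec: "val_size (enc_vec v) = 2 * length v + 1"
  by (induction v) simp_all

lemma val_size_enc_atoms: "val_size (enc_list VAtom fs) = 2 * length fs + 1"
  by (induction fs) simp_all

context
  fixes N :: nat
  assumes N: "1 \<le> N"
begin

text \<open>For linear arithmetic the nested products are atoms; these inequalities let it absorb
  lower powers of \<open>N\<close> into higher ones.\<close>

lemma N_pow:
  "N \<le> N * N" "N * N \<le> N * (N * N)" "N * (N * N) \<le> N * (N * (N * N))"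
  "N * (N * (N * N)) \<le> N * (N * (N * (N * N)))"
  "N * (N * (N * (N * N))) \<le> N * (N * (N * (N * (N * N))))"
  using N by simp_all

text \<open>Cubic because Gram-Schmidt treats up to \<open>N\<close> rows, each against up to
  \<open>N\<close> basis rows of length up to \<open>N\<close>.\<close>

lemma computes_reduce:
  fixes c :: "'a circuit"
  assumes A: "A \<noteq> []" "\<forall>a\<in>set A. length a = k" "1 \<le> k"
    and b: "length A \<le> N" "k \<le> N" "length c \<le> N" "layers_bounded N c"
  shows "computes fReduce [enc_nat p, enc_rows A, enc_layers c] (enc_result (reduce p A c))
      (1000 * (N * (N * N)))"
    "layers_bounded N (snd (reduce p A c))"
proof -
  define Q where "Q = row_basis A"
  have Q: "Q \<noteq> []" "\<forall>q\<in>set Q. length q = k" "length Q \<le> N"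
    using row_basis_nonempty row_basis_row_length[OF A] row_basis_length[OF A(1)] b
    by (auto simp: Q_def)
  have "length (hd Q) = k" using Q(1,2) by auto
  then have enc: "enc_layer (sum_layer Q p :: 'a layer) = VPair (VNum (of_nat 3)) (VPair
    (enc_rows Q) (enc_nat p))"
    using mat_to_list_mat_of_rows_list[OF Q(2)] by (simp add: sum_layer_def enc_nat_def)
  have basis: "computes fBasis [enc_rows A :: ('a \<Rightarrow> complex) val] (enc_rows Q)
      (N * (N * (60 * N + 120) + 60 * N + 200) + 30 * N + 100)"
    unfolding Q_def
    by (rule computes_weaken[OF computes_basis[OF A] refl])
      (intro add_le_mono mult_le_mono order_refl b)
  have dotMat: "computes fDotMat [enc_rows A :: ('a \<Rightarrow> complex) val, enc_rows Q]
    (enc_rows (dot_mat A Q))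
      (N * (N * (30 * N + 80) + 80) + 30)"
    by (rule computes_weaken[OF computes_dotMat[OF Q(2) A(2)] refl])
      (intro add_le_mono mult_le_mono order_refl b Q)
  have app: "computes fApp [enc_layers c,
      VPair (VPair (VNum (of_nat 3)) (VPair (enc_rows Q) (enc_nat p))) VNil]
      (enc_layers (c @ [sum_layer Q p])) (30 * length c + 30)"
    using computes_snoc[of enc_layer c "sum_layer Q p"] unfolding enc .
  have red: "reduce p A c = ((length c, dot_mat A Q), c @ [sum_layer Q p])"
    by (simp add: reduce_def Q_def)
  show "computes fReduce [enc_nat p, enc_rows A, enc_layers c] (enc_result (reduce p A c))
      (1000 * (N * (N * N)))"
    unfolding red fst_conv snd_conv
    by (rule computes_weaken, rule computes_intros, (rule ev_rules basis dotMat app computes_len)+)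
      (simp_all add: algebra_simps, (insert b N N_pow, linarith)?)
  have "val_size (enc_rows Q :: ('a \<Rightarrow> complex) val) \<le> length Q * (2 * k + 1 + 1) + 1"
    by (rule val_size_enc_list) (use Q(2) in \<open>simp add: val_size_enc_vec\<close>)
  also have "\<dots> \<le> N * (2 * N + 1 + 1) + 1"
    using Q b by (intro add_le_mono mult_le_mono order_refl)
  also have "\<dots> = 2 * (N * N) + 2 * N + 1" by (simp add: algebra_simps)
  finally have vs: "val_size (enc_rows Q :: ('a \<Rightarrow> complex) val) \<le> 2 * (N * N) + 2 * N + 1" .
  have "val_size (enc_layer (sum_layer Q p :: 'a layer)) \<le> 20 * (N * N)"
    unfolding enc by (simp add: enc_nat_def) (insert vs N N_pow, linarith)
  then show "layers_bounded N (snd (reduce p A c))"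
    using b by (auto simp: red layers_bounded_def)
qed

text \<open>\<open>K1 * K2 \<le> N\<close> bounds the rows of \<open>A\<close> and also its columns,
  since by the invariant the width of a new layer is at most \<open>K1\<close> or \<open>K2\<close>.
  The fourth power arises from bounding all four dimensions of \<open>R\<close> and \<open>T\<close>
  by \<open>N\<close> separately.\<close>

lemma computes_combine:
  fixes c :: "'a circuit"
  assumes c: "built M d c" and e1: "entry_ok c e1 K1 S1 F1" and e2: "entry_ok c e2 K2 S2 F2"
    and K: "had \<longrightarrow> K1 = K2"
    and b: "K1 * K2 \<le> N" "length c + 1 \<le> N" "layers_bounded N c"
  shows "computes fCombine [enc_nat (if had then 0 else 1), enc_entry e1, enc_entry e2, enc_layers
    c]
      (enc_result (combine had e1 e2 c)) (1700 * (N * (N * (N * N))))"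
    "layers_bounded N (snd (combine had e1 e2 c))"
proof -
  obtain p R where pR: "e1 = (p, R)" by (cases e1)
  obtain q T where qT: "e2 = (q, T)" by (cases e2)
  note e1 = e1[unfolded entry_ok_def pR fst_conv snd_conv]
  note e2 = e2[unfolded entry_ok_def qT fst_conv snd_conv]
  define k where "k = widths c ! p"
  define l where "l = widths c ! q"
  define c1 where "c1 = c @ [Kronecker [p, q]]"
  define A where "A = (if had then face_split else kron_rows) R T"
  have comb: "combine had e1 e2 c = reduce (length c) A c1"
    by (simp add: combine_def pR qT A_def c1_def)
  have pos: "1 \<le> k" "1 \<le> l"
    using widths_pos[OF built_valid[OF c]] e1 e2 by (simp_all add: k_def l_def)
  have R: "\<forall>r\<in>set R. length r = k" "length R = K1" and T: "\<forall>r\<in>set T. length r = l" "length T = K2"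
    using e1 e2 by (simp_all add: k_def l_def)
  have kl: "k \<le> K1" "l \<le> K2" using e1 e2 by (simp_all add: k_def l_def)
  have K0: "1 \<le> K1" "1 \<le> K2" using kl pos by simp_all
  have KN: "K1 \<le> N" "K2 \<le> N" "k * l \<le> N"
  proof -
    have "K1 * 1 \<le> K1 * K2" "1 * K2 \<le> K1 * K2" "k * l \<le> K1 * K2"
      by (intro mult_le_mono order_refl K0 kl)+
    then show "K1 \<le> N" "K2 \<le> N" "k * l \<le> N" using b(1) by linarith+
  qed
  have klN: "k \<le> N" "l \<le> N" using kl KN by simp_all
  note dims = face_split_dims[OF R(1) T(1)] kron_rows_dims[OF R(1) T(1)]
  have A1: "length A = (if had then K1 else K1 * K2)"
    unfolding A_def using dims(1,3) R(2) T(2) K by simp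
  have A2: "\<forall>a\<in>set A. length a = k * l"
    unfolding A_def by (cases had) (use dims(2,4) in \<open>simp_all only: if_True if_False\<close>)
  have A0: "A \<noteq> []" using A1 K0 by (auto split: if_splits)
  have AN: "length A \<le> N" using A1 KN b(1) by simp
  have kl1: "1 \<le> k * l" using pos by simp
  have "val_size (enc_layer (Kronecker [p, q] :: 'a layer)) \<le> 20 * (N * N)"
    by (simp add: enc_nat_def) (insert N N_pow, linarith)
  then have c1: "layers_bounded N c1" "length c1 \<le> N"
    using b by (auto simp: c1_def layers_bounded_def)
  note red = computes_reduce[OF A0 A2 kl1 AN KN(3) c1(2,1), of "length c"]
  have app: "computes fApp [enc_layers c,
      VPair (VPair (VNum (of_nat 2)) (VPair (enc_nat p) (VPair (enc_nat q) VNil))) VNil]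
      (enc_layers c1) (30 * length c + 30)"
    using computes_snoc[of enc_layer c "Kronecker [p, q]"] by (simp add: enc_nat_def c1_def)
  show "computes fCombine [enc_nat (if had then 0 else 1), enc_entry e1, enc_entry e2, enc_layers c]
      (enc_result (combine had e1 e2 c)) (1700 * (N * (N * (N * N))))"
  proof (cases had)
    case True
    have face: "computes fFace [enc_rows R :: ('a \<Rightarrow> complex) val, enc_rows T] (enc_rows A)
      (N * (N * (60 * N + 120) + 100) + 30)"
    proof -
      have len: "length R \<le> length T" using True K R(2) T(2) by simp
      have eq: "A = face_split R T" using True by (simp add: A_def)
      have RN: "length R \<le> N" using R(2) KN by simp
      show ?thesis unfolding eq
        by (rule computes_weaken[OF computes_face[OF len R(1) T(1)] refl])
          (intro add_le_mono mult_le_mono order_refl RN klN)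
    qed
    show ?thesis
      unfolding comb unfolding pR qT fst_conv snd_conv enc_nat_def[of "if had then 0 else 1"]
      by (rule computes_weaken, rule computes_intros,
          (rule ev_Var evs_Nil evs_Cons ev_Lit ev_Nil ev_Pair ev_Fst ev_Snd ev_IfZero1 ev_Call
            red(1) app face computes_len | (simp add: True; fail))+)
        (simp_all add: algebra_simps, (insert b N N_pow, linarith)?)
  next
    case False
    have kron: "computes fKronRows [enc_rows R :: ('a \<Rightarrow> complex) val, enc_rows T] (enc_rows A)
      (N * (N * (N * (60 * N + 120) + 130) + 120) + 30)"
    proof -
      have eq: "A = kron_rows R T" using False by (simp add: A_def)
      have RN: "length R \<le> N" "length T \<le> N" using R(2) T(2) KN by simp_all
      show ?thesis unfolding eq
        by (rule computes_weaken[OF computes_kronRows[OF R(1) T(1)] refl])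
          (intro add_le_mono mult_le_mono order_refl RN klN)
    qed
    show ?thesis
      unfolding comb unfolding pR qT fst_conv snd_conv enc_nat_def[of "if had then 0 else 1"]
      by (rule computes_weaken, rule computes_intros,
          (rule ev_Var evs_Nil evs_Cons ev_Lit ev_Nil ev_Pair ev_Fst ev_Snd ev_IfZero2 ev_Call
            red(1) app kron computes_len | (simp add: False; fail))+)
        (simp_all add: algebra_simps, (insert b N N_pow, linarith)?)
  qed
  show "layers_bounded N (snd (combine had e1 e2 c))"
    unfolding comb by (rule red(2))
qed

text \<open>\<open>s\<close> bounds every width and \<open>s * s \<le> N\<close> covers one binary
  step. Even a Hadamard step, whose result keeps its width, may meet a matrix with
  \<open>s * s\<close> columns on the way.\<close>

lemma computes_combine_all:
  fixes c c' :: "'a circuit"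
  assumes c': "built M d c'" and es: "entries_ok c es c'" and c: "valid d c"
    and b: "length c \<le> N" "layers_bounded N c'" "s * s \<le> N" "\<forall>j<length c. widths c ! j \<le> s"
  shows "js \<noteq> [] \<Longrightarrow> wf_layer d (widths c) (length c) (product_layer had js :: 'a layer) \<Longrightarrow>
    decomposable_layer (scopes c) (product_layer had js :: 'a layer) \<Longrightarrow>
    layer_width (widths c) (product_layer had js :: 'a layer) \<le> s \<Longrightarrow>
    length c' + 2 * length js \<le> N \<Longrightarrow>
    computes fCombineAll [enc_nat (if had then 0 else 1), enc_list enc_nat js, enc_list enc_entry
      es, enc_layers c']
      (enc_result (combine_all had js es c')) (length js * (1900 * (N * (N * (N * N))))) \<and>
    layers_bounded N (snd (combine_all had js es c'))"
proof (induction js)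
  case (Cons j js)
  have j: "j < length c" using Cons.prems(2) by (auto simp: product_layer_def split: if_splits)
  have jes: "j < length es" using j es by (simp add: entries_ok_def)
  have ej: "entry_ok c' (es ! j) (widths c ! j) (scopes c ! j) (\<lambda>x. lout c x j)"
    using es j by (simp add: entries_ok_def)
  have nth: "computes fNth [enc_list enc_entry es :: ('a \<Rightarrow> complex) val, enc_nat j]
    (enc_entry (es ! j)) (30 * N + 30)"
    by (rule computes_weaken[OF computes_nth[OF jes] refl]) (use j b in simp)
  show ?case
  proof (cases js)
    case Nil
    have "computes fCombineAll [enc_nat (if had then 0 else 1), VPair
      (enc_nat j) VNil, enc_list enc_entry es, enc_layers c']
      (enc_result (es ! j, c')) (1900 * (N * (N * (N * N))))"
      unfolding fst_conv snd_conv
      by (rule computes_weaken, rule computes_intros, (rule ev_rules nth)+)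
        (simp_all add: algebra_simps, (insert N N_pow, linarith)?)
    then show ?thesis using Nil b(2) by simp
  next
    case (Cons j' js')
    then have ne: "js \<noteq> []" by simp
    have w: "had \<Longrightarrow> widths c ! hd js = widths c ! j" "\<And>j'. had \<Longrightarrow> j' \<in> set js \<Longrightarrow>
      widths c ! j' = widths c ! j"
      using Cons.prems(2) ne by (auto simp: product_layer_def)
    have wf: "wf_layer d (widths c) (length c) (product_layer had js :: 'a layer)"
    proof (cases had)
      case True
      then show ?thesis using Cons.prems(2) ne w unfolding product_layer_def by simp
    next
      case False
      then show ?thesis using Cons.prems(2) ne unfolding product_layer_def by simp
    qed
    have dec: "decomposable_layer (scopes c) (product_layer had js :: 'a layer)"
      using Cons.prems(3)[unfolded decomposable_product_layer_Cons] by (rule conjunct2)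
    let ?w = "layer_width (widths c) (product_layer had js :: 'a layer)"
    \<comment> \<open>The induction needs the bound for the shorter product. In the Kronecker case
      it is inherited because the factor removed is at least \<open>1\<close>.\<close>
    have ws: "?w \<le> s"
    proof (cases had)
      case True
      then show ?thesis using Cons.prems(4) w(1) by (simp add: product_layer_def)
    next
      case False
      then have "widths c ! j * ?w \<le> s" using Cons.prems(4) by (simp add: product_layer_def)
      moreover have "1 * ?w \<le> widths c ! j * ?w"
        using widths_pos[OF c j] by (intro mult_le_mono order_refl)
      ultimately show ?thesis by linarith
    qed
    let ?r = "combine_all had js es c'"
    have IH: "computes fCombineAll [enc_nat (if had then 0 else 1), enc_list enc_nat js, enc_list
      enc_entry es, enc_layers c']
      (enc_result ?r) (length js * (1900 * (N * (N * (N * N)))))" "layers_bounded N (snd ?r)"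
      using Cons.IH[OF ne wf dec ws] Cons.prems(5) by simp_all
    obtain ls where r: "built M d (snd ?r)" "snd ?r = c' @ ls" "length ls \<le> 2 * length js"
      "entry_ok (snd ?r) (fst ?r) ?w (layer_scope (scopes c) (product_layer had js :: 'a layer))
      (\<lambda>x. list_of_vec (layer_output x (outputs c x) (product_layer had js)))"
      using combine_all_correct[OF c' es c ne wf dec] by blast
    have ej': "entry_ok (snd ?r) (es ! j) (widths c ! j) (scopes c ! j) (\<lambda>x. lout c x j)"
      unfolding r(2) by (rule entry_ok_append[OF ej])
    have K: "had \<longrightarrow> widths c ! j = ?w"
      using w by (simp add: product_layer_def)
    have "widths c ! j * ?w \<le> s * s"
      using b(4) j ws by (intro mult_le_mono) simp_all
    then have KN: "widths c ! j * ?w \<le> N" using b(3) by (rule order_trans)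
    have len: "length (snd ?r) + 1 \<le> N" using r(2,3) Cons.prems(5) by simp
    note comb = computes_combine[OF r(1) ej' r(4) K KN len IH(2)]
    note IH1 = IH(1)[unfolded Cons enc_list_simps, folded Cons]
    have "computes fCombineAll [enc_nat (if had then 0 else 1),
        VPair (enc_nat j) (VPair (enc_nat j') (enc_list enc_nat js')), enc_list enc_entry es,
          enc_layers c']
      (enc_result (combine had (es ! j) (fst ?r) (snd ?r)))
      (length (j # js) * (1900 * (N * (N * (N * N)))))"
      by (rule computes_weaken, rule computes_intros,
          (rule ev_Var evs_Nil evs_Cons ev_Lit ev_Nil ev_Pair ev_Fst ev_Snd ev_IfNil2 ev_Let
            ev_Call nth
            IH1 comb(1))+)
        (simp_all add: algebra_simps, (insert N N_pow, linarith)?)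
    then show ?thesis
      unfolding combine_all_Cons[OF ne] using comb(2) by (simp add: Cons)
  qed
qed simp

text \<open>The fifth power comes from product layers: up to \<open>N\<close> binary products of
  quartic cost. \<open>length c' + 2 * s \<le> N\<close> reserves room for the layers added.\<close>

lemma computes_layer:
  fixes c c' :: "'a circuit"
  assumes c': "built M d c'" and es: "entries_ok c es c'" and c: "valid d c"
    and l: "wf_layer d (widths c) (length c) l" "decomposable_layer (scopes c) l"
    and b: "length c \<le> N" "layers_bounded N c'" "s * s \<le> N" "\<forall>j<length c. widths c ! j \<le> s"
      "layer_size (widths c) l \<le> s" "length c' + 2 * s \<le> N"
  shows "computes fLayer [enc_layer l, enc_list enc_entry es, enc_layers c']
      (enc_result (add_layer l es c')) (3000 * (N * (N * (N * (N * N))))) \<and>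
    layers_bounded N (snd (add_layer l es c'))"
proof -
  have sN: "s \<le> N" using b(6) by simp
  have pos: "1 \<le> widths c ! j" if "j < length c" for j
    using widths_pos[OF c that] .
  \<comment> \<open>Both kinds of product layer are treated together; the two cases below only check
    that the number of inputs and the width are at most the layer size.\<close>
  have product: ?thesis if "l = product_layer had js" "js \<noteq> []" "length js \<le> s" "layer_width
    (widths c) l \<le> s"
    for had js
  proof -
    have jsN: "length c' + 2 * length js \<le> N" using b(6) that(3) by simp
    have all: "computes fCombineAll [enc_nat (if had then 0 else 1), enc_list enc_nat js, enc_list
      enc_entry es, enc_layers c']
      (enc_result (combine_all had js es c')) (length js * (1900 * (N * (N * (N * N)))))"
      "layers_bounded N (snd (combine_all had js es c'))"
      using computes_combine_all[OF c' es c b(1-4) that(2), of had] that(1,4) l jsN by auto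
    have "length js * (1900 * (N * (N * (N * N)))) \<le> N * (1900 * (N * (N * (N * N))))"
      using that(3) sN by (intro mult_le_mono order_refl) simp
    then have all1: "computes fCombineAll [enc_nat (if had then 0 else 1), enc_list enc_nat js,
      enc_list enc_entry es, enc_layers c']
      (enc_result (combine_all had js es c')) (1900 * (N * (N * (N * (N * N)))))"
      by (intro computes_weaken[OF all(1) refl]) (simp add: mult_ac)
    have r: "add_layer l es c' = combine_all had js es c'"
      by (simp add: that(1) product_layer_def)
    show ?thesis
    proof (cases had)
      case True
      have enc: "enc_layer l = VPair (VNum (of_nat 1)) (enc_list enc_nat js)"
        by (simp add: that(1) product_layer_def True enc_nat_def)
      have all2: "computes fCombineAll [VNum (of_nat 0), enc_list enc_nat js, enc_list enc_entry
        es, enc_layers c']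
        (enc_result (combine_all had js es c')) (1900 * (N * (N * (N * (N * N)))))"
        using all1 by (simp add: True enc_nat_def)
      have "computes fLayer [enc_layer l, enc_list enc_entry es, enc_layers c']
        (enc_result (combine_all had js es c')) (3000 * (N * (N * (N * (N * N)))))"
        unfolding enc
        by (rule computes_weaken, rule computes_intros, rule ev_IfZero2, (rule ev_rules)+, simp,
            rule ev_IfZero1, (rule ev_rules)+, simp, (rule ev_rules all2)+)
          (simp_all, (insert N N_pow, linarith)?)
      then show ?thesis using all(2) by (simp add: r)
    next
      case False
      have enc: "enc_layer l = VPair (VNum (of_nat 2)) (enc_list enc_nat js)"
        by (simp add: that(1) product_layer_def False enc_nat_def)
      have all2: "computes fCombineAll [VNum (of_nat 1), enc_list enc_nat js, enc_list enc_entry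
        es, enc_layers c']
        (enc_result (combine_all had js es c')) (1900 * (N * (N * (N * (N * N)))))"
        using all1 by (simp add: False enc_nat_def)
      have "computes fLayer [enc_layer l, enc_list enc_entry es, enc_layers c']
        (enc_result (combine_all had js es c')) (3000 * (N * (N * (N * (N * N)))))"
        unfolding enc
        by (rule computes_weaken, rule computes_intros, rule ev_IfZero2, (rule ev_rules)+, simp,
            rule ev_IfZero2, (rule ev_rules)+, simp, rule ev_IfZero1, (rule ev_rules)+, simp,
            (rule ev_rules all2)+)
          (simp_all, (insert N N_pow, linarith)?)
      then show ?thesis using all(2) by (simp add: r)
    qed
  qed
  show ?thesis
  proof (cases l)
    case (Input X fs)
    have fsN: "length fs \<le> N" "length fs \<le> s" using b(5) sN by (simp_all add: Input)
    have c'N: "length c' \<le> N" using b(6) by simp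
    have enc: "enc_layer l = VPair (VNum (of_nat 0)) (VPair (enc_nat X) (enc_list VAtom fs))"
      by (simp add: Input enc_nat_def)
    have ident: "computes fIdent [enc_list VAtom fs] (enc_rows (ident fs))
      (N * (60 * N + 120) + 30)"
      by (rule computes_weaken[OF computes_ident[OF fsN(1)] refl])
        (intro add_le_mono mult_le_mono order_refl fsN)
    have app: "computes fApp [enc_layers c',
        VPair (VPair (VNum (of_nat 0)) (VPair (enc_nat X) (enc_list VAtom fs))) VNil]
        (enc_layers (c' @ [Input X fs])) (30 * length c' + 30)"
      using computes_snoc[of enc_layer c' "Input X fs"] by (simp add: enc_nat_def)
    have r: "add_layer l es c' = ((length c', ident fs), c' @ [Input X fs])"
      by (simp add: Input)
    have "computes fLayer [enc_layer l, enc_list enc_entry es, enc_layers c']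
        (enc_result ((length c', ident fs), c' @ [Input X fs])) (3000 * (N * (N * (N * (N * N)))))"
      unfolding enc fst_conv snd_conv
      by (rule computes_weaken, rule computes_intros, rule ev_IfZero1, (rule ev_rules)+, simp,
          (rule ev_rules ident app computes_len)+)
        (simp_all add: algebra_simps, (insert c'N N N_pow, linarith)?)
    moreover have "val_size (enc_layer (Input X fs)) \<le> 20 * (N * N)"
      by (simp add: enc_nat_def val_size_enc_atoms) (insert fsN N N_pow, linarith)
    ultimately show ?thesis
      using b(2) unfolding r by (auto simp: layers_bounded_def)
  next
    case (Hadamard js)
    have js: "js \<noteq> []" "hd js < length c" using l Hadamard by (cases js; simp)+
    have "length js * 1 \<le> length js * widths c ! hd js" "1 * widths c ! hd js \<le> length js * widths
      c ! hd js"
      using pos[OF js(2)] js(1) by (intro mult_le_mono order_refl; cases js; simp)+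
    then have "length js \<le> s" "widths c ! hd js \<le> s"
      using b(5) unfolding Hadamard layer_size.simps by linarith+
    then show ?thesis
      by (intro product[of True js]) (simp_all add: Hadamard product_layer_def js)
  next
    case (Kronecker js)
    let ?w = "\<Prod>j\<leftarrow>js. widths c ! j"
    have js: "js \<noteq> []" using l Kronecker by simp
    have w: "1 \<le> ?w"
      using widths_pos[of d "c @ [l]" "length c"] c l
      by (simp add: valid_snoc attr_snoc nth_append Kronecker)
    have "length js * 1 \<le> length js * ?w"
      by (intro mult_le_mono order_refl w)
    moreover have "1 * ?w \<le> length js * ?w"
      using js by (intro mult_le_mono order_refl) (cases js, simp_all)
    ultimately have "length js \<le> s" "?w \<le> s"
      using b(5) unfolding Kronecker layer_size.simps by linarith+
    then show ?thesis
      by (intro product[of False js]) (simp_all add: Kronecker product_layer_def js)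
  next
    case (Sum W j)
    have j: "j < length c" "1 \<le> dim_row W" "dim_col W = widths c ! j" using l Sum by simp_all
    have jes: "j < length es" using j es by (simp add: entries_ok_def)
    have ej: "entry_ok c' (es ! j) (widths c ! j) (scopes c ! j) (\<lambda>x. lout c x j)"
      using es j by (simp add: entries_ok_def)
    obtain p R where pR: "es ! j = (p, R)" by (cases "es ! j")
    note ej = ej[unfolded entry_ok_def pR fst_conv snd_conv]
    define k where "k = widths c' ! p"
    have R: "R \<noteq> []" "\<forall>r\<in>set R. length r = k" "p < length c'"
      "\<forall>w\<in>set (mat_to_list W). length w = length R" "length R = widths c ! j" "k \<le> length R"
      using ej pos[OF j(1)] j by (auto simp: mat_to_list_def k_def)
    have k: "1 \<le> k" using widths_pos[OF built_valid[OF c'] R(3)] by (simp add: k_def)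
    let ?A = "mat_mul (mat_to_list W) R"
    have zlen: "length (zeros (hd R)) = k" using R(1,2) by simp
    have A: "?A \<noteq> []" "\<forall>a\<in>set ?A. length a = k" "length ?A = dim_row W"
      using j R zlen by (auto simp: mat_mul_def mat_to_list_def length_comb)
    have "dim_row W * 1 \<le> dim_row W * dim_col W"
      using j pos[OF j(1)] by (intro mult_le_mono order_refl) simp
    then have rowN: "dim_row W \<le> N" using b(5) sN unfolding Sum layer_size.simps by linarith
    have RN: "length R \<le> N" using R(5) b(4) j(1) sN by (metis order_trans)
    have kN: "k \<le> N" using R(6) RN by simp
    have c'N: "length c' \<le> N" using b(6) by simp
    have WN: "length (mat_to_list W) \<le> N" using rowN by (simp add: mat_to_list_def)
    have AN: "length ?A \<le> N" using A(3) rowN by simp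
    note red = computes_reduce[OF A(1,2) k AN kN c'N b(2), of p]
    have mul: "computes fMatMul [enc_rows (mat_to_list W) :: ('a \<Rightarrow> complex) val, enc_rows R]
      (enc_rows ?A)
      (N * (N * (30 * N + 90) + 30 * N + 150) + 30)"
      by (rule computes_weaken[OF computes_matMul[OF R(1,2,4)] refl])
        (intro add_le_mono mult_le_mono order_refl WN RN kN)
    have nth: "computes fNth [enc_list enc_entry es :: ('a \<Rightarrow> complex) val, enc_nat j] (VPair
      (enc_nat p) (enc_rows R)) (30 * N + 30)"
      using computes_weaken[OF computes_nth[OF jes, of enc_entry] refl, of "30 * N + 30"] j b(1)
        pR by simp
    have enc: "enc_layer l = VPair (VNum (of_nat 3)) (VPair (enc_rows (mat_to_list W)) (enc_nat j))"
      by (simp add: Sum enc_nat_def)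
    have r: "add_layer l es c' = reduce p ?A c'" by (simp add: Sum pR)
    have "computes fLayer [enc_layer l, enc_list enc_entry es, enc_layers c']
        (enc_result (reduce p ?A c')) (3000 * (N * (N * (N * (N * N)))))"
      unfolding enc
      by (rule computes_weaken, rule computes_intros, rule ev_IfZero2, (rule ev_rules)+, simp,
          rule ev_IfZero2, (rule ev_rules)+, simp, rule ev_IfZero2, (rule ev_rules)+, simp,
          (rule ev_rules nth mul red(1))+)
        (simp_all add: algebra_simps, (insert N N_pow, linarith)?)
    then show ?thesis using red(2) by (simp add: r)
  qed
qed

end

section \<open>The norm of the output\<close>

text \<open>Induction along the list of layers. As \<open>built\<close> admits only orthonormal
  inputs, binary Kronecker products and semi-unitary sums, the three closure properties of
  orthonormal families cover all cases.\<close>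

lemma orthonormal_family_layer:
  assumes M: "product_sigma_finite M"
  shows "built M d c \<Longrightarrow> p < length c \<Longrightarrow>
    orthonormal_family M (scopes c ! p) (\<lambda>i x. lout c x p ! i) (widths c ! p)"
proof (induction c arbitrary: p rule: rev_induct)
  case (snoc l c)
  have c: "built M d c" and wf: "wf_layer d (widths c) (length c) l"
    and dec: "decomposable_layer (scopes c) l"
    and l: "orthonormal_layer M l" "simple_layer l"
    using snoc.prems(1) unfolding built_snoc by auto
  note valid = built_valid[OF c]
  have fin: "finite (scopes c ! j)" if "j < length c" for j
    using scopes_subset[OF valid that] finite_subset by blast
  have "orthonormal_family M (layer_scope (scopes c) l) (\<lambda>i x. lout (c @ [l]) x (length c) ! i)
      (layer_width (widths c) l)"
  proof (cases l)
    case (Input X fs)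
    have "orthonormal_family M {X} (\<lambda>i x. (fs ! i) (x X)) (length fs)"
      by (rule orthonormal_family_input[OF M]) (use l Input in simp)
    then have "orthonormal_family M {X} (\<lambda>i x. lout (c @ [l]) x (length c) ! i) (length fs)"
      by (rule iffD1[OF orthonormal_family_cong, rotated]) (simp only: attr_snoc(4) Input
        layer_output.simps list_vec nth_map)
    then show ?thesis by (simp add: Input)
  next
    case (Hadamard js)
    then show ?thesis using l by simp
  next
    case (Kronecker js)
    then have "length js = 2" using l by simp
    then obtain q r where js: "js = [q, r]"
      by (metis (no_types, lifting) One_nat_def Suc_1 length_0_conv length_Suc_conv)
    have qr: "q < length c" "r < length c" using wf Kronecker js by simp_all
    have dis: "scopes c ! q \<inter> scopes c ! r = {}"
      using dec by (simp add: Kronecker js) (metis One_nat_def lessI nth_Cons_0 nth_Cons_Suc)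
    have "orthonormal_family M (scopes c ! q \<union> scopes c ! r)
      (\<lambda>i x. lout c x q ! (i div (widths c ! r)) * lout c x r ! (i mod (widths c ! r)))
      (widths c ! q * widths c ! r)"
      by (rule orthonormal_family_product[OF M dis fin[OF qr(1)] fin[OF qr(2)]
            snoc.IH[OF c qr(1)] snoc.IH[OF c qr(2)]])
    then have "orthonormal_family M (scopes c ! q \<union> scopes c ! r)
      (\<lambda>i x. lout (c @ [l]) x (length c) ! i) (widths c ! q * widths c ! r)"
      by (rule iffD1[OF orthonormal_family_cong, rotated])
        (simp add: Kronecker js lout_kronecker2 lkron_nth length_lout[OF valid] qr)
    then show ?thesis by (simp add: Kronecker js)
  next
    case (Sum W j)
    have j: "j < length c" "dim_col W = widths c ! j" using wf Sum by simp_all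
    have W: "semi_unitary W" using l Sum by simp
    have eq: "(\<Sum>k<widths c ! j. W $$ (i, k) * lout c x j ! k) = lout (c @ [l]) x (length c) ! i"
      if "i < dim_row W" for i x
    proof -
      have "lout (c @ [l]) x (length c) ! i = ldot (mat_to_list W ! i) (lout c x j)"
        using j dim_outputs[OF valid j(1)] that unfolding attr_snoc(4) Sum layer_output.simps
        by (simp add: list_of_vec_mult_mat_vec lout_def mat_app_def mat_to_list_def)
      also have "\<dots> = (\<Sum>k<widths c ! j. W $$ (i, k) * lout c x j ! k)"
        using that j length_lout[OF valid j(1)]
        by (subst ldot_conv_sum) (auto simp: mat_to_list_def)
      finally show ?thesis by simp
    qed
    have "orthonormal_family M (scopes c ! j) (\<lambda>i x. \<Sum>k<widths c ! j. W $$ (i, k) * lout c x j !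
      k) (dim_row W)"
      by (rule orthonormal_family_sum[OF snoc.IH[OF c j(1)] W j(2)])
    then have "orthonormal_family M (scopes c ! j) (\<lambda>i x. lout (c @ [l]) x
      (length c) ! i) (dim_row W)"
      by (rule iffD1[OF orthonormal_family_cong, rotated]) (rule eq)
    then show ?thesis by (simp add: Sum)
  qed
  moreover have "orthonormal_family M (scopes c ! p) (\<lambda>i x. lout (c @ [l]) x p ! i) (widths c ! p)"
    if "p < length c"
    using snoc.IH[OF c that] by (simp add: attr_append[OF that])
  ultimately show ?case
    using snoc.prems(2) by (cases "p = length c") (simp_all add: attr_snoc(1,2) nth_append)
qed simp

section \<open>Correctness of the whole transformation\<close>

lemma valid_appendD: "valid d (c @ c') \<Longrightarrow> valid d c"
  by (induction c' rule: rev_induct) (simp_all add: valid_snoc flip: append_assoc)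

text \<open>The loop invariant: \<open>c\<close> is the part already processed, \<open>ls\<close>
  the part still to come.\<close>

lemma add_layers_correct:
  "built M d c' \<Longrightarrow> entries_ok c es c' \<Longrightarrow> valid d (c @ ls) \<Longrightarrow>
    (\<And>X fs. Input X fs \<in> set ls \<Longrightarrow> orthonormal_functions (M X) fs) \<Longrightarrow>
    built M d (snd (add_layers ls es c')) \<and>
    entries_ok (c @ ls) (fst (add_layers ls es c')) (snd (add_layers ls es c'))"
proof (induction ls arbitrary: c es c')
  case (Cons l ls)
  have v: "valid d ((c @ [l]) @ ls)" using Cons.prems(3) by simp
  then have "valid d (c @ [l])" by (rule valid_appendD)
  then have l: "valid d c" "wf_layer d (widths c) (length c) l" "decomposable_layer (scopes c) l"
    by (simp_all add: valid_snoc)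
  have inp: "orthonormal_functions (M X) fs" if "l = Input X fs" for X fs
    using Cons.prems(4) that by simp
  note step = add_layer_correct[OF Cons.prems(1,2) l inp]
  show ?case
    using Cons.IH[OF step(1,3) v] Cons.prems(4) by (simp add: Let_def)
qed simp

lemma semi_unitary_phase:
  assumes "\<rho> \<noteq> 0"
  shows "semi_unitary (mat_of_rows_list (length [phase \<rho>]) [[phase \<rho>]])"
proof (rule semi_unitary_mat_of_rows_list)
  have "Re (\<rho> * cnj \<rho>) = (cmod \<rho>)\<^sup>2" by (simp add: complex_mult_cnj cmod_power2)
  then have "phase \<rho> = \<rho> / cmod \<rho>" by (simp add: phase_def)
  then have "phase \<rho> * cnj (phase \<rho>) = 1"
    using assms by (simp add: complex_norm_square[symmetric] power2_eq_square flip: of_real_mult)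
  then show "orthonormal_rows [[phase \<rho>]]" by simp
qed simp

text \<open>The last clause is exported for the cost proof, where a vanishing \<rho> would leave the
  final division without a result.\<close>

lemma orthonormalize_correct:
  assumes M: "product_sigma_finite M"
    and c: "tensorized_circuit d c" "decomposable c" "orthonormal_inputs M c"
    and Z: "squared_norm M d c \<noteq> 0"
  shows "tensorized_circuit d (orthonormalize c)" "valid d (orthonormalize c)"
    "orthonormal_circuit M (orthonormalize c)"
    "circuit_fun (orthonormalize c) x =
       complex_of_real (squared_norm M d c powr (- 1 / 2)) * circuit_fun c x"
    "\<exists>\<rho>. \<rho> \<noteq> 0 \<and> snd (fst (add_layers c [] []) ! (length c - 1)) = [[\<rho>]]"
proof -
  have ne: "c \<noteq> []" and valid: "valid d c"
    and last: "last (widths c) = 1" "last (scopes c) = {1..d}"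
    using c by (simp_all add: tensorized_circuit_def valid_def)
  define n where "n = length c - 1"
  have n: "n < length c" using ne by (cases c) (simp_all add: n_def)
  have ne': "widths c \<noteq> []" "scopes c \<noteq> []" "outputs c x \<noteq> []" for x
    using ne length_attr by (metis length_0_conv)+
  have wn: "widths c ! n = 1" "scopes c ! n = {1..d}" "outputs c x ! n = last (outputs c x)" for x
    using last ne' by (simp_all add: last_conv_nth n_def)
  define r where "r = add_layers c [] []"
  define c' where "c' = snd r"
  have r: "built M d c'" "entries_ok c (fst r) c'"
    using add_layers_correct[of M d "[]" "[]" "[]" c] valid c(3)
    by (simp_all add: r_def c'_def entries_ok_def orthonormal_inputs_def)
  obtain p R where pR: "fst r ! n = (p, R)" by (cases "fst r ! n")
  have e: "p < length c'" "length R = 1" "\<forall>q\<in>set R. length q = widths c' ! p" "widths c' ! p \<le> 1"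
    "scopes c' ! p = {1..d}" "\<forall>x. lout c x n = mat_app R (lout c' x p)"
    using r(2) n pR by (auto simp: entries_ok_def entry_ok_def wn)
  \<comment> \<open>The invariant gives at most \<open>1\<close> and positivity at least
    \<open>1\<close>, so \<open>R\<close> is a single number.\<close>
  have w: "widths c' ! p = 1"
    using widths_pos[OF built_valid[OF r(1)] e(1)] e(4) by simp
  obtain q where q: "R = [q]" using e(2) by (cases R) auto
  then have "length q = 1" using e(3) w by simp
  then obtain \<rho> where \<rho>: "q = [\<rho>]" by (cases q) auto
  define u where "u x = lout c' x p ! 0" for x
  have lout': "lout c' x p = [u x]" for x
  proof -
    have "length (lout c' x p) = 1" using length_lout[OF built_valid[OF r(1)] e(1)] w by simp
    then show ?thesis by (cases "lout c' x p") (auto simp: u_def)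
  qed
  have cf: "circuit_fun c x = \<rho> * u x" for x
  proof -
    have "circuit_fun c x = lout c x n ! 0"
      by (simp add: circuit_fun_def lout_def list_of_vec_index wn)
    also have "\<dots> = \<rho> * u x"
      using e(6) by (simp add: q \<rho> mat_app_def lout')
    finally show ?thesis .
  qed
  have "orthonormal_family M {1..d} (\<lambda>i x. lout c' x p ! i) 1"
    using orthonormal_family_layer[OF M r(1) e(1)] e(5) w by simp
  then have u: "(\<integral>x. u x * cnj (u x) \<partial>Pi\<^sub>M {1..d} M) = 1"
    by (simp add: orthonormal_family_def u_def)
  \<comment> \<open>The computation is lifted to complex integrals, where
    \<open>\<rho> * cnj \<rho>\<close> can be pulled out and \<open>u\<close> has norm
    \<open>1\<close>.\<close>
  have "complex_of_real (squared_norm M d c) =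
    (\<integral>x. complex_of_real ((cmod (circuit_fun c x))\<^sup>2) \<partial>Pi\<^sub>M {1..d} M)"
    unfolding squared_norm_def by (rule integral_complex_of_real[symmetric])
  also have "\<dots> = (\<integral>x. (\<rho> * cnj \<rho>) * (u x * cnj (u x)) \<partial>Pi\<^sub>M {1..d} M)"
    by (simp only: complex_norm_square cf complex_cnj_mult mult_ac)
  also have "\<dots> = \<rho> * cnj \<rho>"
    by (simp only: integral_mult_right_zero u mult_1_right)
  also have "\<dots> = complex_of_real ((cmod \<rho>)\<^sup>2)"
    by (rule complex_norm_square[symmetric])
  finally have sq: "squared_norm M d c = (cmod \<rho>)\<^sup>2"
    using of_real_eq_iff by blast
  then have \<rho>0: "\<rho> \<noteq> 0" using Z by auto
  define W where "W = mat_of_rows_list 1 [[phase \<rho>]]"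
  have W: "dim_row W = 1" "dim_col W = 1" "mat_to_list W = [[phase \<rho>]]" "semi_unitary W"
    using semi_unitary_phase[OF \<rho>0] mat_to_list_mat_of_rows_list[of "[[phase \<rho>]]" 1]
    by (simp_all add: W_def mat_of_rows_list_def)
  have len: "length (fst r) - 1 = n" using r(2) by (simp add: entries_ok_def n_def)
  have oc: "orthonormalize c = c' @ [Sum W p]"
    unfolding orthonormalize_def Let_def r_def[symmetric] c'_def[symmetric] len pR
    by (simp add: q \<rho> sum_layer_def W_def)
  have built: "built M d (orthonormalize c)"
    unfolding oc using r(1) e(1) W w by (simp add: built_snoc)
  show "valid d (orthonormalize c)" by (rule built_valid[OF built])
  show "tensorized_circuit d (orthonormalize c)"
    using built_valid[OF built] e(5) W unfolding tensorized_circuit_def valid_def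
    by (simp add: oc attr_snoc)
  show "orthonormal_circuit M (orthonormalize c)"
    using built by (simp add: built_def orthonormal_circuit_iff)
  have "circuit_fun (orthonormalize c) x = lout (orthonormalize c) x (length c') ! 0"
    by (simp add: circuit_fun_def lout_def oc attr_snoc list_of_vec_index nth_append)
  also have "\<dots> = phase \<rho> * u x"
    using dim_outputs[OF built_valid[OF r(1)] e(1)] W w lout'
    by (simp add: oc attr_snoc(4) list_of_vec_mult_mat_vec mat_app_def flip: lout_def)
  \<comment> \<open>By \<open>Z = |\<rho>|^2\<close>, dividing \<rho> by its modulus is the same as
    multiplying it by \<open>Z\<close> to the power \<open>- 1 / 2\<close>.\<close>
  also have "phase \<rho> = complex_of_real (squared_norm M d c powr (- 1 / 2)) * \<rho>"
  proof -
    have "Re (\<rho> * cnj \<rho>) = (cmod \<rho>)\<^sup>2" by (simp add: complex_mult_cnj cmod_power2)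
    then have "phase \<rho> = \<rho> / cmod \<rho>" by (simp add: phase_def)
    moreover have "squared_norm M d c powr (- 1 / 2) = 1 / cmod \<rho>"
      unfolding sq using \<rho>0 by (simp add: powr_minus_divide powr_half_sqrt)
    ultimately show ?thesis by simp
  qed
  finally show "circuit_fun (orthonormalize c) x =
       complex_of_real (squared_norm M d c powr (- 1 / 2)) * circuit_fun c x"
    by (simp add: cf)
  show "\<exists>\<rho>. \<rho> \<noteq> 0 \<and> snd (fst (add_layers c [] []) ! (length c - 1)) = [[\<rho>]]"
    unfolding r_def[symmetric] n_def[symmetric] using \<rho>0 pR q \<rho> by simp
qed

section \<open>Total running time\<close>

lemma layer_size_cong:
  "wf_layer d ws i l \<Longrightarrow> \<forall>j<i. ws ! j = ws' ! j \<Longrightarrow> layer_size ws l = layer_size ws' l"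
proof (cases l)
  case (Hadamard js)
  assume "wf_layer d ws i l" "\<forall>j<i. ws ! j = ws' ! j"
  then show ?thesis using Hadamard by (cases js) simp_all
next
  case (Kronecker js)
  assume "wf_layer d ws i l" "\<forall>j<i. ws ! j = ws' ! j"
  then have "map ((!) ws) js = map ((!) ws') js" using Kronecker by simp
  then show ?thesis unfolding Kronecker layer_size.simps by (simp only:)
qed simp_all

lemma layer_width_le_size:
  assumes "valid d c" "wf_layer d (widths c) (length c) l"
  shows "layer_width (widths c) l \<le> layer_size (widths c) l"
proof (cases l)
  case (Hadamard js)
  then show ?thesis using assms by (cases js) simp_all
next
  case (Kronecker js)
  then show ?thesis using assms by (cases js) simp_all
next
  case (Sum W j)
  then show ?thesis using assms widths_pos[of d c j] by simp
qed simp

text \<open>\<open>length c' + 2 * s * length ls\<close> is a budget for the length of the new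
  circuit: each layer processed uses at most \<open>2 * s\<close> of it, so it stays below
  \<open>N\<close> throughout the loop.\<close>

lemma computes_layers:
  fixes c c' :: "'a circuit"
  assumes N: "1 \<le> N"
  shows "built M d c' \<Longrightarrow> entries_ok c es c' \<Longrightarrow> valid d (c @ ls) \<Longrightarrow>
    (\<And>X fs. Input X fs \<in> set ls \<Longrightarrow> orthonormal_functions (M X) fs) \<Longrightarrow>
    \<forall>l\<in>set ls. layer_size (widths (c @ ls)) l \<le> s \<Longrightarrow>
    \<forall>j<length c. widths c ! j \<le> s \<Longrightarrow>
    layers_bounded N c' \<Longrightarrow> s * s \<le> N \<Longrightarrow> length (c @ ls) \<le> N \<Longrightarrow>
    length c' + 2 * s * length ls \<le> N \<Longrightarrow>
    computes fLayers [enc_layers ls, enc_list enc_entry es, enc_layers c']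
      (VPair (enc_list enc_entry (fst (add_layers ls es c')))
        (enc_layers (snd (add_layers ls es c'))))
      (length ls * (3200 * (N * (N * (N * (N * N))))) + 30) \<and>
    layers_bounded N (snd (add_layers ls es c')) \<and>
    length (snd (add_layers ls es c')) \<le> length c' + 2 * s * length ls"
proof (induction ls arbitrary: c es c')
  case Nil
  have "computes fLayers [VNil, enc_list enc_entry es, enc_layers c']
      (VPair (enc_list enc_entry es) (enc_layers c')) 30"
    by (rule computes_weaken, rule computes_intros, (rule ev_rules)+, simp_all)
  then show ?case using Nil by simp
next
  case (Cons l ls)
  have v: "valid d ((c @ [l]) @ ls)" using Cons.prems(3) by simp
  then have "valid d (c @ [l])" by (rule valid_appendD)
  then have l: "valid d c" "wf_layer d (widths c) (length c) l" "decomposable_layer (scopes c) l"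
    by (simp_all add: valid_snoc)
  have inp: "orthonormal_functions (M X) fs" if "l = Input X fs" for X fs
    using Cons.prems(4) that by simp
  \<comment> \<open>The bound \<open>s\<close> refers to widths in the whole circuit, a single step
    to widths in the prefix; both agree below position \<open>length c\<close>.\<close>
  have "layer_size (widths c) l = layer_size (widths (c @ l # ls)) l"
    by (rule layer_size_cong[OF l(2)]) (simp add: attr_append)
  then have size: "layer_size (widths c) l \<le> s" using Cons.prems(5) by simp
  let ?r = "add_layer l es c'"
  note step = add_layer_correct[OF Cons.prems(1,2) l inp]
  obtain ks where ks: "snd ?r = c' @ ks" "length ks \<le> 2 * layer_size (widths c) l"
    using step(2) by blast
  then have ks_len: "length (snd ?r) \<le> length c' + 2 * s" using size by simp
  have len: "length c' + 2 * s + 2 * s * length ls \<le> N"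
    using Cons.prems(10) by (simp add: algebra_simps)
  have cN: "length c \<le> N" "length ((c @ [l]) @ ls) \<le> N" "length es \<le> N"
    using Cons.prems(2,9) by (simp_all add: entries_ok_def)
  have "length c' + 2 * s \<le> N" using len by simp
  note cost = computes_layer[OF N Cons.prems(1,2) l cN(1) Cons.prems(7,8,6) size this]
  have w: "\<forall>j<length (c @ [l]). widths (c @ [l]) ! j \<le> s"
    using Cons.prems(6) layer_width_le_size[OF l(1,2)] size
    by (auto simp: attr_snoc nth_append less_Suc_eq)
  have sz: "\<forall>l'\<in>set ls. layer_size (widths ((c @ [l]) @ ls)) l' \<le> s"
    using Cons.prems(5) by simp
  have len': "length (snd ?r) + 2 * s * length ls \<le> N" using ks_len len by linarith
  have inps: "orthonormal_functions (M X) fs" if "Input X fs \<in> set ls" for X fs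
    using Cons.prems(4) that by simp
  note IH = Cons.IH[OF step(1,3) v inps sz w conjunct2[OF cost] Cons.prems(8) cN(2) len']
  have app: "computes fApp [enc_list enc_entry es :: ('a \<Rightarrow> complex) val, VPair
    (enc_entry (fst ?r)) VNil]
      (enc_list enc_entry (es @ [fst ?r])) (30 * N + 30)"
    by (rule computes_weaken[OF computes_app[of enc_entry es "[fst ?r]", unfolded enc_list_simps]
      refl])
      (use cN(3) in simp)
  have eq: "add_layers (l # ls) es c' = add_layers ls (es @ [fst ?r]) (snd ?r)"
    by (simp add: Let_def)
  have "computes fLayers [VPair (enc_layer l) (enc_layers ls), enc_list enc_entry es, enc_layers c']
      (VPair (enc_list enc_entry (fst (add_layers (l # ls) es c')))
        (enc_layers (snd (add_layers (l # ls) es c'))))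
      (length (l # ls) * (3200 * (N * (N * (N * (N * N))))) + 30)"
    unfolding eq
    by (rule computes_weaken, rule computes_intros,
        (rule ev_rules app conjunct1[OF cost] conjunct1[OF IH])+)
      (simp_all add: algebra_simps, (insert N N_pow[OF N], linarith)?)
  moreover have "length (snd (add_layers (l # ls) es c')) \<le> length c' + 2 * s * length (l # ls)"
    using IH ks_len unfolding eq by simp
  ultimately show ?case using IH unfolding eq by simp
qed

text \<open>At most \<open>N\<close> layers at a cost of degree \<open>5\<close> give degree
  \<open>6\<close>; reading the last entry and appending the phase layer are linear in
  \<open>N\<close>.\<close>

lemma computes_orthonormalize:
  fixes c :: "'a circuit"
  assumes c: "valid d c" "c \<noteq> []" "orthonormal_inputs M c"
    and \<rho>: "\<exists>\<rho>. \<rho> \<noteq> 0 \<and> snd (fst (add_layers c [] []) ! (length c - 1)) = [[\<rho>]]"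
    and s: "\<forall>l\<in>set c. layer_size (widths c) l \<le> s"
    and N: "1 \<le> N" "s * s \<le> N" "length c \<le> N" "2 * s * length c + 1 \<le> N"
  shows "computes 0 [enc_circuit c] (enc_circuit (orthonormalize c)) (3900 * (N * (N * (N * (N *
    (N * N))))))"
    "val_size (enc_circuit (orthonormalize c)) \<le> N * (20 * (N * N) + 1) + 1"
proof -
  obtain \<rho> where \<rho>: "\<rho> \<noteq> 0" "snd (fst (add_layers c [] []) ! (length c - 1)) = [[\<rho>]]"
    using \<rho> by blast
  define r where "r = add_layers c [] []"
  obtain p where e: "fst r ! (length c - 1) = (p, [[\<rho>]])"
    using \<rho>(2) by (metis prod.collapse r_def)
  have ok: "entries_ok ([] @ c) (fst r) (snd r)"
    using add_layers_correct[of M d "[]" "[]" "[]" c] c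
      by (simp add: r_def entries_ok_def orthonormal_inputs_def)
  then have len: "length (fst r) = length c" by (simp add: entries_ok_def)
  have loop: "computes fLayers [enc_layers c, VNil, VNil]
      (VPair (enc_list enc_entry (fst r)) (enc_layers (snd r)))
      (length c * (3200 * (N * (N * (N * (N * N))))) + 30)"
    "layers_bounded N (snd r)" "length (snd r) \<le> 2 * s * length c"
    using computes_layers[OF N(1), of M d "[]" "[]" "[]" c s] c s N
    by (simp_all add: r_def entries_ok_def orthonormal_inputs_def layers_bounded_def)
  have "length c * (3200 * (N * (N * (N * (N * N))))) \<le> N * (3200 * (N * (N * (N * (N * N)))))"
    using N by (intro mult_le_mono order_refl)
  then have loop1: "computes fLayers [enc_layers c, VNil, VNil]
      (VPair (enc_list enc_entry (fst r)) (enc_layers (snd r)))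
      (3200 * (N * (N * (N * (N * (N * N))))) + 30)"
    by (intro computes_weaken[OF loop(1) refl]) (simp add: mult_ac)
  have pos: "length c - 1 < length (fst r)" using len c(2) by (cases c) simp_all
  have idx: "VNum (of_nat (length (fst r)) - of_nat 1) = (enc_nat
    (length c - 1) :: ('a \<Rightarrow> complex) val)"
    using len c(2) by (cases c) (simp_all add: enc_nat_def)
  have nth: "computes fNth [enc_list enc_entry (fst r) :: ('a \<Rightarrow> complex) val,
      VNum (of_nat (length (fst r)) - of_nat 1)]
      (VPair (enc_nat p) (VPair (VPair (VNum \<rho>) VNil) VNil)) (30 * N + 30)"
  proof -
    have "30 * (length c - 1) + 30 \<le> 30 * N + 30" using N(3) by simp
    from computes_weaken[OF computes_nth[OF pos, of enc_entry] refl this] show ?thesis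
      unfolding idx e fst_conv snd_conv enc_list_simps .
  qed
  have len_cost: "computes fLen [enc_list enc_entry (fst r) :: ('a \<Rightarrow> complex) val] (VNum (of_nat
    (length (fst r)))) (30 * N + 30)"
    by (rule computes_weaken[OF computes_len]) (use len N in \<open>simp_all add: enc_nat_def\<close>)
  have enc: "enc_layer (sum_layer [[phase \<rho>]] p :: 'a layer) =
      VPair (VNum (of_nat 3)) (VPair (VPair (VPair (VNum (phase \<rho>)) VNil) VNil) (enc_nat p))"
    using mat_to_list_mat_of_rows_list[of "[[phase \<rho>]]" 1] by (simp add: sum_layer_def enc_nat_def)
  have oc: "orthonormalize c = snd r @ [sum_layer [[phase \<rho>]] p]"
    unfolding orthonormalize_def Let_def r_def[symmetric] len e by simp
  have app: "computes fApp [enc_layers (snd r),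
      VPair (VPair (VNum (of_nat 3)) (VPair (VPair (VPair (VNum (phase \<rho>)) VNil) VNil)
        (enc_nat p))) VNil]
      (enc_layers (orthonormalize c)) (30 * N + 30)"
    unfolding oc
    by (rule computes_weaken[OF computes_app[of enc_layer "snd r" "[sum_layer [[phase \<rho>]] p]",
      unfolded enc_list_simps enc] refl])
      (use loop(3) N in simp)
  have re: "Im (\<rho> * cnj \<rho>) = 0" "0 \<le> Re (\<rho> * cnj \<rho>)"
    by (simp_all add: complex_mult_cnj)
  have nz: "complex_of_real (sqrt (Re (\<rho> * cnj \<rho>))) \<noteq> 0"
    using \<rho>(1) by (simp add: complex_mult_cnj complex_eq_iff sum_power2_eq_zero_iff)
  note app = app[unfolded phase_def]
  show "computes 0 [enc_circuit c] (enc_circuit (orthonormalize c)) (3900 * (N * (N * (N * (N *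
    (N * N))))))"
    unfolding enc_circuit_def
    by (rule computes_weaken, rule computes_intros,
        (rule ev_rules loop1 nth len_cost app re nz)+)
      (simp_all add: algebra_simps, (insert N(1) N_pow[OF N(1)], linarith)?)
  have "\<forall>l\<in>set (orthonormalize c). val_size (enc_layer l) \<le> 20 * (N * N)"
  proof -
    have "val_size (enc_layer (sum_layer [[phase \<rho>]] p :: 'a layer)) \<le> 20 * (N * N)"
      unfolding enc by (simp add: enc_nat_def) (insert N(1) N_pow[OF N(1)], linarith)
    then show ?thesis using loop(2) by (auto simp: oc layers_bounded_def)
  qed
  then have "val_size (enc_circuit (orthonormalize c)) \<le> length (orthonormalize c) * (20 *
    (N * N) + 1) + 1"
    unfolding enc_circuit_def by (rule val_size_enc_list)
  also have "\<dots> \<le> N * (20 * (N * N) + 1) + 1"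
    using loop(3) N by (intro add_le_mono mult_le_mono order_refl) (simp add: oc)
  finally show "val_size (enc_circuit (orthonormalize c)) \<le> N * (20 * (N * N) + 1) + 1" .
qed

lemma returns_within_orthonormalize:
  fixes c :: "'a circuit"
  assumes c: "valid d c" "c \<noteq> []" "orthonormal_inputs M c"
    and \<rho>: "\<exists>\<rho>. \<rho> \<noteq> 0 \<and> snd (fst (add_layers c [] []) ! (length c - 1)) = [[\<rho>]]"
  shows "returns_within prog (enc_circuit c) (enc_circuit (orthonormalize c))
    ((4000 * 4 ^ 6) * (length c + max_layer_size c) ^ 12)"
proof -
  define s where "s = max_layer_size c"
  define S where "S = length c + s"
  \<comment> \<open>\<open>N\<close> has to dominate \<open>s * s\<close> and
    \<open>2 * s * length c + 1\<close>. Both are at most \<open>3 * (S * S)\<close> because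
    \<open>S\<close> is at least \<open>1\<close>.\<close>
  define N where "N = 4 * (S * S)"
  have size: "\<forall>l\<in>set c. layer_size (widths c) l \<le> s"
    unfolding s_def max_layer_size_def by auto
  have len: "1 \<le> length c" using c(2) by (cases c) simp_all
  have S: "1 \<le> S" "s \<le> S" "length c \<le> S" using len by (simp_all add: S_def)
  have SS: "s * s \<le> S * S" "s * length c \<le> S * S" "1 * S \<le> S * S" "1 * 1 \<le> S * S"
    using S by (intro mult_le_mono; simp)+
  have N: "1 \<le> N" "s * s \<le> N" "length c \<le> N" "2 * s * length c + 1 \<le> N"
    using S SS unfolding N_def mult.assoc by linarith+
  note cost = computes_orthonormalize[OF c \<rho> size N]
  have "ev [enc_circuit c] (ECall 0 [EVar 0]) (enc_circuit (orthonormalize c))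
      (1 + 0 + 3900 * (N * (N * (N * (N * (N * N))))) + 1)"
    by (rule ev_Call[OF evs_Cons[OF ev_Var(1) evs_Nil] cost(1)])
  then obtain t where t: "eval prog [enc_circuit c] (ECall 0 [EVar 0])
    (enc_circuit (orthonormalize c)) t"
      "t \<le> 2 + 3900 * (N * (N * (N * (N * (N * N)))))"
    unfolding ev_def by auto
  have "N * (20 * (N * N) + 1) + 1 = 20 * (N * (N * N)) + N + 1" by (simp add: algebra_simps)
  \<comment> \<open>The gap between \<open>3900\<close> and \<open>4000\<close> pays for the outer
    call and for the tree size of the result, which is only cubic in \<open>N\<close>.\<close>
  then have "t + val_size (enc_circuit (orthonormalize c)) \<le> 4000 * (N * (N * (N * (N * (N * N)))))"
    using t(2) cost(2) N(1) N_pow[OF N(1)] by linarith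
  also have "\<dots> = (4000 * 4 ^ 6) * S ^ 12"
    by (simp add: N_def power_mult_distrib power_numeral_reduce mult_ac)
  finally show ?thesis
    unfolding returns_within_def S_def s_def using t(1) by blast
qed

lemma valid_Input:
  assumes "valid d c" "Input X fs \<in> set c"
  shows "X \<in> {1..d}"
proof -
  obtain i where i: "i < length c" "c ! i = Input X fs"
    using assms(2) by (metis in_set_conv_nth)
  have "wf_layer d (widths c) i (c ! i)"
    using assms(1) i(1) unfolding valid_def by blast
  then show ?thesis by (simp add: i(2))
qed

lemma orthonormal_circuit_cong:
  assumes "valid d c" "\<forall>X\<in>{1..d}. M X = M' X"
  shows "orthonormal_circuit M c \<longleftrightarrow> orthonormal_circuit M' c"
proof -
  have "orthonormal_functions (M X) fs \<longleftrightarrow> orthonormal_functions (M' X) fs" if "Input X fs \<in> set c"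
    for X fs
    using valid_Input[OF assms(1) that] assms(2) by simp
  then show ?thesis
    unfolding orthonormal_circuit_def orthonormal_inputs_def by blast
qed

theorem theorem2:
  shows "\<exists>(P :: program) (C :: nat) (k :: nat).
    \<forall>(M :: nat \<Rightarrow> 'a measure) (d :: nat) (c :: 'a circuit).
      (\<forall>i\<in>{1..d}. sigma_finite_measure (M i)) \<longrightarrow>
      tensorized_circuit d c \<longrightarrow>
      decomposable c \<longrightarrow>
      orthonormal_inputs M c \<longrightarrow>
      squared_norm M d c \<noteq> 0 \<longrightarrow>
      (\<exists>c'. returns_within P (enc_circuit c) (enc_circuit c')
               (C * (length c + max_layer_size c) ^ k) \<and>
            tensorized_circuit d c' \<and>
            decomposable c' \<and>
            orthonormal_circuit M c' \<and>
            (\<forall>x\<in>space (Pi\<^sub>M {1..d} M).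
               circuit_fun c' x =
                 complex_of_real (squared_norm M d c powr (- 1 / 2)) * circuit_fun c x))"
proof (intro exI allI impI)
  fix M :: "nat \<Rightarrow> 'a measure" and d :: nat and c :: "'a circuit"
  assume M: "\<forall>i\<in>{1..d}. sigma_finite_measure (M i)"
    and c: "tensorized_circuit d c" "decomposable c" "orthonormal_inputs M c"
    and Z: "squared_norm M d c \<noteq> 0"
  \<comment> \<open>\<open>product_sigma_finite\<close> demands a \<sigma>-finite measure at every
    index, the theorem only at \<open>1\<close> to \<open>d\<close>. The other indices receive the
    counting measure on the empty set, which changes neither the product measure over
    \<open>{1..d}\<close> nor any input layer.\<close>
  define M' :: "nat \<Rightarrow> 'a measure" where "M' i = (if i \<in> {1..d} then M i else count_space {})" for i
  have eq: "\<forall>i\<in>{1..d}. M i = M' i" by (simp add: M'_def)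
  have M': "product_sigma_finite M'"
    by (rule product_sigma_finite.intro)
      (use M in \<open>simp add: M'_def sigma_finite_measure_count_space_finite\<close>)
  have "Pi\<^sub>M {1..d} M = Pi\<^sub>M {1..d} M'"
    by (rule PiM_cong) (use eq in auto)
  then have sq: "squared_norm M d c = squared_norm M' d c" by (simp add: squared_norm_def)
  have valid: "valid d c" and ne: "c \<noteq> []"
    using c by (simp_all add: valid_def tensorized_circuit_def)
  have inp: "orthonormal_inputs M' c"
  proof (unfold orthonormal_inputs_def, intro allI impI)
    fix X fs assume X: "Input X fs \<in> set c"
    have "M X = M' X" using eq valid_Input[OF valid X] by blast
    then show "orthonormal_functions (M' X) fs"
      using c(3) X unfolding orthonormal_inputs_def by metis
  qed
  note correct = orthonormalize_correct[OF M' c(1,2) inp Z[unfolded sq]]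
  \<comment> \<open>The schematic program, constant and exponent were introduced before
    \<open>M\<close>, \<open>d\<close> and \<open>c\<close> were fixed and so cannot depend on them;
    they are instantiated here.\<close>
  show "returns_within prog (enc_circuit c) (enc_circuit (orthonormalize c))
          ((4000 * 4 ^ 6) * (length c + max_layer_size c) ^ 12) \<and>
        tensorized_circuit d (orthonormalize c) \<and>
        decomposable (orthonormalize c) \<and>
        orthonormal_circuit M (orthonormalize c) \<and>
        (\<forall>x\<in>space (Pi\<^sub>M {1..d} M).
           circuit_fun (orthonormalize c) x =
             complex_of_real (squared_norm M d c powr (- 1 / 2)) * circuit_fun c x)"
    using returns_within_orthonormalize[OF valid ne inp correct(5)] correct(1-4)
      orthonormal_circuit_cong[OF correct(2) eq]
    by (auto simp: sq valid_def)
qed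

end
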